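(* The assignment $\alpha \mapsto \Phi(\alpha)$ is a well-defined map on equivalence classes of open virtual strings, and it defines a semigroup homomorphism $\Phi:\mathcal{M}\to \mathrm{End}(F)$ from the semigroup $\mathcal{M}$ of open virtual strings (under concatenation) to the semigroup of endomorphisms of the free group $F$; that is, $\Phi(\alpha_1\cdot\alpha_2)=\Phi(\alpha_1)\circ\Phi(\alpha_2)$ for all $\alpha_1,\alpha_2\in\mathcal{M}$, where $(f\circ g)(x)=f(g(x))$.
   Context: **Open strings.** An open virtual string (open string) is the image $\alpha$ of a generic immersion $\mathbb{R}\to\mathbb{R}^2$ (only transverse double points) with $x\mapsto(x,0)$ for $|x|$ sufficiently large, where some of the double points may be marked as "encircled" (virtual). It is oriented from left to right. Two open strings are regarded as the same if they are related by planar isotopy and a finite sequence of flat generalized Reidemeister moves: the flat (no over/under information) versions of Reidemeister moves I, II, III with all double points uncircled; the same three moves with all double points encircled; and the mixed third move, in which a strand having only encircled double points is moved past an uncircled double point. $\mathcal{M}$ denotes the semigroup of open strings under concatenation, $\alpha_1\cdot\alpha_2$ being $\alpha_1$ followed (to the right) by $\alpha_2$. **Descending diagram.** Given $\alpha$, let $D$ be the diagram obtained by travelling along $\alpha$ in its direction and resolving each uncircled double point, when first encountered, as a classical crossing such that we travel along the overcrossing strand. Encircled double points are left as virtual crossings. A classical crossing is positive if (direction of overstrand, direction of understrand) is a positively oriented basis of $\mathbb{R}^2$, and negative otherwise. The arcs of $D$ are the pieces into which the curve is cut at every passage (over or under) through a classical crossing; virtual crossings are disregarded. **Extended Alexander group.**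 Let $u=(1,0)$, $v=(0,1)$ be the standard generators of $\mathbb{Z}^2$. The group $\tilde{\mathcal{A}}$ has generators $x_{\mathbf n}$, one for each arc $x$ of $D$ and each $\mathbf n\in\mathbb{Z}^2$, and, for each classical crossing and all $\mathbf n\in\mathbb{Z}^2$, the following relations. - Positive crossing with incoming under-arc $a$, outgoing under-arc $d$, incoming over-arc $b$, outgoing over-arc $c$: $a_{\mathbf n}b_{\mathbf n+u}=c_{\mathbf n}d_{\mathbf n+u}$ and $c_{\mathbf n+v}=b_{\mathbf n}$. - Negative crossing with incoming over-arc $a$, outgoing over-arc $d$, incoming under-arc $b$, outgoing under-arc $c$: $a_{\mathbf n}b_{\mathbf n+u}=c_{\mathbf n}d_{\mathbf n+u}$ and $a_{\mathbf n+v}=d_{\mathbf n}$. $\mathbb{Z}^2$ acts on $\tilde{\mathcal{A}}$ by translating the indices. **The endomorphism $\Phi(\alpha)$.** Let $F$ be the free group on $\{a_{\mathbf n}:\mathbf n\in\mathbb{Z}^2\}$, with $\mathbb{Z}^2$ acting by translation of indices. Let $a_{-\infty}$ and $a_{+\infty}$ denote the families of generators of $\tilde{\mathcal{A}}$ of the arcs running to $-\infty$ and $+\infty$. Because $D$ is descending, $\tilde{\mathcal{A}}$ is freely generated by the family $a_{-\infty}$, so it is identified with $F$ via $(a_{-\infty})_{\mathbf n}\leftrightarrow a_{\mathbf n}$. Then $\Phi(\alpha)$ is the endomorphism of $F$ sending $a_{\mathbf n}$ to the element $(a_{+\infty})_{\mathbf n}$, expressed as a word in the generators of $F$; it commutes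 with the $\mathbb{Z}^2$-action. *)

theory Defs
  imports "HOL-Analysis.Analysis" "HOL-Algebra.Group"
begin

section \<open>Group presentations\<close>

text \<open>A word is a list of letters \<^term>\<open>(x, e)\<close>, which stands for the generator \<open>x\<close> if \<open>e\<close> is
  true and for its formal inverse otherwise.  A relation is a pair of words declared to be equal.\<close>

type_synonym 'x word = "('x \<times> bool) list"

inductive presentation_eq :: "'x set \<Rightarrow> ('x word \<times> 'x word) set \<Rightarrow> 'x word \<Rightarrow> 'x word \<Rightarrow> bool"
  for X :: "'x set" and R :: "('x word \<times> 'x word) set" where
  refl: "w \<in> lists (X \<times> UNIV) \<Longrightarrow> presentation_eq X R w w"
| sym: "presentation_eq X R v w \<Longrightarrow> presentation_eq X R w v"
| trans: "presentation_eq X R u v \<Longrightarrow> presentation_eq X R v w \<Longrightarrow> presentation_eq X R u w"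
| cong: "presentation_eq X R v w \<Longrightarrow> presentation_eq X R v' w' \<Longrightarrow>
    presentation_eq X R (v @ v') (w @ w')"
| cancel: "x \<in> X \<Longrightarrow> presentation_eq X R [(x, e), (x, \<not> e)] []"
| relation: "(v, w) \<in> R \<Longrightarrow> v \<in> lists (X \<times> UNIV) \<Longrightarrow> w \<in> lists (X \<times> UNIV) \<Longrightarrow>
    presentation_eq X R v w"

definition word_class :: "'x set \<Rightarrow> ('x word \<times> 'x word) set \<Rightarrow> 'x word \<Rightarrow> 'x word set" where
  "word_class X R w = {v. presentation_eq X R w v}"

definition presented_group ::
  "'x set \<Rightarrow> ('x word \<times> 'x word) set \<Rightarrow> 'x word set monoid" where
  "presented_group X R =
    \<lparr>carrier = word_class X R ` lists (X \<times> UNIV),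
     mult = \<lambda>A B. {w. \<exists>u\<in>A. \<exists>v\<in>B. presentation_eq X R (u @ v) w},
     one = word_class X R []\<rparr>"

definition generator :: "'x set \<Rightarrow> ('x word \<times> 'x word) set \<Rightarrow> 'x \<Rightarrow> 'x word set" where
  "generator X R x = word_class X R [(x, True)]"

definition free_group_F :: "(int \<times> int) word set monoid" where
  "free_group_F = presented_group UNIV {}"

definition F_gen :: "int \<times> int \<Rightarrow> (int \<times> int) word set" where
  "F_gen n = generator UNIV {} n"

definition End_monoid :: "('a, 'b) monoid_scheme \<Rightarrow> ('a \<Rightarrow> 'a) monoid" where
  "End_monoid G =
    \<lparr>carrier = hom G G \<inter> extensional (carrier G),
     mult = \<lambda>f g. compose (carrier G) f g,
     one = \<lambda>x\<in>carrier G. x\<rparr>"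

section \<open>Open virtual string diagrams\<close>

definition det2 :: "real \<times> real \<Rightarrow> real \<times> real \<Rightarrow> real" where
  "det2 v w = fst v * snd w - snd v * fst w"

definition velocity :: "(real \<Rightarrow> real \<times> real) \<Rightarrow> real \<Rightarrow> real \<times> real" where
  "velocity c t = vector_derivative c (at t)"

definition double_points :: "(real \<Rightarrow> real \<times> real) \<Rightarrow> (real \<times> real) set" where
  "double_points c = {p. \<exists>s t. s \<noteq> t \<and> c s = p \<and> c t = p}"

definition generic_immersion :: "(real \<Rightarrow> real \<times> real) \<Rightarrow> bool" where
  "generic_immersion c \<longleftrightarrow>
    c C1_differentiable_on UNIV \<and> (\<forall>t. velocity c t \<noteq> 0) \<and>
    finite (double_points c) \<and>
    (\<forall>s t. s \<noteq> t \<and> c s = c t \<longrightarrow> det2 (velocity c s) (velocity c t) \<noteq> 0) \<and>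
    (\<forall>s t u. c s = c t \<and> c t = c u \<longrightarrow> s = t \<or> t = u \<or> s = u)"

text \<open>A diagram is a parametrised curve with the set of its encircled double points.  The choice of
  the (increasing) parametrisation is factored out by \<open>planar_isotopy\<close> below.\<close>

type_synonym diagram = "(real \<Rightarrow> real \<times> real) \<times> (real \<times> real) set"

definition open_strings :: "diagram set" where
  "open_strings = {(c, V). generic_immersion c \<and> (\<exists>K. \<forall>x. \<bar>x\<bar> \<ge> K \<longrightarrow> c x = (x, 0)) \<and>
    V \<subseteq> double_points c}"

subsection \<open>Planar isotopy\<close>

definition orientation_preserving_diffeo :: "(real \<times> real \<Rightarrow> real \<times> real) \<Rightarrow> bool" where
  "orientation_preserving_diffeo h \<longleftrightarrow> bij h \<and>
    (\<exists>D. (\<forall>p. (h has_derivative D p) (at p)) \<and>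
         (\<forall>v. continuous_on UNIV (\<lambda>p. D p v)) \<and>
         (\<forall>p. det2 (D p (1, 0)) (D p (0, 1)) > 0))"

definition ambient_isotopy :: "(real \<Rightarrow> real \<times> real \<Rightarrow> real \<times> real) \<Rightarrow> bool" where
  "ambient_isotopy H \<longleftrightarrow>
    (\<forall>p. H 0 p = p) \<and>
    (\<forall>t\<in>{0..1}. orientation_preserving_diffeo (H t)) \<and>
    continuous_on ({0..1} \<times> UNIV) (\<lambda>(t, p). H t p) \<and>
    (\<forall>v. continuous_on ({0..1} \<times> UNIV) (\<lambda>(t, p). frechet_derivative (H t) (at p) v)) \<and>
    (\<exists>K. \<forall>t\<in>{0..1}. \<forall>p. norm p \<ge> K \<longrightarrow> H t p = p)"

definition planar_isotopy :: "diagram \<Rightarrow> diagram \<Rightarrow> bool" where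
  "planar_isotopy \<alpha> \<beta> \<longleftrightarrow>
    (\<exists>H r. ambient_isotopy H \<and>
      bij r \<and> (\<forall>t. \<exists>d>0. (r has_real_derivative d) (at t)) \<and>
      (\<forall>t. fst \<beta> t = H 1 (fst \<alpha> (r t))) \<and>
      snd \<beta> = H 1 ` snd \<alpha>)"

subsection \<open>Flat generalized Reidemeister moves\<close>

text \<open>A move takes place in a disc \<open>\<psi> ` square\<close>.  In the coordinates given by \<open>\<psi>\<close>, the part of a string
  in the disc consists of \<open>n\<close> strands \<open>\<gamma> 0, \<dots>, \<gamma> (n-1)\<close>, running from the left to the right side
  of the square.  The string passes through \<open>\<psi> (\<gamma> i x)\<close> at time \<open>\<tau> i x\<close>; as each \<open>\<tau> i\<close> may be
  increasing or decreasing and the time intervals come in any order, all orientations and orders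
  of traversal of the strands are covered.\<close>

definition square :: "(real \<times> real) set" where
  "square = {-1..1} \<times> {-1..1}"

definition strand :: "(real \<Rightarrow> real \<times> real) \<Rightarrow> bool" where
  "strand \<gamma> \<longleftrightarrow> \<gamma> differentiable_on {-1..1} \<and>
    \<gamma> ` {-1<..<1} \<subseteq> {-1<..<1} \<times> {-1<..<1} \<and>
    \<gamma> (-1) \<in> {-1} \<times> {-1<..<1} \<and> \<gamma> 1 \<in> {1} \<times> {-1<..<1}"

definition meets_disc_in ::
  "(real \<times> real \<Rightarrow> real \<times> real) \<Rightarrow> nat \<Rightarrow> (nat \<Rightarrow> real \<Rightarrow> real) \<Rightarrow> (real \<Rightarrow> real \<times> real)
    \<Rightarrow> (nat \<Rightarrow> real \<Rightarrow> real \<times> real) \<Rightarrow> bool" where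
  "meets_disc_in \<psi> n \<tau> c \<gamma> \<longleftrightarrow>
    {t. c t \<in> \<psi> ` square} = (\<Union>i<n. \<tau> i ` {-1..1}) \<and>
    (\<forall>i<n. strand (\<gamma> i) \<and> (\<forall>x\<in>{-1..1}. c (\<tau> i x) = \<psi> (\<gamma> i x)))"

definition tangle_replacement ::
  "(real \<times> real \<Rightarrow> real \<times> real) \<Rightarrow> nat \<Rightarrow> diagram \<Rightarrow> (nat \<Rightarrow> real \<Rightarrow> real \<times> real)
    \<Rightarrow> diagram \<Rightarrow> (nat \<Rightarrow> real \<Rightarrow> real \<times> real) \<Rightarrow> bool" where
  "tangle_replacement \<psi> n \<alpha> \<gamma> \<beta> \<delta> \<longleftrightarrow>
    orientation_preserving_diffeo \<psi> \<and>
    (\<exists>\<tau>. inj_on (\<lambda>(i, x). \<tau> i x) ({..<n} \<times> {-1..1}) \<and>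
         (\<forall>i<n. \<forall>x\<in>{-1..1}. \<exists>d. d \<noteq> 0 \<and> (\<tau> i has_real_derivative d) (at x within {-1..1})) \<and>
         meets_disc_in \<psi> n \<tau> (fst \<alpha>) \<gamma> \<and> meets_disc_in \<psi> n \<tau> (fst \<beta>) \<delta> \<and>
         (\<forall>t. t \<notin> (\<Union>i<n. \<tau> i ` {-1<..<1}) \<longrightarrow> fst \<alpha> t = fst \<beta> t)) \<and>
    snd \<alpha> - \<psi> ` square = snd \<beta> - \<psi> ` square"

definition graph_strand :: "(real \<Rightarrow> real) \<Rightarrow> real \<Rightarrow> real \<times> real" where
  "graph_strand f x = (x, f x)"

text \<open>First move: an embedded strand is replaced by one with a single self-crossing (a curl).  The
  new double point may be encircled or not.\<close>

definition reidemeister1 :: "diagram \<Rightarrow> diagram \<Rightarrow> bool" where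
  "reidemeister1 \<alpha> \<beta> \<longleftrightarrow>
    (\<exists>\<psi> \<gamma> \<delta> p q. tangle_replacement \<psi> 1 \<alpha> \<gamma> \<beta> \<delta> \<and>
      inj_on (\<gamma> 0) {-1..1} \<and>
      -1 < p \<and> p < q \<and> q < 1 \<and>
      (\<forall>x\<in>{-1..1}. \<forall>y\<in>{-1..1}. x < y \<longrightarrow> (\<delta> 0 x = \<delta> 0 y \<longleftrightarrow> x = p \<and> y = q)))"

text \<open>Second move: two disjoint strands are replaced by two strands crossing twice; the two new
  double points are both encircled or both uncircled.\<close>

definition reidemeister2 :: "diagram \<Rightarrow> diagram \<Rightarrow> bool" where
  "reidemeister2 \<alpha> \<beta> \<longleftrightarrow>
    (\<exists>\<psi> f g p q.
      tangle_replacement \<psi> 2 \<alpha> (\<lambda>i. graph_strand (f i)) \<beta> (\<lambda>i. graph_strand (g i)) \<and>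
      (\<forall>x\<in>{-1..1}. f 0 x < f 1 x) \<and>
      -1 < p \<and> p < q \<and> q < 1 \<and>
      (\<forall>x\<in>{-1..1}. g 0 x = g 1 x \<longleftrightarrow> x = p \<or> x = q) \<and>
      (\<psi> (p, g 0 p) \<in> snd \<beta> \<longleftrightarrow> \<psi> (q, g 0 q) \<in> snd \<beta>))"

text \<open>Third move: of three strands any two cross exactly once, and the order (from left to right) of
  the three crossings is reversed, each crossing keeping its marking.  With \<open>A\<close>, \<open>B\<close>, \<open>C\<close> expressing
  that the respective crossing is encircled, the last conjunct admits the flat move (none
  encircled), the purely virtual move (all encircled) and the mixed move (exactly two encircled;
  the strand common to these two is moved past the uncircled double point), and excludes the move
  with exactly two uncircled double points.\<close>

definition reidemeister3 :: "diagram \<Rightarrow> diagram \<Rightarrow> bool" where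
  "reidemeister3 \<alpha> \<beta> \<longleftrightarrow>
    (\<exists>\<psi> f g p q r p' q' r' A B C.
      tangle_replacement \<psi> 3 \<alpha> (\<lambda>i. graph_strand (f i)) \<beta> (\<lambda>i. graph_strand (g i)) \<and>
      f 0 (-1) < f 1 (-1) \<and> f 1 (-1) < f 2 (-1) \<and>
      -1 < p \<and> p < q \<and> q < r \<and> r < 1 \<and>
      (\<forall>x\<in>{-1..1}. (f 0 x = f 1 x \<longleftrightarrow> x = p) \<and> (f 0 x = f 2 x \<longleftrightarrow> x = q) \<and>
                   (f 1 x = f 2 x \<longleftrightarrow> x = r)) \<and>
      -1 < r' \<and> r' < q' \<and> q' < p' \<and> p' < 1 \<and>
      (\<forall>x\<in>{-1..1}. (g 0 x = g 1 x \<longleftrightarrow> x = p') \<and> (g 0 x = g 2 x \<longleftrightarrow> x = q') \<and>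
                   (g 1 x = g 2 x \<longleftrightarrow> x = r')) \<and>
      (\<psi> (p, f 0 p) \<in> snd \<alpha> \<longleftrightarrow> A) \<and> (\<psi> (p', g 0 p') \<in> snd \<beta> \<longleftrightarrow> A) \<and>
      (\<psi> (q, f 0 q) \<in> snd \<alpha> \<longleftrightarrow> B) \<and> (\<psi> (q', g 0 q') \<in> snd \<beta> \<longleftrightarrow> B) \<and>
      (\<psi> (r, f 1 r) \<in> snd \<alpha> \<longleftrightarrow> C) \<and> (\<psi> (r', g 1 r') \<in> snd \<beta> \<longleftrightarrow> C) \<and>
      ((\<not> A \<and> \<not> B \<and> \<not> C) \<or> (A \<and> B) \<or> (A \<and> C) \<or> (B \<and> C)))"

subsection \<open>The semigroup of open strings\<close>

definition elementary_move :: "diagram \<Rightarrow> diagram \<Rightarrow> bool" where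
  "elementary_move \<alpha> \<beta> \<longleftrightarrow> \<alpha> \<in> open_strings \<and> \<beta> \<in> open_strings \<and>
    (planar_isotopy \<alpha> \<beta> \<or> reidemeister1 \<alpha> \<beta> \<or> reidemeister2 \<alpha> \<beta> \<or> reidemeister3 \<alpha> \<beta>)"

definition string_equiv :: "diagram rel" where
  "string_equiv = {(\<alpha>, \<beta>). \<alpha> \<in> open_strings \<and> \<beta> \<in> open_strings \<and> equivclp elementary_move \<alpha> \<beta>}"

text \<open>For sufficiently large \<open>R\<close>, a string with parameters \<open>\<bar>x\<bar> < R\<close> stays in the vertical strip of
  points with \<open>\<bar>fst p\<bar> < R\<close> and is standard otherwise.  Concatenation places two such strips next
  to each other, separated by the line \<open>fst p = 0\<close>.\<close>

definition fits_strip :: "real \<Rightarrow> diagram \<Rightarrow> bool" where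
  "fits_strip R \<alpha> \<longleftrightarrow> R > 0 \<and>
    (\<forall>x. if \<bar>x\<bar> \<ge> R then fst \<alpha> x = (x, 0) else \<bar>fst (fst \<alpha> x)\<bar> < R)"

definition concatenate :: "real \<Rightarrow> real \<Rightarrow> diagram \<Rightarrow> diagram \<Rightarrow> diagram" where
  "concatenate R S \<alpha> \<beta> =
    ((\<lambda>x. if x \<le> 0 then fst \<alpha> (x + R) - (R, 0) else fst \<beta> (x - S) + (S, 0)),
     (\<lambda>p. p - (R, 0)) ` snd \<alpha> \<union> (\<lambda>p. p + (S, 0)) ` snd \<beta>)"

text \<open>The product of two classes collects the classes of all concatenations of representatives.\<close>

definition string_semigroup :: "diagram set monoid" where
  "string_semigroup =
    \<lparr>carrier = open_strings // string_equiv,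
     mult = \<lambda>A B. {\<gamma>. \<exists>\<alpha>\<in>A. \<exists>\<beta>\<in>B. \<exists>R S. fits_strip R \<alpha> \<and> fits_strip S \<beta> \<and>
                       (concatenate R S \<alpha> \<beta>, \<gamma>) \<in> string_equiv},
     one = string_equiv `` {(\<lambda>x. (x, 0), {})}\<rparr>"

section \<open>The extended Alexander group of the descending diagram\<close>

definition classical_passages :: "diagram \<Rightarrow> real set" where
  "classical_passages \<alpha> = {t. fst \<alpha> t \<in> double_points (fst \<alpha>) - snd \<alpha>}"

text \<open>Arcs are represented by the corresponding open parameter intervals.\<close>

definition arcs :: "diagram \<Rightarrow> real set set" where
  "arcs \<alpha> = components (UNIV - classical_passages \<alpha>)"

definition arc_into :: "diagram \<Rightarrow> real \<Rightarrow> real set" where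
  "arc_into \<alpha> t = {s. s < t \<and> {s..<t} \<inter> classical_passages \<alpha> = {}}"

definition arc_out_of :: "diagram \<Rightarrow> real \<Rightarrow> real set" where
  "arc_out_of \<alpha> t = {s. t < s \<and> {t<..s} \<inter> classical_passages \<alpha> = {}}"

definition arc_minus_infinity :: "diagram \<Rightarrow> real set" where
  "arc_minus_infinity \<alpha> = {s. {..s} \<inter> classical_passages \<alpha> = {}}"

definition arc_plus_infinity :: "diagram \<Rightarrow> real set" where
  "arc_plus_infinity \<alpha> = {s. {s..} \<inter> classical_passages \<alpha> = {}}"

text \<open>A classical crossing is given by its two passages \<open>s < t\<close>.  The diagram is descending, so \<open>s\<close> is
  the passage along the overstrand.\<close>

definition classical_crossings :: "diagram \<Rightarrow> (real \<times> real) set" where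
  "classical_crossings \<alpha> = {(s, t). s < t \<and> fst \<alpha> s = fst \<alpha> t \<and> fst \<alpha> s \<notin> snd \<alpha>}"

definition positive_crossing :: "diagram \<Rightarrow> real \<times> real \<Rightarrow> bool" where
  "positive_crossing \<alpha> = (\<lambda>(s, t). det2 (velocity (fst \<alpha>) s) (velocity (fst \<alpha>) t) > 0)"

type_synonym alexander_generator = "real set \<times> (int \<times> int)"

definition letter :: "real set \<Rightarrow> int \<times> int \<Rightarrow> alexander_generator \<times> bool" where
  "letter a n = ((a, n), True)"

definition crossing_relations ::
  "diagram \<Rightarrow> real \<times> real \<Rightarrow> (alexander_generator word \<times> alexander_generator word) set" where
  "crossing_relations \<alpha> = (\<lambda>(s, t).
    let u = (1, 0); v = (0, 1) in
    if positive_crossing \<alpha> (s, t) then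
      let a = arc_into \<alpha> t; d = arc_out_of \<alpha> t; b = arc_into \<alpha> s; c = arc_out_of \<alpha> s in
        (\<Union>n. {([letter a n, letter b (n + u)], [letter c n, letter d (n + u)]),
              ([letter c (n + v)], [letter b n])})
    else
      let a = arc_into \<alpha> s; d = arc_out_of \<alpha> s; b = arc_into \<alpha> t; c = arc_out_of \<alpha> t in
        (\<Union>n. {([letter a n, letter b (n + u)], [letter c n, letter d (n + u)]),
              ([letter a (n + v)], [letter d n])}))"

definition alexander_generators :: "diagram \<Rightarrow> alexander_generator set" where
  "alexander_generators \<alpha> = arcs \<alpha> \<times> UNIV"

definition alexander_relations ::
  "diagram \<Rightarrow> (alexander_generator word \<times> alexander_generator word) set" where
  "alexander_relations \<alpha> = (\<Union>x\<in>classical_crossings \<alpha>. crossing_relations \<alpha> x)"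

definition alexander_group :: "diagram \<Rightarrow> alexander_generator word set monoid" where
  "alexander_group \<alpha> = presented_group (alexander_generators \<alpha>) (alexander_relations \<alpha>)"

definition alexander_gen :: "diagram \<Rightarrow> real set \<Rightarrow> int \<times> int \<Rightarrow> alexander_generator word set" where
  "alexander_gen \<alpha> a n = generator (alexander_generators \<alpha>) (alexander_relations \<alpha>) (a, n)"

section \<open>The endomorphism \<open>\<Phi>\<close>\<close>

text \<open>The isomorphism \<open>h\<close> is the identification of \<^const>\<open>free_group_F\<close> with the extended Alexander group.\<close>

definition is_Phi :: "diagram \<Rightarrow> ((int \<times> int) word set \<Rightarrow> (int \<times> int) word set) \<Rightarrow> bool" where
  "is_Phi \<alpha> \<phi> \<longleftrightarrow> \<phi> \<in> carrier (End_monoid free_group_F) \<and>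
    (\<exists>h \<in> iso free_group_F (alexander_group \<alpha>).
      (\<forall>n. h (F_gen n) = alexander_gen \<alpha> (arc_minus_infinity \<alpha>) n) \<and>
      (\<forall>n. h (\<phi> (F_gen n)) = alexander_gen \<alpha> (arc_plus_infinity \<alpha>) n))"

definition Phi :: "diagram \<Rightarrow> (int \<times> int) word set \<Rightarrow> (int \<times> int) word set" where
  "Phi \<alpha> = (THE \<phi>. is_Phi \<alpha> \<phi>)"

definition Phi_class :: "diagram set \<Rightarrow> (int \<times> int) word set \<Rightarrow> (int \<times> int) word set" where
  "Phi_class A = the_elem (Phi ` A)"

end

(* Travelling along a diagram, the relation at each passage expresses the label of the outgoing arc
   by the label of the incoming arc and by the label of the overstrand, and the overstrand has been
   met before since the diagram is descending.  So the word of passages (the signed Gauss word)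
   determines by recursion words in the generators of the first arc for all arcs, and this inverts
   the map from F to the extended Alexander group.  The image of a generator under Phi is the
   word computed for the last arc.  Hence invariance is a statement on Gauss words: a move changes
   the Gauss word by inserting or permuting passages in one, two or three intervals, one for each strand
   in the disc, and it suffices that the total effect of these passages on the labels is unchanged
   in the free group.  Concatenation of strings concatenates Gauss words; running the second word
   on the last label of the first one amounts to substituting that label, which is composition. *)

theory Submission
  imports Defs
begin

section \<open>Words and presented groups\<close>

text \<open>Labels are families of unreduced words. The moves compare them in the free group, which
  is set up as a type of class \<open>group_add\<close>, so that each move becomes a finite
  calculation by simplification. The obstacle is that a move also changes the records kept at the
  crossings in its disc, and these have no counterpart on the other side. Two states are therefore
  compared by \<open>state_eq N\<close>: on the current label and on the records at crossings in
  \<open>N\<close>. For a move, \<open>N\<close> is the set of points outside the disc, which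
  contains the name of every crossing that the rest of the Gauss word can read. This relies on
  naming a crossing by its point in the plane: outside the disc both diagrams use the same names,
  and two strings placed side by side share none. Isotopies and translations change the names
  injectively, which no label notices. The signs are the geometric input. In the discs of the second
  and third moves the strands are graphs, and the sign of a crossing is determined by which strand
  is lower just beside it and by the directions in which the two are traversed.\<close>

declare in_listsI [rule del] in_listsD [rule del]

definition winv :: "'x word \<Rightarrow> 'x word" where
  "winv w = rev (map (\<lambda>(x, e). (x, \<not> e)) w)"

text \<open>The homomorphic extension of \<open>\<sigma>\<close>, on unreduced words; cancellation
  enters only through \<open>presentation_eq\<close>.\<close>

definition subst :: "('x \<Rightarrow> 'y word) \<Rightarrow> 'x word \<Rightarrow> 'y word" where
  "subst \<sigma> w = concat (map (\<lambda>(x, e). if e then \<sigma> x else winv (\<sigma> x)) w)"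

lemma winv_simps [simp]:
  "winv [] = []" "winv (v @ w) = winv w @ winv v" "winv (winv w) = w" "winv [(x, e)] = [(x, \<not> e)]"
  by (simp_all add: winv_def rev_map comp_def case_prod_unfold)

lemma winv_Cons: "winv ((x, e) # w) = winv w @ [(x, \<not> e)]"
  by (simp add: winv_def)

lemma subst_simps [simp]:
  "subst \<sigma> [] = []" "subst \<sigma> (v @ w) = subst \<sigma> v @ subst \<sigma> w"
  "subst \<sigma> [(x, e)] = (if e then \<sigma> x else winv (\<sigma> x))"
  by (simp_all add: subst_def)

lemma subst_Cons: "subst \<sigma> ((x, e) # w) = (if e then \<sigma> x else winv (\<sigma> x)) @ subst \<sigma> w"
  by (simp add: subst_def)

lemma subst_winv [simp]: "subst \<sigma> (winv w) = winv (subst \<sigma> w)"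
  by (induction w) (auto simp: winv_Cons subst_Cons)

lemma subst_subst: "subst \<tau> (subst \<sigma> w) = subst (\<lambda>x. subst \<tau> (\<sigma> x)) w"
  by (induction w) (auto simp: subst_Cons)

lemma winv_in_lists [simp]: "winv w \<in> lists (X \<times> UNIV) \<longleftrightarrow> w \<in> lists (X \<times> UNIV)"
  by (force simp: winv_def lists_eq_set)

lemma subst_in_lists:
  assumes "\<And>x. x \<in> X \<Longrightarrow> \<sigma> x \<in> lists (Y \<times> UNIV)" "w \<in> lists (X \<times> UNIV)"
  shows "subst \<sigma> w \<in> lists (Y \<times> UNIV)"
  using assms(2) by (induction w) (auto simp: subst_Cons assms(1) winv_in_lists)

lemma peq_in_lists:
  "presentation_eq X R v w \<Longrightarrow> v \<in> lists (X \<times> UNIV) \<and> w \<in> lists (X \<times> UNIV)"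
  by (induction rule: presentation_eq.induct) auto

lemma peq_winv_left: "w \<in> lists (X \<times> UNIV) \<Longrightarrow> presentation_eq X R (winv w @ w) []"
\<comment> \<open>The last letter of \<open>w\<close> gives the two outermost letters of
  \<open>winv w @ w\<close>, so the inner part can be removed first.\<close>
proof (induction w rule: rev_induct)
  case Nil
  then show ?case by (simp add: presentation_eq.refl)
next
  case (snoc l w)
  obtain x e where l: "l = (x, e)" by force
  have x: "x \<in> X" and w: "w \<in> lists (X \<times> UNIV)" using snoc.prems l by auto
  have r: "presentation_eq X R [(x, e')] [(x, e')]" for e' by (rule presentation_eq.refl) (use x in auto)
  have "presentation_eq X R (([(x, \<not> e)] @ (winv w @ w)) @ [(x, e)]) (([(x, \<not> e)] @ []) @ [(x, e)])"
    by (intro presentation_eq.cong r snoc.IH w)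
  moreover have "presentation_eq X R [(x, \<not> e), (x, e)] []"
    using presentation_eq.cancel[OF x, of R "\<not> e"] by simp
  ultimately show ?case using l by (auto intro: presentation_eq.trans)
qed

lemma peq_winv_right: "w \<in> lists (X \<times> UNIV) \<Longrightarrow> presentation_eq X R (w @ winv w) []"
  using peq_winv_left[of "winv w" X R] by simp

text \<open>Inverses have no congruence rule of their own; the chain is v^-1 = v^-1 (w w^-1) = (v^-1
  v) w^-1 = w^-1, where the given equality is used in the middle.\<close>

lemma peq_winv_cong:
  assumes "presentation_eq X R v w" shows "presentation_eq X R (winv v) (winv w)"
proof -
  have L: "v \<in> lists (X \<times> UNIV)" "w \<in> lists (X \<times> UNIV)" using peq_in_lists[OF assms] by auto
  have iv: "presentation_eq X R (winv v) (winv v)" and iw: "presentation_eq X R (winv w) (winv w)"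
    using L by (auto intro: presentation_eq.refl)
  have "presentation_eq X R (winv v @ (w @ winv w)) (winv v @ [])"
    by (intro presentation_eq.cong iv peq_winv_right L)
  moreover have "presentation_eq X R (winv v @ (v @ winv w)) (winv v @ (w @ winv w))"
    by (intro presentation_eq.cong iv iw assms)
  moreover have "presentation_eq X R ((winv v @ v) @ winv w) ([] @ winv w)"
    by (intro presentation_eq.cong iw peq_winv_left L)
  ultimately show ?thesis
    by (metis append.assoc append_Nil append_Nil2 presentation_eq.sym presentation_eq.trans)
qed

text \<open>Von Dyck's theorem on the level of words. The condition on \<open>R\<close> concerns
  only words over \<open>X\<close>, because the rule \<open>relation\<close> applies only to
  these.\<close>

lemma peq_subst:
  assumes "presentation_eq X R v w"
    and \<sigma>: "\<And>x. x \<in> X \<Longrightarrow> \<sigma> x \<in> lists (Y \<times> UNIV)"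
    and R: "\<And>v w. (v, w) \<in> R \<Longrightarrow> v \<in> lists (X \<times> UNIV) \<Longrightarrow> w \<in> lists (X \<times> UNIV) \<Longrightarrow>
      presentation_eq Y Q (subst \<sigma> v) (subst \<sigma> w)"
  shows "presentation_eq Y Q (subst \<sigma> v) (subst \<sigma> w)"
  using assms(1)
proof (induction rule: presentation_eq.induct)
  case (refl w)
  then show ?case by (intro presentation_eq.refl subst_in_lists \<sigma>)
next
  case (sym v w)
  show ?case by (rule presentation_eq.sym) (rule sym.IH)
next
  case (trans u v w)
  then show ?case by (auto intro: presentation_eq.trans)
next
  case (cong v w v' w')
  then show ?case by (simp add: presentation_eq.cong)
next
  case (cancel x e)
  then show ?case
    using peq_winv_left[OF \<sigma>, of x Q] peq_winv_right[OF \<sigma>, of x Q] by (cases e) (auto simp: subst_Cons)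
next
  case (relation v w)
  then show ?case using R by auto
qed

text \<open>The assumption puts \<open>w\<close> into its own class; a word with a letter outside
  \<open>X\<close> has the empty class.\<close>

lemma word_class_eq_iff:
  assumes "w \<in> lists (X \<times> UNIV)"
  shows "word_class X R v = word_class X R w \<longleftrightarrow> presentation_eq X R v w"
proof
  assume "word_class X R v = word_class X R w"
  moreover have "w \<in> word_class X R w" using assms by (auto simp: word_class_def intro: presentation_eq.refl)
  ultimately show "presentation_eq X R v w" by (auto simp: word_class_def)
next
  assume "presentation_eq X R v w"
  then show "word_class X R v = word_class X R w"
    by (auto simp: word_class_def intro: presentation_eq.trans presentation_eq.sym)
qed

lemma word_class_eqI: "presentation_eq X R v w \<Longrightarrow> word_class X R v = word_class X R w"
  using peq_in_lists word_class_eq_iff by blast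

lemma carrier_presented_group: "carrier (presented_group X R) = word_class X R ` lists (X \<times> UNIV)"
  and one_presented_group: "\<one>\<^bsub>presented_group X R\<^esub> = word_class X R []"
  by (simp_all add: presented_group_def)

lemma word_class_in_carrier:
  "w \<in> lists (X \<times> UNIV) \<Longrightarrow> word_class X R w \<in> carrier (presented_group X R)"
  by (simp add: carrier_presented_group)

lemma mult_presented_group:
  assumes "v \<in> lists (X \<times> UNIV)" "w \<in> lists (X \<times> UNIV)"
  shows "word_class X R v \<otimes>\<^bsub>presented_group X R\<^esub> word_class X R w = word_class X R (v @ w)"
proof -
  have "presentation_eq X R (v @ w) x"
    if "presentation_eq X R v v'" "presentation_eq X R w w'" "presentation_eq X R (v' @ w') x" for v' w' x
    using presentation_eq.trans[OF presentation_eq.cong[OF that(1,2)] that(3)] .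
  moreover have "presentation_eq X R v v" "presentation_eq X R w w"
    using assms by (auto intro: presentation_eq.refl)
  ultimately show ?thesis
    unfolding presented_group_def word_class_def by fastforce
qed

lemma group_presented_group: "group (presented_group X R)"
proof (rule groupI)
  fix a assume "a \<in> carrier (presented_group X R)"
  then obtain w where w: "w \<in> lists (X \<times> UNIV)" "a = word_class X R w"
    by (auto simp: carrier_presented_group)
  then have "word_class X R (winv w) \<otimes>\<^bsub>presented_group X R\<^esub> a = \<one>\<^bsub>presented_group X R\<^esub>"
    using word_class_eqI[OF peq_winv_left] by (simp add: mult_presented_group one_presented_group)
  then show "\<exists>b\<in>carrier (presented_group X R). b \<otimes>\<^bsub>presented_group X R\<^esub> a = \<one>\<^bsub>presented_group X R\<^esub>"
    using w by (metis winv_in_lists word_class_in_carrier)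
qed (auto simp: carrier_presented_group mult_presented_group one_presented_group)

lemma inv_presented_group:
  assumes "w \<in> lists (X \<times> UNIV)"
  shows "inv\<^bsub>presented_group X R\<^esub> word_class X R w = word_class X R (winv w)"
  by (rule group.inv_equality[OF group_presented_group])
    (use assms word_class_eqI[OF peq_winv_left] in
      \<open>auto simp: word_class_in_carrier mult_presented_group one_presented_group\<close>)

lemma hom_agree_on_generators:
  assumes f: "f \<in> hom (presented_group X R) G" and g: "g \<in> hom (presented_group X R) G"
    and G: "group G"
    and eq: "\<And>x. x \<in> X \<Longrightarrow> f (generator X R x) = g (generator X R x)"
    and a: "a \<in> carrier (presented_group X R)"
  shows "f a = g a"
proof -
  let ?P = "presented_group X R"
  interpret f: group_hom ?P G f by (simp add: group_hom_def group_hom_axioms_def G f group_presented_group)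
  interpret g: group_hom ?P G g by (simp add: group_hom_def group_hom_axioms_def G g group_presented_group)
  have "f (word_class X R w) = g (word_class X R w)" if "w \<in> lists (X \<times> UNIV)" for w
    using that
  proof (induction w)
    case Nil
    then show ?case using f.hom_one g.hom_one by (simp add: one_presented_group)
  next
    case (Cons l w)
    obtain x e where l: "l = (x, e)" by force
    have x: "x \<in> X" "[(x, True)] \<in> lists (X \<times> UNIV)" and w: "w \<in> lists (X \<times> UNIV)"
      using Cons l by auto
    have inv: "word_class X R [(x, False)] = inv\<^bsub>?P\<^esub> word_class X R [(x, True)]"
      using inv_presented_group[OF x(2), of R] by simp
    have "f (word_class X R [(x, e)]) = g (word_class X R [(x, e)])"
      using eq[OF x(1)] word_class_in_carrier[OF x(2), of R]
      by (cases e) (auto simp: generator_def inv)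
    moreover have "word_class X R (l # w) = word_class X R [(x, e)] \<otimes>\<^bsub>?P\<^esub> word_class X R w"
      using x w by (simp add: mult_presented_group l)
    moreover have "word_class X R [(x, e)] \<in> carrier ?P" "word_class X R w \<in> carrier ?P"
      using x w by (auto intro!: word_class_in_carrier)
    ultimately show ?case using Cons by simp
  qed
  then show ?thesis using a by (auto simp: carrier_presented_group)
qed

text \<open>The restriction to the carrier makes the map extensional, as membership in
  \<open>End_monoid\<close> demands. Independence of the chosen representative is von Dyck's
  condition, stated in the locale \<open>presentation_map\<close>.\<close>

definition induced_hom ::
  "'x set \<Rightarrow> ('x word \<times> 'x word) set \<Rightarrow> 'y set \<Rightarrow> ('y word \<times> 'y word) set \<Rightarrow>
    ('x \<Rightarrow> 'y word) \<Rightarrow> 'x word set \<Rightarrow> 'y word set" where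
  "induced_hom X R Y Q \<sigma> =
    (\<lambda>C\<in>carrier (presented_group X R). word_class Y Q (subst \<sigma> (SOME w. w \<in> C)))"

locale presentation_map =
  fixes X :: "'x set" and R :: "('x word \<times> 'x word) set"
    and Y :: "'y set" and Q :: "('y word \<times> 'y word) set" and \<sigma> :: "'x \<Rightarrow> 'y word"
  assumes gens: "x \<in> X \<Longrightarrow> \<sigma> x \<in> lists (Y \<times> UNIV)"
    and rels: "(v, w) \<in> R \<Longrightarrow> v \<in> lists (X \<times> UNIV) \<Longrightarrow> w \<in> lists (X \<times> UNIV) \<Longrightarrow>
      presentation_eq Y Q (subst \<sigma> v) (subst \<sigma> w)"
begin

lemma induced_hom_word_class:
  assumes w: "w \<in> lists (X \<times> UNIV)"
  shows "induced_hom X R Y Q \<sigma> (word_class X R w) = word_class Y Q (subst \<sigma> w)"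
proof -
  have "w \<in> word_class X R w" using w by (simp add: word_class_def presentation_eq.refl)
  then have "(SOME v. v \<in> word_class X R w) \<in> word_class X R w" by (rule someI)
  then have "presentation_eq X R w (SOME v. v \<in> word_class X R w)" by (simp add: word_class_def)
  then have "presentation_eq Y Q (subst \<sigma> w) (subst \<sigma> (SOME v. v \<in> word_class X R w))"
    by (rule peq_subst) (use gens rels in auto)
  from word_class_eqI[OF this] w show ?thesis by (simp add: induced_hom_def word_class_in_carrier)
qed

lemma induced_hom_generator:
  "x \<in> X \<Longrightarrow> induced_hom X R Y Q \<sigma> (generator X R x) = word_class Y Q (\<sigma> x)"
  by (simp add: generator_def induced_hom_word_class)

lemma induced_hom_hom: "induced_hom X R Y Q \<sigma> \<in> hom (presented_group X R) (presented_group Y Q)"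
proof (rule homI)
  fix a b assume "a \<in> carrier (presented_group X R)" "b \<in> carrier (presented_group X R)"
  then obtain v w where "v \<in> lists (X \<times> UNIV)" "w \<in> lists (X \<times> UNIV)"
    "a = word_class X R v" "b = word_class X R w" by (auto simp: carrier_presented_group)
  then show "induced_hom X R Y Q \<sigma> (a \<otimes>\<^bsub>presented_group X R\<^esub> b) =
      induced_hom X R Y Q \<sigma> a \<otimes>\<^bsub>presented_group Y Q\<^esub> induced_hom X R Y Q \<sigma> b"
    using subst_in_lists[of X \<sigma> Y] gens
    by (simp add: mult_presented_group induced_hom_word_class)
next
  fix a assume "a \<in> carrier (presented_group X R)"
  then show "induced_hom X R Y Q \<sigma> a \<in> carrier (presented_group Y Q)"
    using subst_in_lists[of X \<sigma> Y] gens
    by (auto simp: carrier_presented_group induced_hom_word_class)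
qed

text \<open>Both composites are homomorphisms that fix every generator, hence identities on the
  carriers.\<close>

lemma induced_hom_iso:
  assumes "presentation_map Y Q X R \<tau>"
    and left: "\<And>x. x \<in> X \<Longrightarrow> presentation_eq X R (subst \<tau> (\<sigma> x)) [(x, True)]"
    and right: "\<And>y. y \<in> Y \<Longrightarrow> presentation_eq Y Q (subst \<sigma> (\<tau> y)) [(y, True)]"
  shows "induced_hom X R Y Q \<sigma> \<in> iso (presented_group X R) (presented_group Y Q)"
proof -
  let ?f = "induced_hom X R Y Q \<sigma>" and ?g = "induced_hom Y Q X R \<tau>"
  let ?P = "presented_group X R" and ?S = "presented_group Y Q"
  interpret \<tau>: presentation_map Y Q X R \<tau> by fact
  have "(\<lambda>x. ?g (?f x)) \<in> hom ?P ?P" "(\<lambda>x. ?f (?g x)) \<in> hom ?S ?S"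
    using hom_compose[OF induced_hom_hom \<tau>.induced_hom_hom] hom_compose[OF \<tau>.induced_hom_hom induced_hom_hom]
    by (simp_all add: comp_def)
  moreover have "(\<lambda>x. x) \<in> hom ?P ?P" "(\<lambda>x. x) \<in> hom ?S ?S" by (auto intro: homI)
  moreover have "?g (?f (generator X R x)) = generator X R x" if "x \<in> X" for x
    using that gens word_class_eqI[OF left]
    by (simp add: induced_hom_generator \<tau>.induced_hom_word_class, simp add: generator_def)
  moreover have "?f (?g (generator Y Q y)) = generator Y Q y" if "y \<in> Y" for y
    using that \<tau>.gens word_class_eqI[OF right]
    by (simp add: \<tau>.induced_hom_generator induced_hom_word_class, simp add: generator_def)
  ultimately have "\<And>a. a \<in> carrier ?P \<Longrightarrow> ?g (?f a) = a" "\<And>b. b \<in> carrier ?S \<Longrightarrow> ?f (?g b) = b"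
    using hom_agree_on_generators[OF _ _ group_presented_group] by blast+
  then have "bij_betw ?f (carrier ?P) (carrier ?S)"
    using induced_hom_hom \<tau>.induced_hom_hom by (intro bij_betwI[where g = ?g]) (auto simp: hom_def)
  then show ?thesis by (simp add: iso_def induced_hom_hom)
qed

end

subsection \<open>Free groups\<close>

lemma equivp_peq_free: "equivp (presentation_eq UNIV {} :: 'x word \<Rightarrow> _)"
  by (rule equivpI)
    (auto intro!: reflpI sympI transpI intro: presentation_eq.refl presentation_eq.sym presentation_eq.trans)

\<comment> \<open>The free group again, now as a type: the class \<open>group_add\<close> is a
  non-commutative group in additive notation, so its cancellation rules become available to the
  simplifier.\<close>
quotient_type 'x fg = "'x word" / "presentation_eq UNIV {} :: 'x word \<Rightarrow> 'x word \<Rightarrow> bool"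
  by (rule equivp_peq_free)

instantiation fg :: (type) group_add
begin

lift_definition zero_fg :: "'a fg" is "[]" .
lift_definition plus_fg :: "'a fg \<Rightarrow> 'a fg \<Rightarrow> 'a fg" is "(@)" by (rule presentation_eq.cong)
lift_definition uminus_fg :: "'a fg \<Rightarrow> 'a fg" is winv by (rule peq_winv_cong)
definition minus_fg :: "'a fg \<Rightarrow> 'a fg \<Rightarrow> 'a fg" where "minus_fg x y = x + - y"

instance
proof
  show "a + b + c = a + (b + c)" for a b c :: "'a fg" by transfer (simp add: presentation_eq.refl)
  show "0 + a = a" for a :: "'a fg" by transfer (simp add: presentation_eq.refl)
  show "a + 0 = a" for a :: "'a fg" by transfer (simp add: presentation_eq.refl)
  show "- a + a = 0" for a :: "'a fg" by transfer (simp add: peq_winv_left)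
  show "a + - b = a - b" for a b :: "'a fg" by (simp add: minus_fg_def)
qed

end

lemma abs_fg_simps [simp]:
  "abs_fg (v @ w) = abs_fg v + abs_fg w" "abs_fg (winv v) = - abs_fg v" "abs_fg [] = 0"
  by (simp_all add: plus_fg.abs_eq uminus_fg.abs_eq zero_fg.abs_eq)

lemma peq_free_iff: "presentation_eq UNIV {} v w \<longleftrightarrow> abs_fg v = abs_fg w"
  by (simp add: fg.abs_eq_iff)

section \<open>Labels transported along Gauss words\<close>

text \<open>The label of an arc is the family of words \<open>a\<^sub>n\<close> which express its generators.  A passage over
  or under the crossing \<open>c\<close> carries the sign of the crossing (true if positive).\<close>

datatype 'c passage = Over (crossing: 'c) bool | Under (crossing: 'c) bool

type_synonym 'x label = "int \<times> int \<Rightarrow> 'x word"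

definition shift :: "int \<times> int \<Rightarrow> 'x label \<Rightarrow> 'x label" where
  "shift k L = (\<lambda>n. L (n + k))"

text \<open>The overpassage at \<open>c\<close> records the label which enters the relation of the underpassage: with
  the notation of the relations, this is \<open>b\<close> at positive and \<open>d\<close> at negative crossings.  With this
  choice the two actions on the understrand are inverse to each other.\<close>

fun step :: "'c passage \<Rightarrow> 'x label \<times> ('c \<Rightarrow> 'x label) \<Rightarrow> 'x label \<times> ('c \<Rightarrow> 'x label)" where
  "step (Over c e) (L, st) =
    (shift (0, if e then - 1 else 1) L, st(c := if e then L else shift (0, 1) L))"
| "step (Under c e) (L, st) =
    (if e then (\<lambda>n. winv (st c (n - (1, 1))) @ L (n - (1, 0)) @ st c n)
     else (\<lambda>n. st c (n - (0, 1)) @ L (n + (1, 0)) @ winv (st c (n + (1, 0)))), st)"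

definition subst_state :: "('x \<Rightarrow> 'y word) \<Rightarrow> 'x label \<times> ('c \<Rightarrow> 'x label) \<Rightarrow> 'y label \<times> ('c \<Rightarrow> 'y label)" where
  "subst_state \<sigma> = (\<lambda>(L, st). (\<lambda>n. subst \<sigma> (L n), \<lambda>c n. subst \<sigma> (st c n)))"

text \<open>A passage builds its words from earlier ones by shifting, inverting and concatenating,
  all of which commute with substitution. This naturality is what turns concatenation of strings
  into composition.\<close>

lemma step_subst_state: "step p (subst_state \<sigma> s) = subst_state \<sigma> (step p s)"
  by (cases p; cases s) (auto simp: subst_state_def shift_def)

lemma fold_step_subst_state: "fold step ps (subst_state \<sigma> s) = subst_state \<sigma> (fold step ps s)"
  by (induction ps arbitrary: s) (simp_all add: step_subst_state)

text \<open>Names of crossings are mere addresses in the store, and an injective renaming keeps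
  distinct addresses distinct.\<close>

lemma step_rename:
  assumes "inj f"
  shows "step p (L, st \<circ> f) = (fst (step (map_passage f p) (L, st)), snd (step (map_passage f p) (L, st)) \<circ> f)"
  using assms by (cases p) (auto simp: inj_eq)

lemma fold_step_rename:
  assumes "inj f"
  shows "fst (fold step (map (map_passage f) ps) (L, st)) = fst (fold step ps (L, st \<circ> f))"
proof (induction ps arbitrary: L st)
  case (Cons p ps)
  obtain L' st' where "step (map_passage f p) (L, st) = (L', st')" by force
  with Cons[of L' st'] step_rename[OF assms, of p L st] show ?case by (simp add: comp_def)
qed simp

lemma snd_fold_step_unrecorded:
  "(\<And>e. Over c e \<notin> set ps) \<Longrightarrow> snd (fold step ps s) c = snd s c"
proof (induction ps arbitrary: s)
  case (Cons p ps)
  then have "snd (step p s) c = snd s c" by (cases p; cases s) auto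
  with Cons show ?case by simp
qed simp

lemma snd_fold_step_other: "c \<notin> crossing ` set ps \<Longrightarrow> snd (fold step ps s) c = snd s c"
  by (rule snd_fold_step_unrecorded) force

text \<open>The restriction to \<open>N\<close> leaves out the crossings of the disc in which a move
  takes place: their records differ on the two sides, but the passages after the disc never read
  them.\<close>

definition state_eq :: "'c set \<Rightarrow> 'x label \<times> ('c \<Rightarrow> 'x label) \<Rightarrow> 'x label \<times> ('c \<Rightarrow> 'x label) \<Rightarrow> bool" where
  "state_eq N s s' \<longleftrightarrow> (\<forall>n. abs_fg (fst s n) = abs_fg (fst s' n)) \<and>
    (\<forall>c\<in>N. \<forall>n. abs_fg (snd s c n) = abs_fg (snd s' c n))"

lemma state_eq_refl: "state_eq N s s"
  by (simp add: state_eq_def)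

lemma state_eq_trans: "state_eq N s t \<Longrightarrow> state_eq N t u \<Longrightarrow> state_eq N s u"
  by (simp add: state_eq_def)

lemma step_state_eq: "state_eq N s s' \<Longrightarrow> crossing p \<in> N \<Longrightarrow> state_eq N (step p s) (step p s')"
  by (cases p; cases s; cases s') (auto simp: state_eq_def shift_def)

lemma fold_step_state_eq:
  "state_eq N s s' \<Longrightarrow> crossing ` set ps \<subseteq> N \<Longrightarrow> state_eq N (fold step ps s) (fold step ps s')"
  by (induction ps arbitrary: s s') (simp_all add: step_state_eq)

text \<open>The understrand reads the label which the same strand has just recorded, so that two of
  the three factors cancel. The record at \<open>c\<close> stays behind, hence
  \<open>c \<notin> N\<close>.\<close>

lemma fold_step_reidemeister1:
  assumes "c \<notin> N"
  shows "state_eq N (fold step [Over c e, Under c e] s) s"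
  using assms by (cases s) (auto simp: state_eq_def shift_def add.assoc)

text \<open>Normal form for the calculations: sums nested to the right, signs pushed to the single
  terms, no subtraction. The last equation reverses the simplification rule
  \<open>add_uminus_conv_diff\<close>, which is therefore kept only at type \<open>int\<close>, for
  the indices.\<close>

lemma fg_normalize:
  "a + b + c = a + (b + c)" "- (a + b) = - b + - a" "a - b = a + - b" for a b c :: "'x fg"
  by (simp_all add: add.assoc minus_add)

text \<open>The bit says whether the passages on a strand are listed in the order of time or in the
  opposite order.\<close>

definition directed :: "bool \<Rightarrow> 'a list \<Rightarrow> 'a list" where
  "directed e xs = (if e then xs else rev xs)"

text \<open>The opposite signs make the overstrand undo its shift and record the same label at both
  crossings. The two underpassages then act by mutually inverse maps, in whichever order they
  come.\<close>

lemma fold_step_reidemeister2: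
  assumes xy: "x \<noteq> y" "x \<notin> N" "y \<notin> N" and B: "crossing ` set B \<subseteq> N"
  shows "state_eq N (fold step (directed d [Over x e, Over y (\<not> e)] @ B @ directed d' [Under x e, Under y (\<not> e)]) s)
    (fold step B s)"
proof -
  obtain L st where s: "s = (L, st)" by force
  define s1 where "s1 = fold step (directed d [Over x e, Over y (\<not> e)]) s"
  obtain M st2 where s2: "fold step B s1 = (M, st2)" by force
  have "state_eq N s1 s"
    using xy by (cases d; cases e) (auto simp: s state_eq_def shift_def s1_def directed_def)
  then have M: "state_eq N (M, st2) (fold step B s)"
    unfolding s2[symmetric] by (rule fold_step_state_eq) (rule B)
  have "snd (fold step B s1) x = snd s1 x" "snd (fold step B s1) y = snd s1 y"
    by (rule snd_fold_step_other, use B xy in blast)+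
  \<comment> \<open>\<open>d = e\<close> holds exactly if the crossing met first is positive; then
    the incoming label is recorded, otherwise its shift by (0, 1).\<close>
  moreover have "snd s1 x (i, j) = L (i, if d = e then j else j + 1) \<and>
     snd s1 y (i, j) = L (i, if d = e then j else j + 1)" for i j
    using xy by (cases d; cases e) (simp_all add: s shift_def s1_def directed_def)
  ultimately have st2: "st2 x (i, j) = L (i, if d = e then j else j + 1)"
     "st2 y (i, j) = L (i, if d = e then j else j + 1)" for i j
    by (simp_all add: s2)
  have "state_eq N (fold step (directed d' [Under x e, Under y (\<not> e)]) (M, st2)) (M, st2)"
    by (cases d; cases e; cases d') (simp_all add: state_eq_def directed_def split_paired_all st2 fg_normalize
        add_uminus_conv_diff[where 'a = int] del: add_uminus_conv_diff)
  from state_eq_trans[OF this M] show ?thesis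
    unfolding fold_append comp_def s1_def[symmetric] s2 .
qed

text \<open>The bits \<open>da\<close>, \<open>db\<close>, \<open>dc\<close> give the order in which the strands meet their two crossings.  The bits
  and the signs are determined by the directions and the heights of the three strands; of the
  constraints resulting from this, only the two equivalences are needed.\<close>

lemma fold_step_reidemeister3:
  assumes N: "x \<notin> N" "y \<notin> N" "z \<notin> N" "distinct [x, y, z]"
    and N': "x' \<notin> N" "y' \<notin> N" "z' \<notin> N" "distinct [x', y', z']"
    and B: "crossing ` set B \<subseteq> N" and C: "crossing ` set C \<subseteq> N"
    and ss': "state_eq N s s'"
    and e: "ey \<longleftrightarrow> (ex \<longleftrightarrow> (db \<longleftrightarrow> dc))" "ez \<longleftrightarrow> (ex \<longleftrightarrow> (da \<longleftrightarrow> dc))"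
  shows "state_eq N
    (fold step (directed da [Over x ex, Over y ey] @ B @
       directed db [Under x ex, Over z ez] @ C @ directed dc [Under y ey, Under z ez]) s)
    (fold step (directed (\<not> da) [Over x' ex, Over y' ey] @ B @
       directed (\<not> db) [Under x' ex, Over z' ez] @ C @ directed (\<not> dc) [Under y' ey, Under z' ez]) s')"
proof -
  have ne: "x \<noteq> y" "y \<noteq> x" "x \<noteq> z" "z \<noteq> x" "y \<noteq> z" "z \<noteq> y"
    "x' \<noteq> y'" "y' \<noteq> x'" "x' \<noteq> z'" "z' \<noteq> x'" "y' \<noteq> z'" "z' \<noteq> y'"
    using N N' by auto
  obtain L st L' st' where s: "s = (L, st)" "s' = (L', st')" by force
  define s1 where "s1 = fold step (directed da [Over x ex, Over y ey]) s"
  define s1' where "s1' = fold step (directed (\<not> da) [Over x' ex, Over y' ey]) s'"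
  have L': "abs_fg (L' n) = abs_fg (L n)" for n using ss' by (cases n) (simp add: state_eq_def s)
  \<comment> \<open>The first strand passes over both crossings, and the two shifts add up to the
    same total in either order.\<close>
  have 1: "state_eq N s1 s1'"
    using ss' N N' unfolding s1_def s1'_def s
    by (cases ex; cases ey; cases da) (auto simp: state_eq_def directed_def shift_def)
  obtain M st2 M' st2' where s2: "fold step B s1 = (M, st2)" "fold step B s1' = (M', st2')" by force
  have 2: "state_eq N (M, st2) (M', st2')"
    unfolding s2[symmetric] by (rule fold_step_state_eq[OF 1 B])
  have M': "abs_fg (M' n) = abs_fg (M n)" for n using 2 by (cases n) (simp add: state_eq_def)
  have "snd (fold step B s1) x = snd s1 x" "snd (fold step B s1) y = snd s1 y"
    "snd (fold step B s1') x' = snd s1' x'" "snd (fold step B s1') y' = snd s1' y'"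
    by (rule snd_fold_step_other, use B N N' in blast)+
  note st2 = this[unfolded s2 snd_conv]
  define s3 where "s3 = fold step (directed db [Under x ex, Over z ez]) (M, st2)"
  define s3' where "s3' = fold step (directed (\<not> db) [Under x' ex, Over z' ez]) (M', st2')"
  \<comment> \<open>The second strand. The hypotheses \<open>e\<close> give \<open>ey = ez\<close>
    exactly if \<open>da = db\<close>; so the shift by which the records at \<open>x\<close> and
    \<open>x'\<close> differ, caused by the other crossing of the first strand, matches the shift
    which the second strand undergoes at \<open>z\<close> before or after passing under
    \<open>x\<close>.\<close>
  have "\<forall>n. abs_fg (fst s3 n) = abs_fg (fst s3' n)"
    using ne unfolding s3_def s3'_def
    by (cases ex; cases db; cases dc; cases da)
      (simp_all add: e directed_def shift_def split_paired_all st2 s1_def s1'_def s L' M' fg_normalize add.commute[of "1 :: int"]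
        add_uminus_conv_diff[where 'a = int] del: add_uminus_conv_diff)
  moreover have "snd s3 c = st2 c" "snd s3' c = st2' c" if "c \<in> N" for c
  proof -
    have "c \<notin> {x, z, x', z'}" using N N' that by blast
    then show "snd s3 c = st2 c" "snd s3' c = st2' c"
      unfolding s3_def s3'_def by (simp_all add: snd_fold_step_other directed_def)
  qed
  ultimately have 3: "state_eq N s3 s3'"
    using 2 by (simp add: state_eq_def)
  obtain K st4 K' st4' where s4: "fold step C s3 = (K, st4)" "fold step C s3' = (K', st4')" by force
  have 4: "state_eq N (K, st4) (K', st4')"
    unfolding s4[symmetric] by (rule fold_step_state_eq[OF 3 C])
  have K': "abs_fg (K' n) = abs_fg (K n)" for n using 4 by (cases n) (simp add: state_eq_def)
  have "snd (fold step C s3) y = snd s3 y" "snd (fold step C s3) z = snd s3 z"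
    "snd (fold step C s3') y' = snd s3' y'" "snd (fold step C s3') z' = snd s3' z'"
    by (rule snd_fold_step_other, use C N N' in blast)+
  note st4 = this[unfolded s4 snd_conv]
  \<comment> \<open>The third strand. On exactly one side the label recorded at \<open>z\<close> has
    already been changed by passing under the first strand; that the underpassages at
    \<open>y\<close> and \<open>z\<close> can nevertheless be swapped is the self-distributivity of
    conjugation.\<close>
  have "\<forall>n. abs_fg (fst (fold step (directed dc [Under y ey, Under z ez]) (K, st4)) n) =
     abs_fg (fst (fold step (directed (\<not> dc) [Under y' ey, Under z' ez]) (K', st4')) n)"
    using ne K'
    by (cases ex; cases db; cases dc; cases da)
      (simp_all add: e directed_def shift_def split_paired_all
        st4 s3_def s3'_def st2 s1_def s1'_def s L' M' fg_normalize add.commute[of "1 :: int"]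
        add_uminus_conv_diff[where 'a = int] del: add_uminus_conv_diff)
  then have "state_eq N (fold step (directed dc [Under y ey, Under z ez]) (K, st4))
     (fold step (directed (\<not> dc) [Under y' ey, Under z' ez]) (K', st4'))"
    using 4 by (simp add: state_eq_def snd_fold_step_unrecorded directed_def)
  then show ?thesis
    unfolding fold_append comp_def s1_def[symmetric] s1'_def[symmetric] s2 s3_def[symmetric] s3'_def[symmetric] s4 .
qed

text \<open>The bit \<open>m\<close> stands for an encircled crossing, which leaves no trace in the
  Gauss word.\<close>

definition unmarked :: "bool \<Rightarrow> 'a \<Rightarrow> 'a list" where
  "unmarked m x = (if m then [] else [x])"

text \<open>For the mixed third move: a single uncircled crossing remains, and all that changes is
  its name, since it has moved to another point of the disc.\<close>

lemma fold_step_crossing: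
  assumes x: "x \<notin> N" "x' \<notin> N" and B: "crossing ` set B \<subseteq> N" and ss': "state_eq N s s'"
  shows "state_eq N (fold step (Over x e # B @ [Under x e]) s) (fold step (Over x' e # B @ [Under x' e]) s')"
proof -
  obtain L st L' st' where s: "s = (L, st)" "s' = (L', st')" by force
  define s1 where "s1 = step (Over x e) s"
  define s1' where "s1' = step (Over x' e) s'"
  have L': "abs_fg (L' n) = abs_fg (L n)" for n using ss' by (cases n) (simp add: state_eq_def s)
  have 1: "state_eq N s1 s1'"
    using ss' x unfolding s1_def s1'_def s by (auto simp: state_eq_def shift_def)
  obtain M st2 M' st2' where s2: "fold step B s1 = (M, st2)" "fold step B s1' = (M', st2')" by force
  have 2: "state_eq N (M, st2) (M', st2')"
    unfolding s2[symmetric] by (rule fold_step_state_eq[OF 1 B])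
  have M': "abs_fg (M' n) = abs_fg (M n)" for n using 2 by (cases n) (simp add: state_eq_def)
  have "snd (fold step B s1) x = snd s1 x" "snd (fold step B s1') x' = snd s1' x'"
    by (rule snd_fold_step_other, use B x in blast)+
  note st2 = this[unfolded s2 snd_conv]
  have "state_eq N (step (Under x e) (M, st2)) (step (Under x' e) (M', st2'))"
    using 2 by (simp add: state_eq_def st2 s1_def s1'_def s shift_def L' M')
  then show ?thesis
    by (simp add: s1_def[symmetric] s1'_def[symmetric] s2)
qed

lemma fold_step_reidemeister3_marked:
  assumes N: "x \<notin> N" "y \<notin> N" "z \<notin> N" "distinct [x, y, z]"
    and N': "x' \<notin> N" "y' \<notin> N" "z' \<notin> N" "distinct [x', y', z']"
    and B: "crossing ` set B \<subseteq> N" and C: "crossing ` set C \<subseteq> N"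
    and ss': "state_eq N s s'"
    and e: "ey \<longleftrightarrow> (ex \<longleftrightarrow> (db \<longleftrightarrow> dc))" "ez \<longleftrightarrow> (ex \<longleftrightarrow> (da \<longleftrightarrow> dc))"
    and m: "(\<not> mx \<and> \<not> my \<and> \<not> mz) \<or> (mx \<and> my) \<or> (mx \<and> mz) \<or> (my \<and> mz)"
  shows "state_eq N
    (fold step (directed da (unmarked mx (Over x ex) @ unmarked my (Over y ey)) @ B @
       directed db (unmarked mx (Under x ex) @ unmarked mz (Over z ez)) @ C @
       directed dc (unmarked my (Under y ey) @ unmarked mz (Under z ez))) s)
    (fold step (directed (\<not> da) (unmarked mx (Over x' ex) @ unmarked my (Over y' ey)) @ B @
       directed (\<not> db) (unmarked mx (Under x' ex) @ unmarked mz (Over z' ez)) @ C @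
       directed (\<not> dc) (unmarked my (Under y' ey) @ unmarked mz (Under z' ez))) s')"
proof -
  have BC: "crossing ` set (B @ C) \<subseteq> N" using B C by auto
  \<comment> \<open>Unless all three crossings are uncircled, at most one of them is; then no strand
    has two passages to reorder, and the directions do not matter.\<close>
  consider "\<not> mx" "\<not> my" "\<not> mz" | "mx" "my" "mz" | "mx" "my" "\<not> mz" | "mx" "\<not> my" "mz" | "\<not> mx" "my" "mz"
    using m by blast
  then show ?thesis
  proof cases
    case 1
    then show ?thesis using fold_step_reidemeister3[OF N N' B C ss' e] by (simp add: unmarked_def)
  next
    case 2
    then show ?thesis using fold_step_state_eq[OF ss' BC] by (simp add: unmarked_def directed_def)
  next
    case 3
    then show ?thesis
      using fold_step_crossing[OF N(3) N'(3) C fold_step_state_eq[OF ss' B]] by (simp add: unmarked_def directed_def)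
  next
    case 4
    then show ?thesis
      using fold_step_crossing[OF N(2) N'(2) BC ss'] by (simp add: unmarked_def directed_def)
  next
    case 5
    then show ?thesis
      using fold_step_state_eq[OF fold_step_crossing[OF N(1) N'(1) B ss'] C] by (simp add: unmarked_def directed_def)
  qed
qed

section \<open>The Gauss word of a diagram\<close>

lemma sorted_list_of_set_Un:
  fixes A B :: "'a :: linorder set"
  assumes "finite A" "finite B" "\<And>a b. a \<in> A \<Longrightarrow> b \<in> B \<Longrightarrow> a < b"
  shows "sorted_list_of_set (A \<union> B) = sorted_list_of_set A @ sorted_list_of_set B"
proof (rule sorted_distinct_set_unique)
  show "sorted (sorted_list_of_set A @ sorted_list_of_set B)"
    using assms by (auto simp: sorted_append intro: less_imp_le)
  have "A \<inter> B = {}" using assms(3) by force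
  then show "distinct (sorted_list_of_set A @ sorted_list_of_set B)" using assms by auto
qed (use assms in auto)

definition partner :: "(real \<Rightarrow> real \<times> real) \<Rightarrow> real \<Rightarrow> real" where
  "partner c t = (THE s. s \<noteq> t \<and> c s = c t)"

text \<open>The point in the plane serves as the name of the crossing. The earlier of the two
  passages is the overpassage because the diagram is descending.\<close>

definition gauss_passage :: "diagram \<Rightarrow> real \<Rightarrow> (real \<times> real) passage" where
  "gauss_passage \<alpha> t = (let s = partner (fst \<alpha>) t in
    if t < s then Over (fst \<alpha> t) (positive_crossing \<alpha> (t, s))
    else Under (fst \<alpha> t) (positive_crossing \<alpha> (s, t)))"

definition gauss_word :: "diagram \<Rightarrow> real set \<Rightarrow> (real \<times> real) passage list" where
  "gauss_word \<alpha> S = map (gauss_passage \<alpha>) (sorted_list_of_set (classical_passages \<alpha> \<inter> S))"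

text \<open>The empty words are placeholders: in a descending diagram the overpassage replaces the
  record of a crossing before the underpassage reads it.\<close>

definition initial_state :: "(int \<times> int) label \<times> (real \<times> real \<Rightarrow> (int \<times> int) label)" where
  "initial_state = (\<lambda>n. [(n, True)], \<lambda>c n. [])"

definition state_at :: "diagram \<Rightarrow> real \<Rightarrow> (int \<times> int) label \<times> (real \<times> real \<Rightarrow> (int \<times> int) label)" where
  "state_at \<alpha> t = fold step (gauss_word \<alpha> {..<t}) initial_state"

definition end_label :: "diagram \<Rightarrow> (int \<times> int) label" where
  "end_label \<alpha> = fst (fold step (gauss_word \<alpha> UNIV) initial_state)"

definition arc_of :: "diagram \<Rightarrow> real \<Rightarrow> real set" where
  "arc_of \<alpha> s = {x. closed_segment s x \<inter> classical_passages \<alpha> = {}}"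

text \<open>The choice of the point is harmless, since no passage lies between two points of an arc
  and the state is the same at both (\<open>arc_label_arc_of\<close>).\<close>

definition arc_label :: "diagram \<Rightarrow> real set \<Rightarrow> (int \<times> int) label" where
  "arc_label \<alpha> a = fst (state_at \<alpha> (SOME s. s \<in> a))"

lemma finite_gap_below:
  fixes t :: real
  assumes "finite P" obtains s where "s < t" "{s..<t} \<inter> P = {}"
proof (cases "P \<inter> {..<t} = {}")
  case True
  then have "{t - 1..<t} \<inter> P = {}" by auto
  then show ?thesis using that[of "t - 1"] by simp
next
  case False
  then have "Max (P \<inter> {..<t}) \<in> P \<inter> {..<t}" using assms by (intro Max_in) auto
  moreover then obtain s where s: "Max (P \<inter> {..<t}) < s" "s < t" using dense by auto
  moreover have "{s..<t} \<inter> P = {}" 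
  proof (rule equals0I)
    fix x assume x: "x \<in> {s..<t} \<inter> P"
    then have "x \<le> Max (P \<inter> {..<t})" using assms by (intro Max_ge) auto
    then show False using s x by simp
  qed
  ultimately show ?thesis using that by blast
qed

lemma finite_gap_above:
  fixes t :: real
  assumes "finite P" obtains s where "t < s" "{t<..s} \<inter> P = {}"
proof -
  obtain s where s: "s < - t" "{s..<- t} \<inter> uminus ` P = {}"
    using finite_gap_below[of "uminus ` P" "- t"] assms by auto
  have "{t<..- s} \<inter> P = {}"
  proof (intro equals0I)
    fix x assume "x \<in> {t<..- s} \<inter> P"
    then have "- x \<in> {s..<- t} \<inter> uminus ` P" by auto
    then show False using s by simp
  qed
  then show ?thesis using that[of "- s"] s by simp
qed

locale open_string =
  fixes \<alpha> :: diagram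
  assumes \<alpha>: "\<alpha> \<in> open_strings"
begin

lemma generic: "generic_immersion (fst \<alpha>)"
  using \<alpha> by (auto simp: open_strings_def)

lemma no_triple: "fst \<alpha> s = fst \<alpha> t \<Longrightarrow> fst \<alpha> t = fst \<alpha> u \<Longrightarrow> s = t \<or> t = u \<or> s = u"
  using generic unfolding generic_immersion_def by blast

lemma partner_eqI: "s \<noteq> t \<Longrightarrow> fst \<alpha> s = fst \<alpha> t \<Longrightarrow> partner (fst \<alpha>) t = s"
  unfolding partner_def using no_triple by (intro the_equality) metis+

lemma finite_passages: "finite (classical_passages \<alpha>)"
proof -
  have "finite {t. fst \<alpha> t = p}" for p
  proof (cases "\<exists>s t. s \<noteq> t \<and> fst \<alpha> s = p \<and> fst \<alpha> t = p")
    case True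
    then obtain s t where "s \<noteq> t" "fst \<alpha> s = p" "fst \<alpha> t = p" by blast
    then have "{t. fst \<alpha> t = p} \<subseteq> {s, t}" by (smt (verit) no_triple insert_iff mem_Collect_eq subsetI)
    then show ?thesis by (rule finite_subset) simp
  next
    case False
    then have "{t. fst \<alpha> t = p} = {} \<or> (\<exists>t. {t. fst \<alpha> t = p} = {t})" by blast
    then show ?thesis by (metis finite.emptyI finite.insertI)
  qed
  moreover have "classical_passages \<alpha> \<subseteq> (\<Union>p\<in>double_points (fst \<alpha>). {t. fst \<alpha> t = p})"
    by (auto simp: classical_passages_def)
  ultimately show ?thesis
    using generic by (meson finite_UN_I finite_subset generic_immersion_def)
qed

lemma gauss_word_Un:
  "(\<And>a b. a \<in> A \<Longrightarrow> b \<in> B \<Longrightarrow> a < b) \<Longrightarrow> gauss_word \<alpha> (A \<union> B) = gauss_word \<alpha> A @ gauss_word \<alpha> B"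
  unfolding gauss_word_def Int_Un_distrib
  using finite_passages by (subst sorted_list_of_set_Un) auto

lemma gauss_word_singleton:
  "t \<in> classical_passages \<alpha> \<Longrightarrow> gauss_word \<alpha> {t} = [gauss_passage \<alpha> t]"
  by (simp add: gauss_word_def)

lemma state_at_cong:
  "classical_passages \<alpha> \<inter> {..<s} = classical_passages \<alpha> \<inter> {..<t} \<Longrightarrow> state_at \<alpha> s = state_at \<alpha> t"
  by (simp add: state_at_def gauss_word_def)

lemma state_at_step:
  assumes t: "t \<in> classical_passages \<alpha>" and "t < s" and gap: "{t<..<s} \<inter> classical_passages \<alpha> = {}"
  shows "state_at \<alpha> s = step (gauss_passage \<alpha> t) (state_at \<alpha> t)"
proof -
  have "classical_passages \<alpha> \<inter> {..<s} = classical_passages \<alpha> \<inter> ({..<t} \<union> {t})"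
    using assms by force
  then have "gauss_word \<alpha> {..<s} = gauss_word \<alpha> ({..<t} \<union> {t})" by (simp add: gauss_word_def)
  also have "\<dots> = gauss_word \<alpha> {..<t} @ [gauss_passage \<alpha> t]"
    using t by (subst gauss_word_Un) (auto simp: gauss_word_singleton)
  finally show ?thesis by (simp add: state_at_def)
qed

lemma crossing_passages:
  assumes "(s, t) \<in> classical_crossings \<alpha>"
  shows "s \<in> classical_passages \<alpha>" "t \<in> classical_passages \<alpha>" "s < t" "fst \<alpha> s = fst \<alpha> t"
    and gauss_passage_over: "gauss_passage \<alpha> s = Over (fst \<alpha> t) (positive_crossing \<alpha> (s, t))"
    and gauss_passage_under: "gauss_passage \<alpha> t = Under (fst \<alpha> t) (positive_crossing \<alpha> (s, t))"
proof -
  show st: "s < t" "fst \<alpha> s = fst \<alpha> t" using assms by (auto simp: classical_crossings_def)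
  then have "fst \<alpha> t \<in> double_points (fst \<alpha>)" unfolding double_points_def by (blast dest: less_imp_neq)
  then show "s \<in> classical_passages \<alpha>" "t \<in> classical_passages \<alpha>"
    using assms st(2) by (auto simp: classical_crossings_def classical_passages_def)
  have "partner (fst \<alpha>) t = s" "partner (fst \<alpha>) s = t" using st partner_eqI by auto
  then show "gauss_passage \<alpha> s = Over (fst \<alpha> t) (positive_crossing \<alpha> (s, t))"
    "gauss_passage \<alpha> t = Under (fst \<alpha> t) (positive_crossing \<alpha> (s, t))"
    using st by (simp_all add: gauss_passage_def)
qed

lemma passage_cases:
  assumes "t \<in> classical_passages \<alpha>"
  obtains s where "(s, t) \<in> classical_crossings \<alpha>" | s where "(t, s) \<in> classical_crossings \<alpha>"
proof -
  obtain s where "s \<noteq> t" "fst \<alpha> s = fst \<alpha> t" "fst \<alpha> t \<notin> snd \<alpha>"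
    using assms unfolding classical_passages_def double_points_def by (smt (verit) DiffE mem_Collect_eq)
  then have "(s, t) \<in> classical_crossings \<alpha> \<or> (t, s) \<in> classical_crossings \<alpha>"
    by (auto simp: classical_crossings_def)
  then show ?thesis using that by blast
qed

text \<open>There are no triple points, so no overpassage between \<open>s\<close> and
  \<open>t\<close> carries the same name and the record made at \<open>s\<close> survives until
  \<open>t\<close>.\<close>

lemma stored_label:
  assumes st: "(s, t) \<in> classical_crossings \<alpha>"
  shows "snd (state_at \<alpha> t) (fst \<alpha> t) =
    (if positive_crossing \<alpha> (s, t) then fst (state_at \<alpha> s) else shift (0, 1) (fst (state_at \<alpha> s)))"
proof -
  note cr = crossing_passages[OF st] gauss_passage_over[OF st]
  have ord1: "a < b" if "a \<in> {..<s}" "b \<in> {s}" for a b using that by simp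
  have ord2: "a < b" if "a \<in> {..<s} \<union> {s}" "b \<in> {s<..<t}" for a b using that by auto
  have "{..<t} = ({..<s} \<union> {s}) \<union> {s<..<t}" using cr by auto
  then have "gauss_word \<alpha> {..<t} = gauss_word \<alpha> {..<s} @ [gauss_passage \<alpha> s] @ gauss_word \<alpha> {s<..<t}"
    using cr by (simp only: gauss_word_Un[OF ord2] gauss_word_Un[OF ord1] gauss_word_singleton append_assoc)
  moreover have "Over (fst \<alpha> t) e \<notin> set (gauss_word \<alpha> {s<..<t})" for e
  proof
    assume "Over (fst \<alpha> t) e \<in> set (gauss_word \<alpha> {s<..<t})"
    then obtain r where "s < r" "r < t" "gauss_passage \<alpha> r = Over (fst \<alpha> t) e"
      using finite_passages by (auto simp: gauss_word_def)
    moreover from this have "fst \<alpha> r = fst \<alpha> t" by (auto simp: gauss_passage_def Let_def split: if_splits)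
    ultimately show False using no_triple[of s r t] cr by auto
  qed
  ultimately show ?thesis
    unfolding state_at_def using cr
    by (cases "state_at \<alpha> s") (simp add: snd_fold_step_unrecorded state_at_def)
qed

lemma component_eq_arc_of:
  "connected_component_set (UNIV - classical_passages \<alpha>) s = arc_of \<alpha> s"
proof (intro equalityI subsetI)
  fix x assume "x \<in> connected_component_set (UNIV - classical_passages \<alpha>) s"
  then obtain T where T: "connected T" "T \<subseteq> UNIV - classical_passages \<alpha>" "s \<in> T" "x \<in> T"
    by (auto simp: connected_component_def)
  then have "closed_segment s x \<subseteq> T"
    by (intro closed_segment_subset) (simp_all add: is_interval_convex_1[symmetric] is_interval_connected_1)
  then show "x \<in> arc_of \<alpha> s" using T by (auto simp: arc_of_def)
next
  fix x assume "x \<in> arc_of \<alpha> s"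
  then show "x \<in> connected_component_set (UNIV - classical_passages \<alpha>) s"
    unfolding arc_of_def connected_component_def by (auto intro!: exI[of _ "closed_segment s x"])
qed

lemma arcs_eq: "arcs \<alpha> = arc_of \<alpha> ` (UNIV - classical_passages \<alpha>)"
  by (auto simp: arcs_def components_def component_eq_arc_of)

lemma arc_of_self: "s \<notin> classical_passages \<alpha> \<Longrightarrow> s \<in> arc_of \<alpha> s"
  by (simp add: arc_of_def)

lemma arc_label_arc_of:
  assumes "s \<notin> classical_passages \<alpha>"
  shows "arc_label \<alpha> (arc_of \<alpha> s) = fst (state_at \<alpha> s)"
proof -
  have "(SOME x. x \<in> arc_of \<alpha> s) \<in> arc_of \<alpha> s" using arc_of_self[OF assms] by (rule someI)
  then have "closed_segment s (SOME x. x \<in> arc_of \<alpha> s) \<inter> classical_passages \<alpha> = {}"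
    by (simp add: arc_of_def)
  then have "classical_passages \<alpha> \<inter> {..<(SOME x. x \<in> arc_of \<alpha> s)} = classical_passages \<alpha> \<inter> {..<s}"
    by (force simp: closed_segment_eq_real_ivl disjoint_iff not_less split: if_splits)
  then show ?thesis unfolding arc_label_def by (metis state_at_cong)
qed

lemma arc_into_eq:
  assumes "t \<in> classical_passages \<alpha>" "s < t" "{s..<t} \<inter> classical_passages \<alpha> = {}"
  shows "arc_into \<alpha> t = arc_of \<alpha> s"
  using assms unfolding arc_into_def arc_of_def closed_segment_eq_real_ivl disjoint_iff
  by (intro Collect_cong) (smt (verit) atLeastAtMost_iff atLeastLessThan_iff)

lemma arc_out_of_eq:
  assumes "t \<in> classical_passages \<alpha>" "t < s" "{t<..s} \<inter> classical_passages \<alpha> = {}"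
  shows "arc_out_of \<alpha> t = arc_of \<alpha> s"
  using assms unfolding arc_out_of_def arc_of_def closed_segment_eq_real_ivl disjoint_iff
  by (intro Collect_cong) (smt (verit) atLeastAtMost_iff greaterThanAtMost_iff)

lemma arc_minus_infinity_eq:
  assumes "{..s} \<inter> classical_passages \<alpha> = {}"
  shows "arc_minus_infinity \<alpha> = arc_of \<alpha> s"
  using assms unfolding arc_minus_infinity_def arc_of_def closed_segment_eq_real_ivl disjoint_iff
  by (intro Collect_cong) (smt (verit) atLeastAtMost_iff atMost_iff)

lemma arc_plus_infinity_eq:
  assumes "{s..} \<inter> classical_passages \<alpha> = {}"
  shows "arc_plus_infinity \<alpha> = arc_of \<alpha> s"
  using assms unfolding arc_plus_infinity_def arc_of_def closed_segment_eq_real_ivl disjoint_iff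
  by (intro Collect_cong) (smt (verit) atLeastAtMost_iff atLeast_iff)

lemma arc_into_cases:
  assumes "t \<in> classical_passages \<alpha>"
  obtains s where "s < t" "s \<notin> classical_passages \<alpha>" "arc_into \<alpha> t = arc_of \<alpha> s" "state_at \<alpha> s = state_at \<alpha> t"
proof -
  obtain s where s: "s < t" "{s..<t} \<inter> classical_passages \<alpha> = {}"
    using finite_gap_below[OF finite_passages] by blast
  then have "classical_passages \<alpha> \<inter> {..<s} = classical_passages \<alpha> \<inter> {..<t}"
    by (force simp: disjoint_iff not_less)
  then have "state_at \<alpha> s = state_at \<alpha> t" by (rule state_at_cong)
  moreover have "s \<notin> classical_passages \<alpha>" using s by auto
  ultimately show ?thesis using that s arc_into_eq[OF assms s] by blast
qed

lemma arc_out_of_cases: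
  assumes "t \<in> classical_passages \<alpha>"
  obtains s where "s \<notin> classical_passages \<alpha>" "arc_out_of \<alpha> t = arc_of \<alpha> s"
    "state_at \<alpha> s = step (gauss_passage \<alpha> t) (state_at \<alpha> t)"
proof -
  obtain s where s: "t < s" "{t<..s} \<inter> classical_passages \<alpha> = {}"
    using finite_gap_above[OF finite_passages] by blast
  then have "state_at \<alpha> s = step (gauss_passage \<alpha> t) (state_at \<alpha> t)"
    by (intro state_at_step assms) (auto simp: disjoint_iff)
  moreover have "s \<notin> classical_passages \<alpha>" using s by auto
  ultimately show ?thesis using that arc_out_of_eq[OF assms s] by blast
qed

lemma arc_minus_infinity_cases:
  obtains s where "s \<notin> classical_passages \<alpha>" "arc_minus_infinity \<alpha> = arc_of \<alpha> s"
    "state_at \<alpha> s = initial_state"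
proof -
  \<comment> \<open>The inserted 0 keeps the minimum meaningful for a string without classical
    passages.\<close>
  define s where "s = Min (insert 0 (classical_passages \<alpha>)) - 1"
  have s: "s < t" if "t \<in> classical_passages \<alpha>" for t
    unfolding s_def using finite_passages that by (smt (verit) Min_le finite_insert insertI2)
  then have "{..s} \<inter> classical_passages \<alpha> = {}" "classical_passages \<alpha> \<inter> {..<s} = {}" by force+
  then show ?thesis using that[of s] arc_minus_infinity_eq[of s] s
    by (auto simp: state_at_def gauss_word_def)
qed

lemma arc_plus_infinity_cases:
  obtains s where "s \<notin> classical_passages \<alpha>" "arc_plus_infinity \<alpha> = arc_of \<alpha> s"
    "fst (state_at \<alpha> s) = end_label \<alpha>"
proof -
  define s where "s = Max (insert 0 (classical_passages \<alpha>)) + 1"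
  have s: "t < s" if "t \<in> classical_passages \<alpha>" for t
    unfolding s_def using finite_passages that by (smt (verit) Max_ge finite_insert insertI2)
  then have "{s..} \<inter> classical_passages \<alpha> = {}" "classical_passages \<alpha> \<inter> {..<s} = classical_passages \<alpha>" by force+
  then show ?thesis using that[of s] arc_plus_infinity_eq[of s] s
    by (auto simp: state_at_def end_label_def gauss_word_def)
qed

end

section \<open>The extended Alexander group is free\<close>

context open_string
begin

abbreviation "gens \<equiv> alexander_generators \<alpha>"
abbreviation "rels \<equiv> alexander_relations \<alpha>"
abbreviation "G \<equiv> alexander_group \<alpha>"

definition start :: "int \<times> int \<Rightarrow> alexander_generator word" where
  "start n = [letter (arc_minus_infinity \<alpha>) n]"

text \<open>The candidate for the inverse of \<open>start_hom\<close>: every arc generator is sent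
  to the word computed for it.\<close>

definition expand :: "alexander_generator \<Rightarrow> (int \<times> int) word" where
  "expand = (\<lambda>(a, n). arc_label \<alpha> a n)"

lemma arc_in_arcs:
  "t \<in> classical_passages \<alpha> \<Longrightarrow> arc_into \<alpha> t \<in> arcs \<alpha>"
  "t \<in> classical_passages \<alpha> \<Longrightarrow> arc_out_of \<alpha> t \<in> arcs \<alpha>"
  "arc_minus_infinity \<alpha> \<in> arcs \<alpha>" "arc_plus_infinity \<alpha> \<in> arcs \<alpha>"
  unfolding arcs_eq
     apply (metis DiffI UNIV_I arc_into_cases image_eqI)
    apply (metis DiffI UNIV_I arc_out_of_cases image_eqI)
   apply (metis DiffI UNIV_I arc_minus_infinity_cases image_eqI)
  apply (metis DiffI UNIV_I arc_plus_infinity_cases image_eqI)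
  done

lemma letter_in: "a \<in> arcs \<alpha> \<Longrightarrow> letter a n \<in> gens \<times> UNIV"
  by (simp add: letter_def alexander_generators_def)

lemma letter_in_lists: "a \<in> arcs \<alpha> \<Longrightarrow> [letter a n] \<in> lists (gens \<times> UNIV)"
  by (simp add: letter_def alexander_generators_def)

lemma arc_label_simps:
  "t \<in> classical_passages \<alpha> \<Longrightarrow> arc_label \<alpha> (arc_into \<alpha> t) = fst (state_at \<alpha> t)"
  "t \<in> classical_passages \<alpha> \<Longrightarrow>
    arc_label \<alpha> (arc_out_of \<alpha> t) = fst (step (gauss_passage \<alpha> t) (state_at \<alpha> t))"
  "arc_label \<alpha> (arc_minus_infinity \<alpha>) = fst initial_state"
  "arc_label \<alpha> (arc_plus_infinity \<alpha>) = end_label \<alpha>"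
     apply (metis arc_into_cases arc_label_arc_of)
    apply (metis arc_out_of_cases arc_label_arc_of)
   apply (metis arc_minus_infinity_cases arc_label_arc_of)
  apply (metis arc_plus_infinity_cases arc_label_arc_of)
  done

lemma expand_letter: "subst expand [letter a n] = arc_label \<alpha> a n"
  by (simp add: letter_def expand_def)

lemma expand_letters:
  "subst expand [letter a n, letter b m] = arc_label \<alpha> a n @ arc_label \<alpha> b m"
  by (simp add: letter_def expand_def subst_Cons)

text \<open>A passage acts by a crossing relation solved for the outgoing arc, so inserting the
  computed words turns each relation into an identity of the free group.\<close>

lemma expand_presentation: "presentation_map gens rels UNIV {} expand"
proof
  fix v w assume "(v, w) \<in> rels"
  then obtain s t where st: "(s, t) \<in> classical_crossings \<alpha>" and vw: "(v, w) \<in> crossing_relations \<alpha> (s, t)"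
    by (auto simp: alexander_relations_def)
  note cr = crossing_passages[OF st] gauss_passage_over[OF st] gauss_passage_under[OF st]
  obtain L st' where t: "state_at \<alpha> t = (L, st')" by force
  obtain M st'' where s: "state_at \<alpha> s = (M, st'')" by force
  note labels = arc_label_simps(1,2)[OF cr(1)] arc_label_simps(1,2)[OF cr(2)]
  have stored: "st' (fst \<alpha> t) = (if positive_crossing \<alpha> (s, t) then M else shift (0, 1) M)"
    using stored_label[OF st] by (simp add: s t)
  have "abs_fg (subst expand v) = abs_fg (subst expand w)"
  proof (cases "positive_crossing \<alpha> (s, t)")
    case True
    then show ?thesis using vw
      by (auto simp: crossing_relations_def Let_def expand_letter expand_letters labels cr s t stored
          shift_def fg_normalize add_uminus_conv_diff[where 'a = int] simp del: add_uminus_conv_diff)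
  next
    case False
    then show ?thesis using vw
      by (auto simp: crossing_relations_def Let_def expand_letter expand_letters labels cr s t stored
          shift_def fg_normalize add_uminus_conv_diff[where 'a = int] simp del: add_uminus_conv_diff)
  qed
  then show "presentation_eq UNIV {} (subst expand v) (subst expand w)" by (simp add: peq_free_iff)
qed simp

lemma start_presentation: "presentation_map UNIV {} gens rels start"
  by unfold_locales (simp_all add: start_def letter_in arc_in_arcs)

abbreviation start_hom :: "(int \<times> int) word set \<Rightarrow> alexander_generator word set" where
  "start_hom \<equiv> induced_hom UNIV {} gens rels start"

sublocale start: presentation_map UNIV "{}" gens rels start by (rule start_presentation)

sublocale G: group G
  unfolding alexander_group_def by (rule group_presented_group)

definition eval_start :: "(int \<times> int) word \<Rightarrow> alexander_generator word set" where
  "eval_start w = word_class gens rels (subst start w)"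

lemma subst_start_in_lists: "subst start w \<in> lists (gens \<times> UNIV)"
  by (rule subst_in_lists[where X = UNIV]) (simp_all add: start.gens)

lemma eval_start_simps:
  "eval_start w \<in> carrier G" "eval_start (v @ w) = eval_start v \<otimes>\<^bsub>G\<^esub> eval_start w"
  "eval_start (winv w) = inv\<^bsub>G\<^esub> eval_start w"
  unfolding eval_start_def alexander_group_def
  by (simp_all add: word_class_in_carrier mult_presented_group inv_presented_group subst_start_in_lists)

lemma alexander_gen_eq: "alexander_gen \<alpha> a n = word_class gens rels [letter a n]"
  by (simp add: alexander_gen_def generator_def letter_def)

lemma alexander_gen_in_carrier: "a \<in> arcs \<alpha> \<Longrightarrow> alexander_gen \<alpha> a n \<in> carrier G"
  by (simp add: alexander_gen_eq alexander_group_def word_class_in_carrier letter_in)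

lemma alexander_relation:
  assumes st: "(s, t) \<in> classical_crossings \<alpha>"
    and vw: "(v, w) \<in> crossing_relations \<alpha> (s, t)" "v \<in> lists (gens \<times> UNIV)" "w \<in> lists (gens \<times> UNIV)"
  shows "word_class gens rels v = word_class gens rels w"
  using assms by (intro word_class_eqI presentation_eq.relation) (auto simp: alexander_relations_def)

lemma two_letters:
  assumes "a \<in> arcs \<alpha>" "b \<in> arcs \<alpha>"
  shows "word_class gens rels [letter a n, letter b m] = alexander_gen \<alpha> a n \<otimes>\<^bsub>G\<^esub> alexander_gen \<alpha> b m"
  using mult_presented_group[OF letter_in_lists[OF assms(1)] letter_in_lists[OF assms(2)], of rels n m]
  by (simp add: alexander_gen_eq alexander_group_def)

lemma positive_relations:
  assumes st: "(s, t) \<in> classical_crossings \<alpha>" and pos: "positive_crossing \<alpha> (s, t)"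
  shows "alexander_gen \<alpha> (arc_into \<alpha> t) n \<otimes>\<^bsub>G\<^esub> alexander_gen \<alpha> (arc_into \<alpha> s) (n + (1, 0)) =
      alexander_gen \<alpha> (arc_out_of \<alpha> s) n \<otimes>\<^bsub>G\<^esub> alexander_gen \<alpha> (arc_out_of \<alpha> t) (n + (1, 0))"
    and "alexander_gen \<alpha> (arc_out_of \<alpha> s) (n + (0, 1)) = alexander_gen \<alpha> (arc_into \<alpha> s) n"
proof -
  note arcs = arc_in_arcs(1,2)[OF crossing_passages(1)[OF st]] arc_in_arcs(1,2)[OF crossing_passages(2)[OF st]]
  show "alexander_gen \<alpha> (arc_into \<alpha> t) n \<otimes>\<^bsub>G\<^esub> alexander_gen \<alpha> (arc_into \<alpha> s) (n + (1, 0)) =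
      alexander_gen \<alpha> (arc_out_of \<alpha> s) n \<otimes>\<^bsub>G\<^esub> alexander_gen \<alpha> (arc_out_of \<alpha> t) (n + (1, 0))"
    unfolding two_letters[symmetric, OF arcs(3,1)] two_letters[symmetric, OF arcs(2,4)]
    by (rule alexander_relation[OF st], unfold crossing_relations_def Let_def prod.case if_P[OF pos], blast)
      (simp_all add: letter_in arcs)
  show "alexander_gen \<alpha> (arc_out_of \<alpha> s) (n + (0, 1)) = alexander_gen \<alpha> (arc_into \<alpha> s) n"
    unfolding alexander_gen_eq
    by (rule alexander_relation[OF st], unfold crossing_relations_def Let_def prod.case if_P[OF pos], blast)
      (simp_all add: letter_in arcs)
qed

lemma negative_relations:
  assumes st: "(s, t) \<in> classical_crossings \<alpha>" and neg: "\<not> positive_crossing \<alpha> (s, t)"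
  shows "alexander_gen \<alpha> (arc_into \<alpha> s) n \<otimes>\<^bsub>G\<^esub> alexander_gen \<alpha> (arc_into \<alpha> t) (n + (1, 0)) =
      alexander_gen \<alpha> (arc_out_of \<alpha> t) n \<otimes>\<^bsub>G\<^esub> alexander_gen \<alpha> (arc_out_of \<alpha> s) (n + (1, 0))"
    and "alexander_gen \<alpha> (arc_into \<alpha> s) (n + (0, 1)) = alexander_gen \<alpha> (arc_out_of \<alpha> s) n"
proof -
  note arcs = arc_in_arcs(1,2)[OF crossing_passages(1)[OF st]] arc_in_arcs(1,2)[OF crossing_passages(2)[OF st]]
  show "alexander_gen \<alpha> (arc_into \<alpha> s) n \<otimes>\<^bsub>G\<^esub> alexander_gen \<alpha> (arc_into \<alpha> t) (n + (1, 0)) =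
      alexander_gen \<alpha> (arc_out_of \<alpha> t) n \<otimes>\<^bsub>G\<^esub> alexander_gen \<alpha> (arc_out_of \<alpha> s) (n + (1, 0))"
    unfolding two_letters[symmetric, OF arcs(1,3)] two_letters[symmetric, OF arcs(4,2)]
    by (rule alexander_relation[OF st], unfold crossing_relations_def Let_def prod.case if_not_P[OF neg], blast)
      (simp_all add: letter_in arcs)
  show "alexander_gen \<alpha> (arc_into \<alpha> s) (n + (0, 1)) = alexander_gen \<alpha> (arc_out_of \<alpha> s) n"
    unfolding alexander_gen_eq
    by (rule alexander_relation[OF st], unfold crossing_relations_def Let_def prod.case if_not_P[OF neg], blast)
      (simp_all add: letter_in arcs)
qed

text \<open>The same solution of the relations, now carried out inside the group. Every arc that
  enters it, also at the earlier overpassage, contains a point before \<open>t\<close> or is the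
  outgoing arc of the overstrand, which its shift relation expresses by the incoming one.\<close>

lemma eval_arc_out_of:
  assumes t: "t \<in> classical_passages \<alpha>"
    and before: "\<And>x n. x < t \<Longrightarrow> x \<notin> classical_passages \<alpha> \<Longrightarrow>
      eval_start (fst (state_at \<alpha> x) n) = alexander_gen \<alpha> (arc_of \<alpha> x) n"
  shows "eval_start (fst (step (gauss_passage \<alpha> t) (state_at \<alpha> t)) n) = alexander_gen \<alpha> (arc_out_of \<alpha> t) n"
proof -
  have into: "eval_start (fst (state_at \<alpha> r) n) = alexander_gen \<alpha> (arc_into \<alpha> r) n"
    if "r \<in> classical_passages \<alpha>" "r \<le> t" for r n
    using arc_into_cases[OF that(1)] before that by (metis order_less_le_trans)
  have over: "eval_start (shift (0, if positive_crossing \<alpha> (r, r') then - 1 else 1) (fst (state_at \<alpha> r)) n) =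
      alexander_gen \<alpha> (arc_out_of \<alpha> r) n"
    if r: "(r, r') \<in> classical_crossings \<alpha>" "r \<le> t" for r r' n
    using into[OF crossing_passages(1)[OF r(1)] r(2)] positive_relations(2)[OF r(1), of "n - (0, 1)"]
      negative_relations(2)[OF r(1), of n] by (cases n) (auto simp: shift_def)
  from t show ?thesis
  proof (cases rule: passage_cases)
    case (1 s)
    note cr = crossing_passages[OF 1] gauss_passage_under[OF 1]
    obtain L st where L: "state_at \<alpha> t = (L, st)" by force
    note arcs = arc_in_arcs(1,2)[OF cr(1)] arc_in_arcs(1,2)[OF cr(2)]
    note carrier = alexander_gen_in_carrier[OF arcs(1)] alexander_gen_in_carrier[OF arcs(2)]
      alexander_gen_in_carrier[OF arcs(3)] alexander_gen_in_carrier[OF arcs(4)]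
    have Lt: "eval_start (L n) = alexander_gen \<alpha> (arc_into \<alpha> t) n" for n
      using into[OF t] by (simp add: L)
    show ?thesis
    proof (cases "positive_crossing \<alpha> (s, t)")
      case True
      have stored: "eval_start (st (fst \<alpha> t) n) = alexander_gen \<alpha> (arc_into \<alpha> s) n" for n
        using stored_label[OF 1] into[OF cr(1)] cr(3) True by (simp add: L)
      \<comment> \<open>The stored label is b, but the product relation at \<open>n - (1, 0)\<close>
        contains c at \<open>n - (1, 0)\<close>; the shift relation identifies this with b at
        \<open>n - (1, 1)\<close>.\<close>
      have "alexander_gen \<alpha> (arc_into \<alpha> s) (n - (1, 1)) = alexander_gen \<alpha> (arc_out_of \<alpha> s) (n - (1, 0))"
        using positive_relations(2)[OF 1 True, of "n - (1, 1)"] by (cases n) simp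
      then show ?thesis
        using positive_relations(1)[OF 1 True, of "n - (1, 0)"] True carrier
        by (simp add: cr L eval_start_simps stored Lt diff_add_cancel)
          (simp add: G.m_assoc[symmetric])
    next
      case False
      have stored: "eval_start (st (fst \<alpha> t) n) = alexander_gen \<alpha> (arc_out_of \<alpha> s) n" for n
        using stored_label[OF 1] over[OF 1] cr(3) False by (simp add: L)
      \<comment> \<open>Here the stored label is d, and the factor a at \<open>n\<close> of the
        product relation is d at \<open>n - (0, 1)\<close>.\<close>
      have "alexander_gen \<alpha> (arc_out_of \<alpha> s) (n - (0, 1)) = alexander_gen \<alpha> (arc_into \<alpha> s) n"
        using negative_relations(2)[OF 1 False, of "n - (0, 1)"] by (simp add: diff_add_cancel)
      then show ?thesis
        using negative_relations(1)[OF 1 False, of n] False carrier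
        by (simp add: cr L eval_start_simps stored Lt G.m_assoc[symmetric]) (simp add: G.m_assoc)
    qed
  next
    case (2 s)
    show ?thesis using over[OF 2] gauss_passage_over[OF 2] 
      by (cases "state_at \<alpha> t") simp
  qed
qed

text \<open>Induction on the number of passages before \<open>s\<close>; the arc of \<open>s\<close>
  leaves the last one of them, and everything before that passage is covered by the
  hypothesis.\<close>

lemma eval_arc_of:
  "s \<notin> classical_passages \<alpha> \<Longrightarrow> eval_start (fst (state_at \<alpha> s) n) = alexander_gen \<alpha> (arc_of \<alpha> s) n"
proof (induction "card (classical_passages \<alpha> \<inter> {..<s})" arbitrary: s n rule: less_induct)
  case less
  show ?case
  proof (cases "classical_passages \<alpha> \<inter> {..<s} = {}")
    case True
    then have "{..s} \<inter> classical_passages \<alpha> = {}" using less.prems by (auto simp: le_less)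
    then show ?thesis using True
      by (simp add: arc_minus_infinity_eq[symmetric] state_at_def gauss_word_def initial_state_def
          eval_start_def start_def alexander_gen_eq)
  next
    case False
    define t where "t = Max (classical_passages \<alpha> \<inter> {..<s})"
    have t: "t \<in> classical_passages \<alpha> \<inter> {..<s}" unfolding t_def using finite_passages False by (intro Max_in) auto
    have gap: "{t<..<s} \<inter> classical_passages \<alpha> = {}"
    proof (rule equals0I)
      fix x assume x: "x \<in> {t<..<s} \<inter> classical_passages \<alpha>"
      then have "x \<le> t" unfolding t_def using finite_passages by (intro Max_ge) auto
      then show False using x by simp
    qed
    then have "{t<..s} \<inter> classical_passages \<alpha> = {}" using less.prems by (auto simp: disjoint_iff le_less)
    then have arc: "arc_out_of \<alpha> t = arc_of \<alpha> s" using t by (intro arc_out_of_eq) auto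
    have before: "eval_start (fst (state_at \<alpha> x) n) = alexander_gen \<alpha> (arc_of \<alpha> x) n"
      if "x < t" "x \<notin> classical_passages \<alpha>" for x n
    proof (rule less.hyps[OF _ that(2)])
      show "card (classical_passages \<alpha> \<inter> {..<x}) < card (classical_passages \<alpha> \<inter> {..<s})"
      proof (rule psubset_card_mono)
        have "t \<notin> classical_passages \<alpha> \<inter> {..<x}" using that by simp
        moreover have "classical_passages \<alpha> \<inter> {..<x} \<subseteq> classical_passages \<alpha> \<inter> {..<s}" using t that by auto
        ultimately show "classical_passages \<alpha> \<inter> {..<x} \<subset> classical_passages \<alpha> \<inter> {..<s}" using t by blast
      qed (simp add: finite_passages)
    qed
    have "t \<in> classical_passages \<alpha>" "t < s" using t by auto
    from eval_arc_out_of[OF this(1) before, of n] state_at_step[OF this gap] show ?thesis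
      by (simp add: arc)
  qed
qed

text \<open>The initial arc has the generators of F as its label, so \<open>expand\<close> after
  \<open>start\<close> is the identity; the other composite is \<open>eval_arc_of\<close>.\<close>

lemma start_iso: "start_hom \<in> iso free_group_F G"
  unfolding free_group_F_def alexander_group_def
proof (rule start.induced_hom_iso[OF expand_presentation])
  fix n show "presentation_eq UNIV {} (subst expand (start n)) [(n, True)]"
    by (simp add: start_def expand_letter arc_label_simps initial_state_def presentation_eq.refl)
next
  fix y assume "y \<in> gens"
  then obtain s n where s: "s \<notin> classical_passages \<alpha>" and y: "y = (arc_of \<alpha> s, n)"
    by (auto simp: alexander_generators_def arcs_eq)
  have "word_class gens rels (subst start (expand y)) = word_class gens rels [(y, True)]"
    using eval_arc_of[OF s, of n]
    by (simp add: y expand_def arc_label_arc_of[OF s] eval_start_def alexander_gen_eq letter_def)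
  then show "presentation_eq gens rels (subst start (expand y)) [(y, True)]"
    using \<open>y \<in> gens\<close> by (subst (asm) word_class_eq_iff) auto
qed

end

section \<open>The endomorphism of a diagram\<close>

definition label_endo :: "(int \<times> int) label \<Rightarrow> (int \<times> int) word set \<Rightarrow> (int \<times> int) word set" where
  "label_endo L = induced_hom UNIV {} UNIV {} L"

lemma free_presentation: "presentation_map UNIV {} UNIV {} (L :: (int \<times> int) label)"
  by unfold_locales auto

lemma label_endo_word_class: "label_endo L (word_class UNIV {} w) = word_class UNIV {} (subst L w)"
  unfolding label_endo_def
  using presentation_map.induced_hom_word_class[OF free_presentation] by simp

lemma label_endo_in_carrier: "label_endo L \<in> carrier (End_monoid free_group_F)"
  using presentation_map.induced_hom_hom[OF free_presentation, of L]
  by (simp add: label_endo_def End_monoid_def free_group_F_def) (simp add: induced_hom_def)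

lemma group_free_group_F: "group free_group_F"
  unfolding free_group_F_def by (rule group_presented_group)

lemma carrier_free_group_F: "carrier free_group_F = range (word_class UNIV {})"
  by (simp add: free_group_F_def carrier_presented_group)

lemma F_gen_eq: "F_gen n = word_class UNIV {} [(n, True)]"
  by (simp add: F_gen_def generator_def)

lemma hom_free_group_F_agree:
  "f \<in> hom free_group_F H \<Longrightarrow> g \<in> hom free_group_F H \<Longrightarrow> group H \<Longrightarrow> (\<And>n. f (F_gen n) = g (F_gen n)) \<Longrightarrow>
    a \<in> carrier free_group_F \<Longrightarrow> f a = g a"
  unfolding free_group_F_def F_gen_def by (rule hom_agree_on_generators) auto

lemma label_endo_cong: "(\<And>n. abs_fg (L n) = abs_fg (M n)) \<Longrightarrow> label_endo L = label_endo M"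
proof (rule ext)
  fix a assume eq: "\<And>n. abs_fg (L n) = abs_fg (M n)"
  have hom: "label_endo K \<in> hom free_group_F free_group_F" for K
    using label_endo_in_carrier[of K] by (simp add: End_monoid_def)
  show "label_endo L a = label_endo M a"
  proof (cases "a \<in> carrier free_group_F")
    case True
    show ?thesis
    proof (rule hom_free_group_F_agree[OF hom hom group_free_group_F _ True])
      fix n show "label_endo L (F_gen n) = label_endo M (F_gen n)"
        using eq by (simp add: F_gen_eq label_endo_word_class word_class_eq_iff peq_free_iff)
    qed
  next
    case False
    then show ?thesis by (simp add: label_endo_def induced_hom_def free_group_F_def)
  qed
qed

lemma label_endo_comp:
  "mult (End_monoid free_group_F) (label_endo L) (label_endo M) = label_endo (\<lambda>n. subst L (M n))"
proof (rule ext)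
  fix a show "mult (End_monoid free_group_F) (label_endo L) (label_endo M) a = label_endo (\<lambda>n. subst L (M n)) a"
  proof (cases "a \<in> carrier free_group_F")
    case True
    then show ?thesis
      by (auto simp: End_monoid_def compose_def carrier_free_group_F label_endo_word_class subst_subst)
  next
    case False
    then show ?thesis
      by (simp add: End_monoid_def compose_def label_endo_def induced_hom_def free_group_F_def)
  qed
qed

context open_string
begin

lemma is_Phi_label_endo: "is_Phi \<alpha> (label_endo (end_label \<alpha>))"
  unfolding is_Phi_def
proof (intro conjI bexI allI)
  fix n
  show "start_hom (F_gen n) = alexander_gen \<alpha> (arc_minus_infinity \<alpha>) n"
    by (simp add: F_gen_eq start.induced_hom_word_class start_def alexander_gen_eq)
  obtain s where s: "s \<notin> classical_passages \<alpha>" "arc_plus_infinity \<alpha> = arc_of \<alpha> s"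
    "fst (state_at \<alpha> s) = end_label \<alpha>" by (rule arc_plus_infinity_cases)
  then show "start_hom (label_endo (end_label \<alpha>) (F_gen n)) = alexander_gen \<alpha> (arc_plus_infinity \<alpha>) n"
    using eval_arc_of[OF s(1), of n]
    by (simp add: F_gen_eq label_endo_word_class start.induced_hom_word_class eval_start_def)
qed (use label_endo_in_carrier start_iso in auto)

text \<open>Two identifications agree on the generators of F, hence on all of F. Their injectivity
  then fixes the value of the endomorphism at each generator.\<close>

lemma is_Phi_unique:
  assumes "is_Phi \<alpha> f" "is_Phi \<alpha> g"
  shows "f = g"
proof -
  obtain h h' where h: "h \<in> iso free_group_F G" "\<And>n. h (F_gen n) = alexander_gen \<alpha> (arc_minus_infinity \<alpha>) n"
      "\<And>n. h (f (F_gen n)) = alexander_gen \<alpha> (arc_plus_infinity \<alpha>) n"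
    and h': "h' \<in> iso free_group_F G" "\<And>n. h' (F_gen n) = alexander_gen \<alpha> (arc_minus_infinity \<alpha>) n"
      "\<And>n. h' (g (F_gen n)) = alexander_gen \<alpha> (arc_plus_infinity \<alpha>) n"
    using assms unfolding is_Phi_def by metis
  have fg: "f \<in> hom free_group_F free_group_F" "g \<in> hom free_group_F free_group_F"
    "f \<in> extensional (carrier free_group_F)" "g \<in> extensional (carrier free_group_F)"
    using assms by (auto simp: is_Phi_def End_monoid_def)
  have hh': "h a = h' a" if "a \<in> carrier free_group_F" for a
    using h h' that G.is_group by (intro hom_free_group_F_agree[of h G h' a]) (auto simp: iso_def)
  have gen: "F_gen n \<in> carrier free_group_F" for n by (simp add: carrier_free_group_F F_gen_eq)
  have "f (F_gen n) = g (F_gen n)" for n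
  proof -
    have c: "f (F_gen n) \<in> carrier free_group_F" "g (F_gen n) \<in> carrier free_group_F"
      using hom_in_carrier[OF fg(1) gen] hom_in_carrier[OF fg(2) gen] by auto
    have "h (f (F_gen n)) = h (g (F_gen n))" using h(3) h'(3) hh' c by metis
    then show ?thesis using h(1) c by (auto simp: iso_def bij_betw_def inj_on_def)
  qed
  then have "f a = g a" if "a \<in> carrier free_group_F" for a
    using hom_free_group_F_agree[OF fg(1,2) group_free_group_F] that by blast
  then show ?thesis using fg(3,4) by (intro extensionalityI)
qed

lemma Phi_eq: "Phi \<alpha> = label_endo (end_label \<alpha>)"
  unfolding Phi_def using is_Phi_label_endo is_Phi_unique by blast

end

section \<open>Invariance under planar isotopy\<close>

text \<open>The monotone \<open>f\<close> matches the times and \<open>h\<close> the names.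
  \<open>S\<close> and \<open>S'\<close> allow parts of strings to be compared; the condition on
  crossings covers those with a single passage in \<open>S\<close>, since a passage gets its type
  and sign from its partner, wherever that lies.\<close>

lemma gauss_word_transport:
  assumes \<alpha>: "open_string \<alpha>" and \<beta>: "open_string \<beta>" and f: "strict_mono f"
    and passages: "classical_passages \<beta> \<inter> S' = f ` (classical_passages \<alpha> \<inter> S)"
    and crossings: "\<And>s t. (s, t) \<in> classical_crossings \<alpha> \<Longrightarrow> s \<in> S \<or> t \<in> S \<Longrightarrow>
      (f s, f t) \<in> classical_crossings \<beta> \<and> fst \<beta> (f t) = h (fst \<alpha> t) \<and>
      positive_crossing \<beta> (f s, f t) = positive_crossing \<alpha> (s, t)"
  shows "gauss_word \<beta> S' = map (map_passage h) (gauss_word \<alpha> S)"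
proof -
  interpret \<alpha>: open_string \<alpha> by fact
  interpret \<beta>: open_string \<beta> by fact
  let ?A = "classical_passages \<alpha> \<inter> S"
  have fin: "finite ?A" using \<alpha>.finite_passages by simp
  have sorted: "sorted_list_of_set (f ` ?A) = map f (sorted_list_of_set ?A)"
  proof (rule sorted_distinct_set_unique)
    show "sorted (map f (sorted_list_of_set ?A))"
      unfolding sorted_map
      by (rule sorted_wrt_mono_rel[OF _ sorted_sorted_list_of_set]) (use strict_mono_less_eq[OF f] in auto)
    show "distinct (map f (sorted_list_of_set ?A))"
      using strict_mono_imp_inj_on[OF f] fin by (simp add: distinct_map)
  qed (use fin in auto)
  have "gauss_passage \<beta> (f t) = map_passage h (gauss_passage \<alpha> t)" if "t \<in> ?A" for t
  proof -
    from that have "t \<in> classical_passages \<alpha>" "t \<in> S" by auto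
    from this(1) show ?thesis
    proof (cases rule: \<alpha>.passage_cases)
      case (1 s)
      then have c: "(f s, f t) \<in> classical_crossings \<beta>" using crossings \<open>t \<in> S\<close> by blast
      show ?thesis
        using crossings[OF 1] \<open>t \<in> S\<close> \<alpha>.gauss_passage_under[OF 1] \<beta>.gauss_passage_under[OF c] by simp
    next
      case (2 s)
      then have c: "(f t, f s) \<in> classical_crossings \<beta>" using crossings \<open>t \<in> S\<close> by blast
      show ?thesis
        using crossings[OF 2] \<open>t \<in> S\<close> \<alpha>.gauss_passage_over[OF 2] \<beta>.gauss_passage_over[OF c] by simp
    qed
  qed
  then show ?thesis using fin by (simp add: gauss_word_def passages sorted)
qed

lemma det2_linear:
  assumes "linear D"
  shows "det2 (D v) (D w) = det2 (D (1, 0)) (D (0, 1)) * det2 v w"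
proof -
  have D: "D x = fst x *\<^sub>R D (1, 0) + snd x *\<^sub>R D (0, 1)" for x
    using linear_add[OF assms, of "(fst x, 0)" "(0, snd x)"]
      linear_scale[OF assms, of "fst x" "(1, 0)"] linear_scale[OF assms, of "snd x" "(0, 1)"] by simp
  show ?thesis by (subst D[of v], subst D[of w]) (simp add: det2_def algebra_simps)
qed

lemma det2_scale: "det2 (a *\<^sub>R v) (b *\<^sub>R w) = a * b * det2 v w"
  by (simp add: det2_def algebra_simps)

lemma (in open_string) has_velocity: "(fst \<alpha> has_vector_derivative velocity (fst \<alpha>) t) (at t)"
  using generic unfolding generic_immersion_def C1_differentiable_on_eq velocity_def
  by (simp add: vector_derivative_works)

lemma (in open_string) transversal:
  "s \<noteq> t \<Longrightarrow> fst \<alpha> s = fst \<alpha> t \<Longrightarrow> det2 (velocity (fst \<alpha>) s) (velocity (fst \<alpha>) t) \<noteq> 0"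
  using generic unfolding generic_immersion_def by blast

lemma end_label_planar_isotopy:
  assumes \<alpha>: "open_string \<alpha>" and \<beta>: "open_string \<beta>" and iso: "planar_isotopy \<alpha> \<beta>"
  shows "end_label \<alpha> = end_label \<beta>"
proof -
  interpret \<alpha>: open_string \<alpha> by fact
  interpret \<beta>: open_string \<beta> by fact
  obtain H r where H: "ambient_isotopy H" and r: "bij r" "\<And>t. \<exists>d>0. (r has_real_derivative d) (at t)"
    and \<beta>_eq: "\<And>t. fst \<beta> t = H 1 (fst \<alpha> (r t))" and V: "snd \<beta> = H 1 ` snd \<alpha>"
    using iso unfolding planar_isotopy_def by blast
  have "orientation_preserving_diffeo (H 1)" using H by (simp add: ambient_isotopy_def)
  then obtain D where bij: "bij (H 1)" and D: "\<And>p. (H 1 has_derivative D p) (at p)"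
    and pos: "\<And>p. det2 (D p (1, 0)) (D p (0, 1)) > 0"
    unfolding orientation_preserving_diffeo_def by blast
  have inj: "inj (H 1)" using bij by (rule bij_is_inj)
  have mono: "strict_mono r"
  proof (rule strict_monoI)
    fix x y :: real assume "x < y"
    then show "r x < r y" by (rule DERIV_pos_imp_increasing) (use r(2) in blast)
  qed
  have double: "double_points (fst \<beta>) = H 1 ` double_points (fst \<alpha>)"
  proof (intro equalityI subsetI)
    fix p assume "p \<in> double_points (fst \<beta>)"
    then obtain s t where st: "s \<noteq> t" "fst \<beta> s = p" "fst \<beta> t = p" unfolding double_points_def by blast
    then have "fst \<alpha> (r s) = fst \<alpha> (r t)" using inj \<beta>_eq by (metis injD)
    moreover have "r s \<noteq> r t" using r(1) st(1) by (simp add: bij_is_inj inj_eq)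
    ultimately have "fst \<alpha> (r s) \<in> double_points (fst \<alpha>)" unfolding double_points_def by force
    then show "p \<in> H 1 ` double_points (fst \<alpha>)" using \<beta>_eq st(2) by blast
  next
    fix p assume "p \<in> H 1 ` double_points (fst \<alpha>)"
    then obtain q where "q \<in> double_points (fst \<alpha>)" "p = H 1 q" by (rule imageE)
    then obtain s t where st: "s \<noteq> t" "H 1 (fst \<alpha> s) = p" "H 1 (fst \<alpha> t) = p"
      by (auto simp: double_points_def)
    obtain s' t' where "s = r s'" "t = r t'" using r(1) by (meson bij_pointE)
    then have "s' \<noteq> t' \<and> fst \<beta> s' = p \<and> fst \<beta> t' = p" using st \<beta>_eq by auto
    then show "p \<in> double_points (fst \<beta>)" unfolding double_points_def by blast
  qed
  have passages: "t \<in> classical_passages \<beta> \<longleftrightarrow> r t \<in> classical_passages \<alpha>" for t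
    using inj by (simp add: classical_passages_def double V \<beta>_eq inj_image_mem_iff image_set_diff[symmetric])
  have det: "positive_crossing \<beta> (s, t) = positive_crossing \<alpha> (r s, r t)" if "fst \<beta> s = fst \<beta> t" for s t
  proof -
    have eq: "fst \<alpha> (r s) = fst \<alpha> (r t)" using that inj \<beta>_eq by (metis injD)
    have vel: "\<exists>d>0. velocity (fst \<beta>) t = D (fst \<alpha> (r t)) (d *\<^sub>R velocity (fst \<alpha>) (r t))" for t
    proof -
      obtain d where d: "d > 0" "(r has_real_derivative d) (at t)" using r(2) by blast
      have "((fst \<alpha> \<circ> r) has_vector_derivative d *\<^sub>R velocity (fst \<alpha>) (r t)) (at t)"
        using d(2) \<alpha>.has_velocity by (intro vector_diff_chain_at) (simp_all add: has_real_derivative_iff_has_vector_derivative)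
      then have "((H 1 \<circ> (fst \<alpha> \<circ> r)) has_vector_derivative D (fst \<alpha> (r t)) (d *\<^sub>R velocity (fst \<alpha>) (r t))) (at t)"
        by (rule vector_derivative_diff_chain_within[OF _ has_derivative_at_withinI]) (simp add: D)
      moreover have "fst \<beta> = H 1 \<circ> (fst \<alpha> \<circ> r)" using \<beta>_eq by auto
      ultimately show ?thesis using d(1) vector_derivative_unique_at \<beta>.has_velocity by metis
    qed
    obtain d where d: "d > 0" "velocity (fst \<beta>) s = D (fst \<alpha> (r t)) (d *\<^sub>R velocity (fst \<alpha>) (r s))"
      using vel[of s] eq by auto
    obtain e where e: "e > 0" "velocity (fst \<beta>) t = D (fst \<alpha> (r t)) (e *\<^sub>R velocity (fst \<alpha>) (r t))"
      using vel[of t] by auto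
    \<comment> \<open>The determinants of the two pairs of velocities differ by the Jacobian of
      \<open>H 1\<close> and by the two speed factors from \<open>r\<close>, all of them
      positive.\<close>
    have "linear (D (fst \<alpha> (r t)))" using D has_derivative_linear by blast
    then have "det2 (velocity (fst \<beta>) s) (velocity (fst \<beta>) t) =
      det2 (D (fst \<alpha> (r t)) (1, 0)) (D (fst \<alpha> (r t)) (0, 1)) * (d * e * det2 (velocity (fst \<alpha>) (r s)) (velocity (fst \<alpha>) (r t)))"
      unfolding d(2) e(2) by (subst det2_linear) (simp_all add: det2_scale)
    then show ?thesis using pos[of "fst \<alpha> (r t)"] d(1) e(1)
      by (auto simp: positive_crossing_def zero_less_mult_iff mult_less_0_iff)
  qed
  \<comment> \<open>\<open>r\<close> takes the times of \<beta> to those of \<alpha>, so the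
    transport runs from \<beta> to \<alpha> and the points are renamed by the inverse of
    \<open>H 1\<close>.\<close>
  have "gauss_word \<alpha> UNIV = map (map_passage (inv_into UNIV (H 1))) (gauss_word \<beta> UNIV)"
  proof (rule gauss_word_transport[OF \<beta> \<alpha> mono])
    show "classical_passages \<alpha> \<inter> UNIV = r ` (classical_passages \<beta> \<inter> UNIV)"
      using passages r(1) by (auto simp: image_iff) (metis bij_pointE)
  next
    fix s t assume "(s, t) \<in> classical_crossings \<beta>"
    then have st: "s < t" "fst \<beta> s = fst \<beta> t" "fst \<beta> s \<notin> snd \<beta>" by (auto simp: classical_crossings_def)
    then have "fst \<alpha> (r s) = fst \<alpha> (r t)" using inj \<beta>_eq by (metis injD)
    moreover have "r s < r t" using mono st(1) by (simp add: strict_mono_less)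
    moreover have "fst \<alpha> (r s) \<notin> snd \<alpha>" using st(3) by (auto simp: V \<beta>_eq)
    ultimately show "(r s, r t) \<in> classical_crossings \<alpha> \<and> fst \<alpha> (r t) = inv_into UNIV (H 1) (fst \<beta> t) \<and>
        positive_crossing \<alpha> (r s, r t) = positive_crossing \<beta> (s, t)"
      using det[OF st(2)] inj by (simp add: classical_crossings_def \<beta>_eq)
  qed
  moreover have "inj (inv_into UNIV (H 1))" using bij by (simp add: bij_imp_bij_inv bij_is_inj)
  ultimately show ?thesis
    unfolding end_label_def initial_state_def by (simp add: fold_step_rename comp_def)
qed

section \<open>Invariance under the Reidemeister moves\<close>

lemma (in open_string) gauss_word_split_UNIV:
  "l \<le> h \<Longrightarrow> gauss_word \<alpha> UNIV = gauss_word \<alpha> {..<l} @ gauss_word \<alpha> {l..h} @ gauss_word \<alpha> {h<..}"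
proof -
  assume "l \<le> h"
  have "gauss_word \<alpha> ({..<l} \<union> ({l..h} \<union> {h<..})) = gauss_word \<alpha> {..<l} @ gauss_word \<alpha> {l..h} @ gauss_word \<alpha> {h<..}"
    using \<open>l \<le> h\<close> by (subst gauss_word_Un, force, subst gauss_word_Un) auto
  moreover have "{..<l} \<union> ({l..h} \<union> {h<..}) = UNIV" using \<open>l \<le> h\<close> by auto
  ultimately show ?thesis by simp
qed

lemma (in open_string) gauss_word_split_above:
  "k < l \<Longrightarrow> l \<le> h \<Longrightarrow> gauss_word \<alpha> {k<..} = gauss_word \<alpha> {k<..<l} @ gauss_word \<alpha> {l..h} @ gauss_word \<alpha> {h<..}"
proof -
  assume "k < l" "l \<le> h"
  have "gauss_word \<alpha> ({k<..<l} \<union> ({l..h} \<union> {h<..})) = gauss_word \<alpha> {k<..<l} @ gauss_word \<alpha> {l..h} @ gauss_word \<alpha> {h<..}"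
    using \<open>l \<le> h\<close> by (subst gauss_word_Un, force, subst gauss_word_Un) auto
  moreover have "{k<..<l} \<union> ({l..h} \<union> {h<..}) = {k<..}" using \<open>k < l\<close> \<open>l \<le> h\<close> by auto
  ultimately show ?thesis by simp
qed

section \<open>Time intervals and directions of the strands in a disc\<close>

locale strand_times =
  fixes n :: nat and \<tau> :: "nat \<Rightarrow> real \<Rightarrow> real"
  assumes inj: "inj_on (\<lambda>(i, x). \<tau> i x) ({..<n} \<times> {-1..1})"
    and deriv: "\<And>i x. i < n \<Longrightarrow> x \<in> {-1..1} \<Longrightarrow> \<exists>d. d \<noteq> 0 \<and> (\<tau> i has_real_derivative d) (at x within {-1..1})"
begin

definition rising :: "nat \<Rightarrow> bool" where "rising i \<longleftrightarrow> \<tau> i (-1) < \<tau> i 1"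
definition lo :: "nat \<Rightarrow> real" where "lo i = Inf (\<tau> i ` {-1..1})"
definition hi :: "nat \<Rightarrow> real" where "hi i = Sup (\<tau> i ` {-1..1})"

lemma \<tau>_eq_iff: "i < n \<Longrightarrow> j < n \<Longrightarrow> x \<in> {-1..1} \<Longrightarrow> y \<in> {-1..1} \<Longrightarrow> \<tau> i x = \<tau> j y \<longleftrightarrow> i = j \<and> x = y"
  using inj unfolding inj_on_def by fastforce

lemma continuous_\<tau>: "i < n \<Longrightarrow> continuous_on {-1..1} (\<tau> i)"
  unfolding continuous_on_eq_continuous_within using deriv DERIV_continuous by blast

text \<open>An injective continuous function on an interval is strictly monotone; the values at the
  end points tell in which direction.\<close>

lemma \<tau>_less:
  assumes i: "i < n" and xy: "-1 \<le> x" "x < y" "y \<le> 1"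
  shows "if rising i then \<tau> i x < \<tau> i y else \<tau> i y < \<tau> i x"
proof -
  have between: "(\<tau> i a < \<tau> i b \<and> \<tau> i b < \<tau> i c) \<or> (\<tau> i c < \<tau> i b \<and> \<tau> i b < \<tau> i a)"
    if "-1 \<le> a" "a < b" "b < c" "c \<le> 1" for a b c
    using that i by (intro continuous_inj_imp_mono continuous_on_subset[OF continuous_\<tau>]) (auto simp: inj_on_def \<tau>_eq_iff)
  have "\<tau> i (-1) \<noteq> \<tau> i 1" using \<tau>_eq_iff[OF i i] by auto
  moreover have "x = -1 \<or> (\<tau> i (-1) < \<tau> i x \<and> \<tau> i x < \<tau> i 1) \<or> (\<tau> i 1 < \<tau> i x \<and> \<tau> i x < \<tau> i (-1))"
    using between[of "-1" x 1] xy by linarith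
  moreover have "y = 1 \<or> (\<tau> i x < \<tau> i y \<and> \<tau> i y < \<tau> i 1) \<or> (\<tau> i 1 < \<tau> i y \<and> \<tau> i y < \<tau> i x)"
    using between[of x y 1] xy by linarith
  ultimately show ?thesis unfolding rising_def by auto
qed

lemma \<tau>_image: assumes "i < n" shows "\<tau> i ` {-1..1} = {lo i..hi i}" "lo i \<le> hi i"
proof -
  obtain a b where "\<tau> i ` {-1..1} = {a..b}" "a \<le> b"
    using continuous_image_closed_interval[OF _ continuous_\<tau>[OF assms]] by auto
  then show "\<tau> i ` {-1..1} = {lo i..hi i}" "lo i \<le> hi i" by (simp_all add: lo_def hi_def)
qed

lemma hi_less_lo:
  assumes "i < n" "j < n" "i \<noteq> j"
  shows "hi i < lo j \<or> hi j < lo i"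
proof (rule ccontr)
  assume "\<not> ?thesis"
  \<comment> \<open>If the time intervals of two strands overlapped, the larger of their left end
    points would belong to both, against injectivity.\<close>
  then have "max (lo i) (lo j) \<in> {lo i..hi i} \<inter> {lo j..hi j}"
    using \<tau>_image(2)[OF assms(1)] \<tau>_image(2)[OF assms(2)] by auto
  then show False
    unfolding \<tau>_image(1)[OF assms(1), symmetric] \<tau>_image(1)[OF assms(2), symmetric]
    using assms \<tau>_eq_iff by auto
qed

lemma \<tau>_derivative:
  assumes i: "i < n" and x: "-1 < x" "x < 1"
  obtains d where "d \<noteq> 0" "(\<tau> i has_real_derivative d) (at x)" "d > 0 \<longleftrightarrow> rising i"
proof -
  obtain d where d: "d \<noteq> 0" "(\<tau> i has_real_derivative d) (at x within {-1..1})"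
    using deriv[OF i, of x] x by auto
  then have D: "(\<tau> i has_real_derivative d) (at x)" using x by (simp add: at_within_Icc_at)
  have "d > 0 \<longleftrightarrow> rising i"
  proof (cases "d > 0")
    case True
    then obtain e where "e > 0" and e: "\<forall>h>0. h < e \<longrightarrow> \<tau> i x < \<tau> i (x + h)"
      using DERIV_pos_inc_right[OF D] by auto
    \<comment> \<open>Small enough for the derivative to decide the comparison, and for
      \<open>x + h\<close> to stay in the domain of \<open>\<tau> i\<close>.\<close>
    define h where "h = min (e / 2) (1 - x)"
    have "h > 0" "h < e" "x + h \<le> 1" using \<open>e > 0\<close> x by (auto simp: h_def min_def)
    then show ?thesis using True e \<tau>_less[OF i, of x "x + h"] x by (auto split: if_splits)
  next
    case False
    then have "d < 0" using d(1) by simp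
    then obtain e where "e > 0" and e: "\<forall>h>0. h < e \<longrightarrow> \<tau> i (x + h) < \<tau> i x"
      using DERIV_neg_dec_right[OF D] by auto
    define h where "h = min (e / 2) (1 - x)"
    have "h > 0" "h < e" "x + h \<le> 1" using \<open>e > 0\<close> x by (auto simp: h_def min_def)
    then show ?thesis using False e \<tau>_less[OF i, of x "x + h"] x by (auto split: if_splits)
  qed
  then show ?thesis using that d(1) D by blast
qed

end

section \<open>Passages and signs of the crossings in a disc\<close>

lemma (in open_string) double_point_iff: "fst \<alpha> s \<in> double_points (fst \<alpha>) \<longleftrightarrow> (\<exists>t. t \<noteq> s \<and> fst \<alpha> t = fst \<alpha> s)"
  unfolding double_points_def by (auto intro: sym) metis

lemma (in open_string) gauss_word_pair:
  assumes "classical_passages \<alpha> \<inter> S = {s, t}" "s < t"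
  shows "gauss_word \<alpha> S = [gauss_passage \<alpha> s, gauss_passage \<alpha> t]"
  using assms by (simp add: gauss_word_def)

lemma (in open_string) gauss_word_empty:
  "classical_passages \<alpha> \<inter> S = {} \<Longrightarrow> gauss_word \<alpha> S = []"
  by (simp add: gauss_word_def)

locale strands = open_string \<alpha> + strand_times n \<tau> for \<alpha> :: diagram and n \<tau> +
  fixes \<psi> :: "real \<times> real \<Rightarrow> real \<times> real" and \<gamma> :: "nat \<Rightarrow> real \<Rightarrow> real \<times> real"
  assumes \<psi>: "orientation_preserving_diffeo \<psi>"
    and meets: "meets_disc_in \<psi> n \<tau> (fst \<alpha>) \<gamma>"
begin

lemma inj_\<psi>: "\<psi> p = \<psi> q \<longleftrightarrow> p = q"
  using \<psi> by (auto simp: orientation_preserving_diffeo_def bij_def inj_eq)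

lemma on_strand: "i < n \<Longrightarrow> x \<in> {-1..1} \<Longrightarrow> fst \<alpha> (\<tau> i x) = \<psi> (\<gamma> i x)"
  and strand: "i < n \<Longrightarrow> strand (\<gamma> i)"
  using meets by (auto simp: meets_disc_in_def)

lemma disc_times: "fst \<alpha> t \<in> \<psi> ` square \<longleftrightarrow> (\<exists>i<n. \<exists>x\<in>{-1..1}. t = \<tau> i x)"
  using meets unfolding meets_disc_in_def by (auto simp: set_eq_iff)

text \<open>The strands account for all visits of the string to the disc, so the partner of a double
  point there lies on a strand as well.\<close>

lemma passage_in_disc_iff:
  assumes i: "i < n" and x: "x \<in> {-1..1}"
  shows "\<tau> i x \<in> classical_passages \<alpha> \<longleftrightarrow> \<psi> (\<gamma> i x) \<notin> snd \<alpha> \<and>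
    (\<exists>j<n. \<exists>y\<in>{-1..1}. (j, y) \<noteq> (i, x) \<and> \<gamma> j y = \<gamma> i x)"
proof -
  have "(\<exists>t. t \<noteq> \<tau> i x \<and> fst \<alpha> t = fst \<alpha> (\<tau> i x)) \<longleftrightarrow>
    (\<exists>j<n. \<exists>y\<in>{-1..1}. (j, y) \<noteq> (i, x) \<and> \<gamma> j y = \<gamma> i x)"
  proof
    assume "\<exists>t. t \<noteq> \<tau> i x \<and> fst \<alpha> t = fst \<alpha> (\<tau> i x)"
    then obtain t where t: "t \<noteq> \<tau> i x" "fst \<alpha> t = fst \<alpha> (\<tau> i x)" by blast
    moreover have "fst \<alpha> (\<tau> i x) \<in> \<psi> ` square" unfolding disc_times using i x by blast
    ultimately have "fst \<alpha> t \<in> \<psi> ` square" by simp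
    then obtain j y where j: "j < n" "y \<in> {-1..1}" "t = \<tau> j y" using disc_times by blast
    then have "\<gamma> j y = \<gamma> i x" using t(2) i x by (simp add: on_strand inj_\<psi>)
    moreover have "(j, y) \<noteq> (i, x)" using t(1) j(3) by auto
    ultimately show "\<exists>j<n. \<exists>y\<in>{-1..1}. (j, y) \<noteq> (i, x) \<and> \<gamma> j y = \<gamma> i x" using j by blast
  next
    assume "\<exists>j<n. \<exists>y\<in>{-1..1}. (j, y) \<noteq> (i, x) \<and> \<gamma> j y = \<gamma> i x"
    then obtain j y where j: "j < n" "y \<in> {-1..1}" "(j, y) \<noteq> (i, x)" "\<gamma> j y = \<gamma> i x" by blast
    then have "\<tau> j y \<noteq> \<tau> i x" "fst \<alpha> (\<tau> j y) = fst \<alpha> (\<tau> i x)"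
      using i x by (auto simp: on_strand \<tau>_eq_iff)
    then show "\<exists>t. t \<noteq> \<tau> i x \<and> fst \<alpha> t = fst \<alpha> (\<tau> i x)" by blast
  qed
  then show ?thesis using i x by (simp add: classical_passages_def double_point_iff on_strand conj_commute)
qed

text \<open>The two abscissas may come in either order, so it is the comparison of
  \<open>p < q\<close> with the direction of traversal that decides which passage is
  earlier.\<close>

lemma gauss_word_strand:
  assumes i: "i < n" and pq: "p \<in> {-1..1}" "q \<in> {-1..1}" "p \<noteq> q"
    and passages: "\<And>x. x \<in> {-1..1} \<Longrightarrow> \<tau> i x \<in> classical_passages \<alpha> \<longleftrightarrow> x = p \<and> \<not> mp \<or> x = q \<and> \<not> mq"
  shows "gauss_word \<alpha> {lo i..hi i} = directed (rising i \<longleftrightarrow> p < q)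
    (unmarked mp (gauss_passage \<alpha> (\<tau> i p)) @ unmarked mq (gauss_passage \<alpha> (\<tau> i q)))"
proof -
  have J: "classical_passages \<alpha> \<inter> {lo i..hi i} = \<tau> i ` {x \<in> {-1..1}. \<tau> i x \<in> classical_passages \<alpha>}"
    unfolding \<tau>_image(1)[OF i, symmetric] by auto
  consider "mp" "mq" | "mp" "\<not> mq" | "\<not> mp" "mq" | "\<not> mp" "\<not> mq" by blast
  then show ?thesis
  proof cases
    case 1
    then have "classical_passages \<alpha> \<inter> {lo i..hi i} = {}" using passages unfolding J by auto
    then show ?thesis using 1 by (simp add: gauss_word_empty unmarked_def directed_def)
  next
    case 2
    then have "{x \<in> {-1..1}. \<tau> i x \<in> classical_passages \<alpha>} = {q}" using passages pq by auto
    then show ?thesis using 2 J by (simp add: gauss_word_def unmarked_def directed_def)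
  next
    case 3
    then have "{x \<in> {-1..1}. \<tau> i x \<in> classical_passages \<alpha>} = {p}" using passages pq by auto
    then show ?thesis using 3 J by (simp add: gauss_word_def unmarked_def directed_def)
  next
    case 4
    then have X: "{x \<in> {-1..1}. \<tau> i x \<in> classical_passages \<alpha>} = {p, q}" using passages pq by auto
    have "\<tau> i p < \<tau> i q \<longleftrightarrow> (rising i \<longleftrightarrow> p < q)" "\<tau> i q < \<tau> i p \<longleftrightarrow> \<not> (rising i \<longleftrightarrow> p < q)"
      using \<tau>_less[OF i, of p q] \<tau>_less[OF i, of q p] pq by (cases "p < q"; cases "rising i"; auto)+
    then show ?thesis
      using gauss_word_pair[of "{lo i..hi i}" "\<tau> i p" "\<tau> i q"] gauss_word_pair[of "{lo i..hi i}" "\<tau> i q" "\<tau> i p"] J 4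
      unfolding X by (cases "rising i \<longleftrightarrow> p < q") (auto simp: unmarked_def directed_def insert_commute)
  qed
qed

end

locale graph_strands = strands \<alpha> n \<tau> \<psi> "\<lambda>i. graph_strand (f i)"
  for \<alpha> :: diagram and n \<tau> \<psi> and f :: "nat \<Rightarrow> real \<Rightarrow> real"
begin

lemma passage_on_graph_iff:
  assumes "i < n" "x \<in> {-1..1}"
  shows "\<tau> i x \<in> classical_passages \<alpha> \<longleftrightarrow> \<psi> (x, f i x) \<notin> snd \<alpha> \<and> (\<exists>j<n. j \<noteq> i \<and> f j x = f i x)"
  unfolding passage_in_disc_iff[OF assms] graph_strand_def using assms by auto

lemma continuous_f: "i < n \<Longrightarrow> continuous_on {-1..1} (f i)"
proof -
  assume "i < n"
  then have "graph_strand (f i) differentiable_on {-1..1}" using strand by (simp add: strand_def)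
  then have "continuous_on {-1..1} (\<lambda>x. snd (graph_strand (f i) x))"
    by (intro continuous_on_snd differentiable_imp_continuous_on)
  then show ?thesis by (simp add: graph_strand_def)
qed

lemma f_derivative:
  assumes i: "i < n" and x: "-1 < x" "x < 1"
  obtains m where "(f i has_real_derivative m) (at x)" "(graph_strand (f i) has_vector_derivative (1, m)) (at x)"
proof -
  have "graph_strand (f i) differentiable (at x within {-1..1})"
    using strand[OF i] x by (simp add: strand_def differentiable_on_def)
  then have "graph_strand (f i) differentiable (at x)" using x by (simp add: at_within_Icc_at)
  then have "(\<lambda>x. snd (graph_strand (f i) x)) differentiable (at x)"
    unfolding differentiable_def by (blast intro: has_derivative_snd)
  then have "f i differentiable (at x)" by (simp add: graph_strand_def)
  then obtain m where m: "(f i has_real_derivative m) (at x)" using real_differentiable_def by blast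
  moreover have "(graph_strand (f i) has_vector_derivative (1, m)) (at x)"
    unfolding graph_strand_def
    by (intro has_vector_derivative_Pair has_vector_derivative_id m[unfolded has_real_derivative_iff_has_vector_derivative])
  ultimately show ?thesis using that by blast
qed

text \<open>Up to the derivatives of \<open>\<tau> i\<close> and \<open>\<tau> j\<close>, whose
  signs are the directions, the velocities are the images of (1, slope) under the derivative of
  \<psi>. Hence their determinant has the sign of the slope difference \<open>m\<close>, corrected
  by the directions, and transversality makes \<open>m\<close> nonzero.\<close>

lemma crossing_sign:
  assumes ij: "i < n" "j < n" "i \<noteq> j" and x: "-1 < x" "x < 1" and eq: "f i x = f j x"
  obtains m where "m \<noteq> 0" "((\<lambda>x. f j x - f i x) has_real_derivative m) (at x)"
    "0 < det2 (velocity (fst \<alpha>) (\<tau> i x)) (velocity (fst \<alpha>) (\<tau> j x)) \<longleftrightarrow> ((0 < m) = (rising i = rising j))"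
    "0 < det2 (velocity (fst \<alpha>) (\<tau> j x)) (velocity (fst \<alpha>) (\<tau> i x)) \<longleftrightarrow> ((0 < m) \<noteq> (rising i = rising j))"
proof -
  obtain D where D: "\<And>p. (\<psi> has_derivative D p) (at p)"
    and pos: "\<And>p. det2 (D p (1, 0)) (D p (0, 1)) > 0"
    using \<psi> unfolding orientation_preserving_diffeo_def by blast
  let ?D = "D (x, f i x)"
  have vel: "\<exists>d m. d \<noteq> 0 \<and> (d > 0 \<longleftrightarrow> rising k) \<and> (f k has_real_derivative m) (at x) \<and>
      d *\<^sub>R velocity (fst \<alpha>) (\<tau> k x) = ?D (1, m)" if k: "k < n" "f k x = f i x" for k
  proof -
    obtain d where d: "d \<noteq> 0" "(\<tau> k has_real_derivative d) (at x)" "d > 0 \<longleftrightarrow> rising k"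
      using \<tau>_derivative[OF k(1) x] by blast
    obtain m where m: "(f k has_real_derivative m) (at x)" "(graph_strand (f k) has_vector_derivative (1, m)) (at x)"
      using f_derivative[OF k(1) x] by blast
    \<comment> \<open>The strand is differentiated in two ways: as the string at the times
      \<open>\<tau> k\<close>, and as \<psi> applied to a graph.\<close>
    have "((fst \<alpha> \<circ> \<tau> k) has_vector_derivative d *\<^sub>R velocity (fst \<alpha>) (\<tau> k x)) (at x)"
      using d(2) has_velocity by (intro vector_diff_chain_at) (simp_all add: has_real_derivative_iff_has_vector_derivative)
    moreover have "((\<psi> \<circ> graph_strand (f k)) has_vector_derivative ?D (1, m)) (at x)"
      using m(2) by (rule vector_derivative_diff_chain_within[OF _ has_derivative_at_withinI])
        (use D[of "(x, f i x)"] k in \<open>simp add: graph_strand_def\<close>)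
    then have "((fst \<alpha> \<circ> \<tau> k) has_vector_derivative ?D (1, m)) (at x)"
      by (rule has_vector_derivative_transform_within_open[where S = "{-1<..<1}"])
        (use x k on_strand in auto)
    ultimately have "d *\<^sub>R velocity (fst \<alpha>) (\<tau> k x) = ?D (1, m)" by (rule vector_derivative_unique_at)
    then show ?thesis using d(1,3) m(1) by blast
  qed
  obtain d m where d: "d \<noteq> 0" "d > 0 \<longleftrightarrow> rising i" "(f i has_real_derivative m) (at x)"
    "d *\<^sub>R velocity (fst \<alpha>) (\<tau> i x) = ?D (1, m)" using vel[OF ij(1)] by auto
  obtain e l where e: "e \<noteq> 0" "e > 0 \<longleftrightarrow> rising j" "(f j has_real_derivative l) (at x)"
    "e *\<^sub>R velocity (fst \<alpha>) (\<tau> j x) = ?D (1, l)" using vel[OF ij(2)] eq by auto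
  define V where "V = det2 (velocity (fst \<alpha>) (\<tau> i x)) (velocity (fst \<alpha>) (\<tau> j x))"
  have V': "det2 (velocity (fst \<alpha>) (\<tau> j x)) (velocity (fst \<alpha>) (\<tau> i x)) = - V"
    by (simp add: V_def det2_def)
  have "linear ?D" using D has_derivative_linear by blast
  have "d * e * V = det2 (?D (1, m)) (?D (1, l))"
    unfolding d(4)[symmetric] e(4)[symmetric] det2_scale V_def by simp
  also have "\<dots> = det2 (?D (1, 0)) (?D (0, 1)) * (l - m)"
    by (subst det2_linear[OF \<open>linear ?D\<close>]) (simp add: det2_def)
  finally have rel: "d * e * V = det2 (?D (1, 0)) (?D (0, 1)) * (l - m)" .
  have "fst \<alpha> (\<tau> i x) = fst \<alpha> (\<tau> j x)" "\<tau> i x \<noteq> \<tau> j x"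
    using ij x eq by (auto simp: on_strand graph_strand_def \<tau>_eq_iff)
  then have "V \<noteq> 0" unfolding V_def using transversal by blast
  then have "l - m \<noteq> 0" using rel d(1) e(1) by auto
  moreover have "0 < d * e * V \<longleftrightarrow> 0 < l - m" unfolding rel using pos[of "(x, f i x)"] by (auto simp: zero_less_mult_iff)
  then have "0 < V \<longleftrightarrow> ((0 < l - m) = (rising i = rising j))"
    using d(1,2) e(1,2) \<open>V \<noteq> 0\<close> by (auto simp: zero_less_mult_iff mult_less_0_iff not_less le_less split: if_splits)
  moreover from this have "0 < - V \<longleftrightarrow> ((0 < l - m) \<noteq> (rising i = rising j))" using \<open>V \<noteq> 0\<close> by auto
  moreover have "((\<lambda>x. f j x - f i x) has_real_derivative l - m) (at x)"
    using d(3) e(3) by (rule DERIV_diff[rotated])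
  ultimately show ?thesis using that[of "l - m"] unfolding V_def[symmetric] V' by blast
qed

text \<open>The height difference is positive to the left of \<open>x\<close> and vanishes at
  \<open>x\<close>, so its slope is not positive there, and the criterion of
  \<open>crossing_sign\<close> reduces to the directions.\<close>

lemma positive_crossing_left:
  assumes ij: "i < n" "j < n" "i \<noteq> j" and x: "-1 < x" "x < 1" and eq: "f i x = f j x"
    and less: "\<And>y. y \<in> {-1..<x} \<Longrightarrow> f i y < f j y"
  shows "positive_crossing \<alpha> (\<tau> i x, \<tau> j x) \<longleftrightarrow> rising i \<noteq> rising j"
    and "positive_crossing \<alpha> (\<tau> j x, \<tau> i x) \<longleftrightarrow> rising i = rising j"
proof -
  obtain m where m: "m \<noteq> 0" "((\<lambda>x. f j x - f i x) has_real_derivative m) (at x)"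
    "0 < det2 (velocity (fst \<alpha>) (\<tau> i x)) (velocity (fst \<alpha>) (\<tau> j x)) \<longleftrightarrow> ((0 < m) = (rising i = rising j))"
    "0 < det2 (velocity (fst \<alpha>) (\<tau> j x)) (velocity (fst \<alpha>) (\<tau> i x)) \<longleftrightarrow> ((0 < m) \<noteq> (rising i = rising j))"
    using crossing_sign[OF ij x eq] by blast
  have "\<not> 0 < m"
  proof
    assume "0 < m"
    then obtain e where "e > 0" and e: "\<forall>h>0. h < e \<longrightarrow> f j (x - h) - f i (x - h) < f j x - f i x"
      using DERIV_pos_inc_left[OF m(2)] by auto
    define h where "h = min (e / 2) (x + 1)"
    have "h > 0" "h < e" "x - h \<in> {-1..<x}" using \<open>e > 0\<close> x by (auto simp: h_def min_def)
    then show False using e less[of "x - h"] eq by force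
  qed
  then show "positive_crossing \<alpha> (\<tau> i x, \<tau> j x) \<longleftrightarrow> rising i \<noteq> rising j"
    "positive_crossing \<alpha> (\<tau> j x, \<tau> i x) \<longleftrightarrow> rising i = rising j"
    using m(3,4) by (auto simp: positive_crossing_def)
qed

lemma positive_crossing_right:
  assumes ij: "i < n" "j < n" "i \<noteq> j" and x: "-1 < x" "x < 1" and eq: "f i x = f j x"
    and less: "\<And>y. y \<in> {x<..1} \<Longrightarrow> f i y < f j y"
  shows "positive_crossing \<alpha> (\<tau> i x, \<tau> j x) \<longleftrightarrow> rising i = rising j"
    and "positive_crossing \<alpha> (\<tau> j x, \<tau> i x) \<longleftrightarrow> rising i \<noteq> rising j"
proof -
  obtain m where m: "m \<noteq> 0" "((\<lambda>x. f j x - f i x) has_real_derivative m) (at x)"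
    "0 < det2 (velocity (fst \<alpha>) (\<tau> i x)) (velocity (fst \<alpha>) (\<tau> j x)) \<longleftrightarrow> ((0 < m) = (rising i = rising j))"
    "0 < det2 (velocity (fst \<alpha>) (\<tau> j x)) (velocity (fst \<alpha>) (\<tau> i x)) \<longleftrightarrow> ((0 < m) \<noteq> (rising i = rising j))"
    using crossing_sign[OF ij x eq] by blast
  have "\<not> m < 0"
  proof
    assume "m < 0"
    then obtain e where "e > 0" and e: "\<forall>h>0. h < e \<longrightarrow> f j (x + h) - f i (x + h) < f j x - f i x"
      using DERIV_neg_dec_right[OF m(2)] by auto
    define h where "h = min (e / 2) (1 - x)"
    have "h > 0" "h < e" "x + h \<in> {x<..1}" using \<open>e > 0\<close> x by (auto simp: h_def min_def)
    then show False using e less[of "x + h"] eq by force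
  qed
  then show "positive_crossing \<alpha> (\<tau> i x, \<tau> j x) \<longleftrightarrow> rising i = rising j"
    "positive_crossing \<alpha> (\<tau> j x, \<tau> i x) \<longleftrightarrow> rising i \<noteq> rising j"
    using m(1,3,4) by (auto simp: positive_crossing_def)
qed

lemma less_before_crossing:
  assumes ij: "i < n" "j < n" and "f i (-1) < f j (-1)" and x: "x \<le> 1"
    and ne: "\<And>y. y \<in> {-1..<x} \<Longrightarrow> f i y \<noteq> f j y" and y: "y \<in> {-1..<x}"
  shows "f i y < f j y"
proof (rule ccontr)
  assume "\<not> f i y < f j y"
  moreover have "continuous_on {-1..y} (\<lambda>y. f j y - f i y)"
    using x y by (intro continuous_on_diff continuous_on_subset[OF continuous_f] ij) auto
  ultimately obtain z where "-1 \<le> z" "z \<le> y" "f j z - f i z = 0"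
    using IVT2'[of "\<lambda>y. f j y - f i y" y 0 "-1"] assms(3) y by auto
  then show False using ne[of z] y by auto
qed

lemma less_after_crossing:
  assumes ij: "i < n" "j < n" and "f i 1 < f j 1" and x: "-1 \<le> x"
    and ne: "\<And>y. y \<in> {x<..1} \<Longrightarrow> f i y \<noteq> f j y" and y: "y \<in> {x<..1}"
  shows "f i y < f j y"
proof (rule ccontr)
  assume "\<not> f i y < f j y"
  moreover have "continuous_on {y..1} (\<lambda>y. f j y - f i y)"
    using x y by (intro continuous_on_diff continuous_on_subset[OF continuous_f] ij) auto
  ultimately obtain z where "y \<le> z" "z \<le> 1" "f j z - f i z = 0"
    using IVT'[of "\<lambda>y. f j y - f i y" y 0 1] assms(3) y by auto
  then show False using ne[of z] y by auto
qed

lemma gauss_passages_at_crossing: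
  assumes ij: "i < n" "j < n" "hi i < lo j" and x: "x \<in> {-1..1}" "f i x = f j x" and m: "\<psi> (x, f i x) \<notin> snd \<alpha>"
  shows "gauss_passage \<alpha> (\<tau> i x) = Over (\<psi> (x, f i x)) (positive_crossing \<alpha> (\<tau> i x, \<tau> j x))"
    and "gauss_passage \<alpha> (\<tau> j x) = Under (\<psi> (x, f i x)) (positive_crossing \<alpha> (\<tau> i x, \<tau> j x))"
proof -
  have "\<tau> i x \<in> {lo i..hi i}" "\<tau> j x \<in> {lo j..hi j}"
    using \<tau>_image(1)[OF ij(1)] \<tau>_image(1)[OF ij(2)] x(1) by blast+
  then have "\<tau> i x < \<tau> j x" using ij(3) by auto
  then have "(\<tau> i x, \<tau> j x) \<in> classical_crossings \<alpha>"
    using ij x m by (simp add: classical_crossings_def on_strand graph_strand_def)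
  from gauss_passage_over[OF this] gauss_passage_under[OF this] ij x
  show "gauss_passage \<alpha> (\<tau> i x) = Over (\<psi> (x, f i x)) (positive_crossing \<alpha> (\<tau> i x, \<tau> j x))"
    "gauss_passage \<alpha> (\<tau> j x) = Under (\<psi> (x, f i x)) (positive_crossing \<alpha> (\<tau> i x, \<tau> j x))"
    by (simp_all add: on_strand graph_strand_def)
qed

end

section \<open>Two diagrams that agree outside a disc\<close>

locale tangle = A: strands \<alpha> n \<tau> \<psi> \<gamma> + B: strands \<beta> n \<tau> \<psi> \<delta> for \<alpha> \<beta> n \<tau> \<psi> \<gamma> \<delta> +
  assumes agree: "\<And>t. t \<notin> (\<Union>i<n. \<tau> i ` {-1<..<1}) \<Longrightarrow> fst \<alpha> t = fst \<beta> t"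
    and marks: "snd \<alpha> - \<psi> ` square = snd \<beta> - \<psi> ` square"
begin

text \<open>The closed time intervals of the strands have an open complement, so the diagrams agree
  near \<open>t\<close> and have the same velocity there; this preserves signs.\<close>

lemma agree_outside:
  assumes "fst \<alpha> t \<notin> \<psi> ` square"
  shows "fst \<beta> t = fst \<alpha> t" "velocity (fst \<beta>) t = velocity (fst \<alpha>) t"
proof -
  define U where "U = - (\<Union>i<n. \<tau> i ` {-1..1})"
  have "closed (\<tau> i ` {-1..1})" if "i < n" for i using A.\<tau>_image(1)[OF that] by simp
  then have "open U" unfolding U_def by (intro open_Compl closed_UN) auto
  have t: "t \<in> U" using assms A.disc_times unfolding U_def by auto
  have eq: "fst \<alpha> s = fst \<beta> s" if "s \<in> U" for s using that agree[of s] unfolding U_def by fastforce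
  then show "fst \<beta> t = fst \<alpha> t" using t by simp
  have "(fst \<beta> has_vector_derivative velocity (fst \<alpha>) t) (at t)"
    using A.has_velocity \<open>open U\<close> t eq by (rule has_vector_derivative_transform_within_open)
  then show "velocity (fst \<beta>) t = velocity (fst \<alpha>) t" using B.has_velocity vector_derivative_unique_at by blast
qed

lemma crossing_outside:
  assumes st: "(s, t) \<in> classical_crossings \<alpha>" and out: "fst \<alpha> t \<notin> \<psi> ` square"
  shows "(s, t) \<in> classical_crossings \<beta> \<and> positive_crossing \<beta> (s, t) = positive_crossing \<alpha> (s, t)"
proof -
  have "fst \<alpha> s = fst \<alpha> t" "s < t" "fst \<alpha> s \<notin> snd \<alpha>" using st by (auto simp: classical_crossings_def)
  then show ?thesis using agree_outside[of s] agree_outside[of t] out marks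
    by (auto simp: classical_crossings_def positive_crossing_def)
qed

end

lemma tangle_sym: "tangle \<alpha> \<beta> n \<tau> \<psi> \<gamma> \<delta> \<Longrightarrow> tangle \<beta> \<alpha> n \<tau> \<psi> \<delta> \<gamma>"
  unfolding tangle_def tangle_axioms_def by auto

context tangle
begin

text \<open>A crossing outside the disc has both its passages outside, hence appears in both
  diagrams with the same name and sign. The second claim is what allows the complement of the disc
  to be taken for \<open>N\<close>.\<close>

lemma gauss_word_outside:
  assumes S: "\<And>i. i < n \<Longrightarrow> S \<inter> {A.lo i..A.hi i} = {}"
  shows "gauss_word \<beta> S = gauss_word \<alpha> S" "crossing ` set (gauss_word \<alpha> S) \<subseteq> - \<psi> ` square"
proof -
  interpret sym: tangle \<beta> \<alpha> n \<tau> \<psi> \<delta> \<gamma> by (rule tangle_sym) unfold_locales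
  have out: "fst \<alpha> t \<notin> \<psi> ` square" "fst \<beta> t \<notin> \<psi> ` square" if "t \<in> S" for t
    using that S A.disc_times B.disc_times A.\<tau>_image(1) by blast+
  have "t \<in> classical_passages \<beta>" if "t \<in> classical_passages \<alpha>" "t \<in> S" for t
    using that(1)
  proof (cases rule: A.passage_cases)
    case (1 s)
    then show ?thesis using crossing_outside[OF 1] out that(2) B.crossing_passages(2) by blast
  next
    case (2 s)
    then show ?thesis using crossing_outside[OF 2] out(1)[OF that(2)] A.crossing_passages(4)[OF 2] B.crossing_passages(1) by auto
  qed
  moreover have "t \<in> classical_passages \<alpha>" if "t \<in> classical_passages \<beta>" "t \<in> S" for t
    using that(1)
  proof (cases rule: B.passage_cases)
    case (1 s)
    then show ?thesis using sym.crossing_outside[OF 1] out that(2) A.crossing_passages(2) by blast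
  next
    case (2 s)
    then show ?thesis using sym.crossing_outside[OF 2] out(2)[OF that(2)] B.crossing_passages(4)[OF 2] A.crossing_passages(1) by auto
  qed
  ultimately have passages: "classical_passages \<beta> \<inter> S = id ` (classical_passages \<alpha> \<inter> S)" by auto
  have "gauss_word \<beta> S = map (map_passage id) (gauss_word \<alpha> S)"
  proof (rule gauss_word_transport[OF A.open_string_axioms B.open_string_axioms _ passages])
    show "strict_mono (id :: real \<Rightarrow> real)" by (simp add: strict_mono_def)
    fix s t assume st: "(s, t) \<in> classical_crossings \<alpha>" "s \<in> S \<or> t \<in> S"
    then have "fst \<alpha> t \<notin> \<psi> ` square" using out(1)[of s] out(1)[of t] A.crossing_passages(4)[OF st(1)] by metis
    then show "(id s, id t) \<in> classical_crossings \<beta> \<and> fst \<beta> (id t) = id (fst \<alpha> t) \<and>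
        positive_crossing \<beta> (id s, id t) = positive_crossing \<alpha> (s, t)"
      using crossing_outside[OF st(1)] agree_outside by simp
  qed
  then show "gauss_word \<beta> S = gauss_word \<alpha> S" by (simp add: passage.map_id0 passage.map_id)
  have "crossing (gauss_passage \<alpha> t) = fst \<alpha> t" for t by (simp add: gauss_passage_def Let_def)
  then have "crossing ` set (gauss_word \<alpha> S) = fst \<alpha> ` (classical_passages \<alpha> \<inter> S)"
    by (simp add: gauss_word_def image_image A.finite_passages)
  then show "crossing ` set (gauss_word \<alpha> S) \<subseteq> - \<psi> ` square"
    using out(1) by (simp only: image_subset_iff) simp
qed

end

lemma tangle_replacement_tangle:
  assumes "\<alpha> \<in> open_strings" "\<beta> \<in> open_strings" "tangle_replacement \<psi> n \<alpha> \<gamma> \<beta> \<delta>"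
  obtains \<tau> where "tangle \<alpha> \<beta> n \<tau> \<psi> \<gamma> \<delta>"
proof -
  obtain \<tau> where "inj_on (\<lambda>(i, x). \<tau> i x) ({..<n} \<times> {-1..1})"
    "\<forall>i<n. \<forall>x\<in>{-1..1}. \<exists>d. d \<noteq> 0 \<and> (\<tau> i has_real_derivative d) (at x within {-1..1})"
    "meets_disc_in \<psi> n \<tau> (fst \<alpha>) \<gamma>" "meets_disc_in \<psi> n \<tau> (fst \<beta>) \<delta>"
    "\<forall>t. t \<notin> (\<Union>i<n. \<tau> i ` {-1<..<1}) \<longrightarrow> fst \<alpha> t = fst \<beta> t"
    using assms(3) unfolding tangle_replacement_def by auto
  then have "tangle \<alpha> \<beta> n \<tau> \<psi> \<gamma> \<delta>"
    using assms unfolding tangle_replacement_def by unfold_locales (auto simp del: split_paired_All)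
  then show ?thesis by (rule that)
qed

text \<open>The diagrams may differ only at interior times of a strand. The order of the heights at
  the sides of the square thus carries over from one diagram to the other.\<close>

lemma (in tangle) agree_boundary:
  assumes "i < n" "x = -1 \<or> x = 1" shows "\<delta> i x = \<gamma> i x"
proof -
  have x: "x \<in> {-1..1}" using assms(2) by auto
  have "\<tau> i x \<noteq> \<tau> j y" if "j < n" "y \<in> {-1<..<1}" for j y
    using A.\<tau>_eq_iff[OF assms(1) that(1) x, of y] that(2) assms(2) by auto
  then have "fst \<alpha> (\<tau> i x) = fst \<beta> (\<tau> i x)" by (intro agree) blast
  then show ?thesis using assms(1) x by (simp add: A.on_strand B.on_strand A.inj_\<psi>)
qed

section \<open>The effect of the three moves on the endomorphism\<close>

lemma label_endo_end_label_eqI: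
  assumes "state_eq N (fold step (gauss_word \<alpha> UNIV) initial_state) (fold step (gauss_word \<beta> UNIV) initial_state)"
  shows "label_endo (end_label \<alpha>) = label_endo (end_label \<beta>)"
  using assms unfolding end_label_def state_eq_def by (intro label_endo_cong) blast

lemma label_endo_reidemeister1:
  assumes \<alpha>: "\<alpha> \<in> open_strings" and \<beta>: "\<beta> \<in> open_strings" and "reidemeister1 \<alpha> \<beta>"
  shows "label_endo (end_label \<alpha>) = label_endo (end_label \<beta>)"
proof -
  obtain \<psi> \<gamma> \<delta> p q where t: "tangle_replacement \<psi> 1 \<alpha> \<gamma> \<beta> \<delta>" and \<gamma>: "inj_on (\<gamma> 0) {-1..1}"
    and pq: "-1 < p" "p < q" "q < 1"
    and \<delta>: "\<forall>x\<in>{-1..1}. \<forall>y\<in>{-1..1}. x < y \<longrightarrow> (\<delta> 0 x = \<delta> 0 y \<longleftrightarrow> x = p \<and> y = q)"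
    using assms(3) unfolding reidemeister1_def by blast
  obtain \<tau> where "tangle \<alpha> \<beta> 1 \<tau> \<psi> \<gamma> \<delta>" using tangle_replacement_tangle[OF \<alpha> \<beta> t] .
  then interpret tangle \<alpha> \<beta> 1 \<tau> \<psi> \<gamma> \<delta> .
  note image = A.\<tau>_image[of 0]
  have word: "gauss_word \<kappa> UNIV = gauss_word \<kappa> {..<A.lo 0} @ gauss_word \<kappa> {A.lo 0..A.hi 0} @ gauss_word \<kappa> {A.hi 0<..}"
    if "open_string \<kappa>" for \<kappa>
    using open_string.gauss_word_split_UNIV[OF that] image by simp
  have outside: "gauss_word \<beta> {..<A.lo 0} = gauss_word \<alpha> {..<A.lo 0}" "gauss_word \<beta> {A.hi 0<..} = gauss_word \<alpha> {A.hi 0<..}"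
    "crossing ` set (gauss_word \<alpha> {A.hi 0<..}) \<subseteq> - \<psi> ` square"
    by (rule gauss_word_outside; force)+
  have "\<tau> 0 x \<notin> classical_passages \<alpha>" if "x \<in> {-1..1}" for x
    using A.passage_in_disc_iff[of 0 x] that \<gamma> by (auto simp: inj_on_def)
  then have in\<alpha>: "gauss_word \<alpha> {A.lo 0..A.hi 0} = []"
    unfolding image(1)[OF zero_less_one, symmetric] by (intro A.gauss_word_empty) auto
  define m where "m \<longleftrightarrow> \<psi> (\<delta> 0 p) \<in> snd \<beta>"
  have \<delta>pq: "\<delta> 0 p = \<delta> 0 q" using \<delta> pq by auto
  have "\<tau> 0 x \<in> classical_passages \<beta> \<longleftrightarrow> x = p \<and> \<not> m \<or> x = q \<and> \<not> m" if x: "x \<in> {-1..1}" for x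
  proof -
    have "\<delta> 0 y = \<delta> 0 x \<longleftrightarrow> x = p \<and> y = q \<or> x = q \<and> y = p" if "y \<in> {-1..1}" "y \<noteq> x" for y
    proof (cases "x < y")
      case True
      then show ?thesis using \<delta>[rule_format, OF x that(1) True] pq by auto
    next
      case False
      then have "y < x" using that(2) by simp
      then show ?thesis using \<delta>[rule_format, OF that(1) x] pq by auto
    qed
    then have "(\<exists>y\<in>{-1..1}. y \<noteq> x \<and> \<delta> 0 y = \<delta> 0 x) \<longleftrightarrow> x = p \<or> x = q"
      using pq by fastforce
    moreover have "(\<exists>j<1. \<exists>y\<in>{-1..1}. (j, y) \<noteq> (0, x) \<and> \<delta> j y = \<delta> 0 x) \<longleftrightarrow>
        (\<exists>y\<in>{-1..1}. y \<noteq> x \<and> \<delta> 0 y = \<delta> 0 x)" by auto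
    ultimately show ?thesis
      unfolding B.passage_in_disc_iff[OF zero_less_one x] using \<delta>pq m_def by auto
  qed
  then have in\<beta>: "gauss_word \<beta> {A.lo 0..A.hi 0} = directed (A.rising 0)
      (unmarked m (gauss_passage \<beta> (\<tau> 0 p)) @ unmarked m (gauss_passage \<beta> (\<tau> 0 q)))"
    using B.gauss_word_strand[of 0 p q m m] pq by simp
  have "state_eq (- \<psi> ` square) (fold step (gauss_word \<beta> {A.lo 0..A.hi 0}) s) s" for s
  proof (cases m)
    case True
    then show ?thesis by (simp add: in\<beta> unmarked_def directed_def state_eq_refl)
  next
    case False
    have \<beta>pq: "fst \<beta> (\<tau> 0 p) = \<psi> (\<delta> 0 p)" "fst \<beta> (\<tau> 0 q) = \<psi> (\<delta> 0 p)"
      using pq \<delta>pq by (simp_all add: B.on_strand)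
    have "\<tau> 0 p \<in> \<tau> 0 ` {-1..1}" using pq by auto
    then have c: "\<psi> (\<delta> 0 p) \<notin> - \<psi> ` square" using B.disc_times[of "\<tau> 0 p"] \<beta>pq by auto
    \<comment> \<open>Whichever way the curl is traversed, its first passage is over and its second
      one under, so one form of the Gauss word suffices.\<close>
    obtain t u where "gauss_word \<beta> {A.lo 0..A.hi 0} = [gauss_passage \<beta> t, gauss_passage \<beta> u]"
      "(t, u) \<in> classical_crossings \<beta>" "fst \<beta> u = \<psi> (\<delta> 0 p)"
    proof (cases "A.rising 0")
      case True
      then have "\<tau> 0 p < \<tau> 0 q" using A.\<tau>_less[of 0 p q] pq by simp
      then show ?thesis using that[of "\<tau> 0 p" "\<tau> 0 q"] True False \<beta>pq m_def
        by (simp add: in\<beta> unmarked_def directed_def classical_crossings_def)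
    next
      case rising: False
      then have "\<tau> 0 q < \<tau> 0 p" using A.\<tau>_less[of 0 p q] pq by simp
      then show ?thesis using that[of "\<tau> 0 q" "\<tau> 0 p"] rising False \<beta>pq m_def
        by (simp add: in\<beta> unmarked_def directed_def classical_crossings_def)
    qed
    then show ?thesis
      using fold_step_reidemeister1[OF c] by (simp add: B.gauss_passage_over B.gauss_passage_under)
  qed
  from fold_step_state_eq[OF this outside(3)]
  have "state_eq (- \<psi> ` square) (fold step (gauss_word \<beta> UNIV) initial_state) (fold step (gauss_word \<alpha> UNIV) initial_state)"
    unfolding word[OF A.open_string_axioms] word[OF B.open_string_axioms] outside in\<alpha> by simp
  then show ?thesis by (rule label_endo_end_label_eqI[symmetric])
qed

lemma label_endo_reidemeister2:
  assumes \<alpha>: "\<alpha> \<in> open_strings" and \<beta>: "\<beta> \<in> open_strings" and "reidemeister2 \<alpha> \<beta>"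
  shows "label_endo (end_label \<alpha>) = label_endo (end_label \<beta>)"
proof -
  obtain \<psi> f g p q where t: "tangle_replacement \<psi> 2 \<alpha> (\<lambda>i. graph_strand (f i)) \<beta> (\<lambda>i. graph_strand (g i))"
    and f: "\<forall>x\<in>{-1..1}. f 0 x < f 1 x" and pq: "-1 < p" "p < q" "q < 1"
    and g: "\<forall>x\<in>{-1..1}. g 0 x = g 1 x \<longleftrightarrow> x = p \<or> x = q"
    and marks_g: "\<psi> (p, g 0 p) \<in> snd \<beta> \<longleftrightarrow> \<psi> (q, g 0 q) \<in> snd \<beta>"
    using assms(3) unfolding reidemeister2_def by blast
  obtain \<tau> where "tangle \<alpha> \<beta> 2 \<tau> \<psi> (\<lambda>i. graph_strand (f i)) (\<lambda>i. graph_strand (g i))"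
    using tangle_replacement_tangle[OF \<alpha> \<beta> t] .
  then interpret tangle \<alpha> \<beta> 2 \<tau> \<psi> "\<lambda>i. graph_strand (f i)" "\<lambda>i. graph_strand (g i)" .
  interpret GA: graph_strands \<alpha> 2 \<tau> \<psi> f by unfold_locales
  interpret GB: graph_strands \<beta> 2 \<tau> \<psi> g by unfold_locales
  \<comment> \<open>\<open>a\<close> is the strand visited first, and therefore the one that passes
    over.\<close>
  obtain a b :: nat where ab: "a = 0 \<and> b = 1 \<or> a = 1 \<and> b = 0" and less: "A.hi a < A.lo b"
    using A.hi_less_lo[of 0 1] by auto
  then have ab': "a < 2" "b < 2" "a \<noteq> b" by auto
  note lohi = A.\<tau>_image(2)[OF ab'(1)] A.\<tau>_image(2)[OF ab'(2)]
  have word: "gauss_word \<kappa> UNIV = gauss_word \<kappa> {..<A.lo a} @ gauss_word \<kappa> {A.lo a..A.hi a} @ gauss_word \<kappa> {A.hi a<..<A.lo b} @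
      gauss_word \<kappa> {A.lo b..A.hi b} @ gauss_word \<kappa> {A.hi b<..}"
    if "open_string \<kappa>" for \<kappa>
    using open_string.gauss_word_split_UNIV[OF that lohi(1)] open_string.gauss_word_split_above[OF that less lohi(2)] by simp
  have disjoint: "{..<A.lo a} \<inter> {A.lo i..A.hi i} = {}" "{A.hi a<..<A.lo b} \<inter> {A.lo i..A.hi i} = {}" 
    "{A.hi b<..} \<inter> {A.lo i..A.hi i} = {}" if "i < 2" for i
  proof -
    have "i = a \<or> i = b" using that ab by auto
    then show "{..<A.lo a} \<inter> {A.lo i..A.hi i} = {}" "{A.hi a<..<A.lo b} \<inter> {A.lo i..A.hi i} = {}" 
      "{A.hi b<..} \<inter> {A.lo i..A.hi i} = {}" using less lohi by auto
  qed
  have outside: "gauss_word \<beta> {..<A.lo a} = gauss_word \<alpha> {..<A.lo a}" "crossing ` set (gauss_word \<alpha> {..<A.lo a}) \<subseteq> - \<psi> ` square"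
    "gauss_word \<beta> {A.hi a<..<A.lo b} = gauss_word \<alpha> {A.hi a<..<A.lo b}" "crossing ` set (gauss_word \<alpha> {A.hi a<..<A.lo b}) \<subseteq> - \<psi> ` square"
    "gauss_word \<beta> {A.hi b<..} = gauss_word \<alpha> {A.hi b<..}" "crossing ` set (gauss_word \<alpha> {A.hi b<..}) \<subseteq> - \<psi> ` square"
    by (rule gauss_word_outside, erule disjoint)+
  have in\<alpha>: "gauss_word \<alpha> {A.lo i..A.hi i} = []" if "i < 2" for i
  proof (rule A.gauss_word_empty)
    have "\<tau> i x \<notin> classical_passages \<alpha>" if "x \<in> {-1..1}" for x
    proof -
      have "f 0 x < f 1 x" using f that by blast
      then have "\<not> (\<exists>j<2. j \<noteq> i \<and> f j x = f i x)" using \<open>i < 2\<close> by (auto simp: less_2_cases_iff intro!: gr0I)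
      then show ?thesis using GA.passage_on_graph_iff[OF \<open>i < 2\<close> that] by blast
    qed
    then show "classical_passages \<alpha> \<inter> {A.lo i..A.hi i} = {}"
      unfolding A.\<tau>_image(1)[OF that, symmetric] by auto
  qed
  define m where "m \<longleftrightarrow> \<psi> (p, g 0 p) \<in> snd \<beta>"
  define e where "e \<longleftrightarrow> positive_crossing \<beta> (\<tau> a p, \<tau> b p)"
  have gab: "g a p = g 0 p" "g a q = g 0 q" "g b p = g 0 p" "g b q = g 0 q" using ab g pq by auto
  have in\<beta>: "gauss_word \<beta> {A.lo i..A.hi i} = directed (A.rising i) (unmarked m (gauss_passage \<beta> (\<tau> i p)) @ unmarked m (gauss_passage \<beta> (\<tau> i q)))"
    if "i = a \<or> i = b" for i
  proof -
    have i: "i < 2" using that ab' by auto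
    have "\<tau> i x \<in> classical_passages \<beta> \<longleftrightarrow> x = p \<and> \<not> m \<or> x = q \<and> \<not> m" if "x \<in> {-1..1}" for x
    proof -
      have "(\<exists>j<2. j \<noteq> i \<and> g j x = g i x) \<longleftrightarrow> g 0 x = g 1 x" using i by (auto simp: less_2_cases_iff)
      also have "\<dots> \<longleftrightarrow> x = p \<or> x = q" using g that by blast
      finally show ?thesis unfolding GB.passage_on_graph_iff[OF i that] using gab marks_g \<open>i = a \<or> i = b\<close> m_def by auto
    qed
    then show ?thesis using B.gauss_word_strand[OF i, of p q m m] pq by simp
  qed
  have g1: "g 0 (-1) < g 1 (-1)" "g 0 1 < g 1 1"
    using f agree_boundary[of 0] agree_boundary[of 1] by (auto simp: graph_strand_def)
  have left: "g 0 y < g 1 y" if "y \<in> {-1..<p}" for y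
    by (rule GB.less_before_crossing[OF _ _ g1(1) _ _ that]) (use g pq in auto)
  have right: "g 0 y < g 1 y" if "y \<in> {q<..1}" for y
    by (rule GB.less_after_crossing[OF _ _ g1(2) _ _ that]) (use g pq in auto)
  \<comment> \<open>Strand 0 is the lower one both to the left of \<open>p\<close> and to the right
    of \<open>q\<close>, so the height difference has slopes of opposite sign at the two
    crossings.\<close>
  have e': "positive_crossing \<beta> (\<tau> a q, \<tau> b q) \<longleftrightarrow> \<not> e"
    using GB.positive_crossing_left[of 0 1 p] GB.positive_crossing_right[of 0 1 q] left right ab pq g
    unfolding e_def by auto
  have "state_eq (- \<psi> ` square)
    (fold step (gauss_word \<beta> {A.lo a..A.hi a} @ gauss_word \<alpha> {A.hi a<..<A.lo b} @ gauss_word \<beta> {A.lo b..A.hi b}) s)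
    (fold step (gauss_word \<alpha> {A.hi a<..<A.lo b}) s)" for s
  proof (cases m)
    case True
    then show ?thesis using in\<beta> by (simp add: unmarked_def directed_def state_eq_refl)
  next
    case False
    have p: "gauss_passage \<beta> (\<tau> a p) = Over (\<psi> (p, g 0 p)) e" "gauss_passage \<beta> (\<tau> b p) = Under (\<psi> (p, g 0 p)) e"
      using GB.gauss_passages_at_crossing[OF ab'(1,2) less, of p] pq False gab unfolding m_def e_def by auto
    have q: "gauss_passage \<beta> (\<tau> a q) = Over (\<psi> (q, g 0 q)) (\<not> e)" "gauss_passage \<beta> (\<tau> b q) = Under (\<psi> (q, g 0 q)) (\<not> e)"
      using GB.gauss_passages_at_crossing[OF ab'(1,2) less, of q] pq False gab marks_g e' unfolding m_def by auto
    have "graph_strand (g a) x \<in> square" if "x \<in> {-1<..<1}" for x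
      using B.strand[OF ab'(1)] that by (fastforce simp: strand_def square_def)
    then have "\<psi> (p, g 0 p) \<in> \<psi> ` square" "\<psi> (q, g 0 q) \<in> \<psi> ` square"
      using pq gab unfolding graph_strand_def by (metis greaterThanLessThan_iff image_eqI less_trans)+
    moreover have "\<psi> (p, g 0 p) \<noteq> \<psi> (q, g 0 q)" using pq by (simp add: A.inj_\<psi>)
    ultimately show ?thesis
      using fold_step_reidemeister2[of "\<psi> (p, g 0 p)" "\<psi> (q, g 0 q)" "- \<psi> ` square" "gauss_word \<alpha> {A.hi a<..<A.lo b}"
        "A.rising a" e "A.rising b" s] outside(4) in\<beta> False p q by (simp add: unmarked_def)
  qed
  from fold_step_state_eq[OF this outside(6)]
  have "state_eq (- \<psi> ` square) (fold step (gauss_word \<beta> UNIV) initial_state) (fold step (gauss_word \<alpha> UNIV) initial_state)"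
    unfolding word[OF A.open_string_axioms] word[OF B.open_string_axioms] outside in\<alpha>[OF ab'(1)] in\<alpha>[OF ab'(2)]
    by simp
  then show ?thesis by (rule label_endo_end_label_eqI[symmetric])
qed

text \<open>Strands \<open>i\<close> and \<open>j\<close> cross above the abscissa \<open>\<xi> i j\<close>, and \<open>M i j\<close> says that this crossing is encircled.
  The flag \<open>\<sigma>\<close> distinguishes the two sides of the third move.\<close>

locale three_strands = graph_strands \<alpha> 3 \<tau> \<psi> f for \<alpha> :: diagram and \<tau> \<psi> f +
  fixes \<xi> :: "nat \<Rightarrow> nat \<Rightarrow> real" and M :: "nat \<Rightarrow> nat \<Rightarrow> bool" and \<sigma> :: bool
  assumes sym: "\<xi> i j = \<xi> j i" "M i j = M j i"
    and \<xi>: "i < 3 \<Longrightarrow> j < 3 \<Longrightarrow> i \<noteq> j \<Longrightarrow> -1 < \<xi> i j \<and> \<xi> i j < 1"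
    and cross: "i < 3 \<Longrightarrow> j < 3 \<Longrightarrow> i \<noteq> j \<Longrightarrow> x \<in> {-1..1} \<Longrightarrow> f i x = f j x \<longleftrightarrow> x = \<xi> i j"
    and marked: "i < 3 \<Longrightarrow> j < 3 \<Longrightarrow> i \<noteq> j \<Longrightarrow> \<psi> (\<xi> i j, f i (\<xi> i j)) \<in> snd \<alpha> \<longleftrightarrow> M i j"
    and order: "i < 3 \<Longrightarrow> j < 3 \<Longrightarrow> k < 3 \<Longrightarrow> distinct [i, j, k] \<Longrightarrow> \<xi> i j \<noteq> \<xi> i k \<and> (\<xi> i j < \<xi> i k \<longleftrightarrow> (j < k) = \<sigma>)"
    and left: "i < j \<Longrightarrow> j < 3 \<Longrightarrow> f i (-1) < f j (-1)"
begin

definition point :: "nat \<Rightarrow> nat \<Rightarrow> real \<times> real" where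
  "point i j = \<psi> (\<xi> i j, f i (\<xi> i j))"

lemma f_\<xi>: "i < 3 \<Longrightarrow> j < 3 \<Longrightarrow> i \<noteq> j \<Longrightarrow> f i (\<xi> i j) = f j (\<xi> i j)"
  using cross[of i j "\<xi> i j"] \<xi>[of i j] by auto

lemma point_in_disc: "i < 3 \<Longrightarrow> j < 3 \<Longrightarrow> i \<noteq> j \<Longrightarrow> point i j \<in> \<psi> ` square"
  using strand[of i] \<xi>[of i j] by (fastforce simp: strand_def square_def point_def graph_strand_def)

lemma distinct_points:
  "i < 3 \<Longrightarrow> j < 3 \<Longrightarrow> k < 3 \<Longrightarrow> distinct [i, j, k] \<Longrightarrow> distinct [point i j, point i k, point j k]"
  using order[of i j k] order[of j i k] order[of k i j] sym[of i j] sym[of i k] sym[of j k]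
  by (auto simp: point_def inj_\<psi>)

text \<open>The strand with the smaller index starts lower. The flag \<open>\<sigma>\<close> does
  not enter, so each crossing keeps its sign in the third move.\<close>

lemma positive_iff:
  assumes ij: "i < 3" "j < 3" "i \<noteq> j"
  shows "positive_crossing \<alpha> (\<tau> i (\<xi> i j), \<tau> j (\<xi> i j)) \<longleftrightarrow> ((rising i = rising j) = (j < i))"
proof -
  have less: "f k y < f l y" if "k < l" "l < 3" "y \<in> {-1..<\<xi> k l}" for k l y
    by (rule less_before_crossing[OF _ _ left[OF that(1,2)] _ _ that(3)])
      (use that \<xi>[of k l] cross[of k l] in auto)
  show ?thesis
  proof (cases "i < j")
    case True
    then show ?thesis
      using positive_crossing_left(1)[OF ij, of "\<xi> i j"] less[OF True ij(2)] \<xi>[OF ij] f_\<xi>[OF ij] by auto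
  next
    case False
    then have "j < i" using ij by simp
    then show ?thesis
      using positive_crossing_left(2)[of j i "\<xi> i j"] less[OF \<open>j < i\<close> ij(1)] \<xi>[OF ij] f_\<xi>[OF ij] ij
      by (auto simp: sym(1)[of j i])
  qed
qed

text \<open>The other half of the comparison: \<open>\<sigma>\<close> enters only through the order
  of the two crossings, which the move reverses on every strand.\<close>

lemma word_on_strand:
  assumes ijk: "i < 3" "j < 3" "k < 3" "distinct [i, j, k]"
  shows "gauss_word \<alpha> {lo i..hi i} = directed (rising i = ((j < k) = \<sigma>))
    (unmarked (M i j) (gauss_passage \<alpha> (\<tau> i (\<xi> i j))) @ unmarked (M i k) (gauss_passage \<alpha> (\<tau> i (\<xi> i k))))"
proof -
  have set: "l \<noteq> i \<longleftrightarrow> l = j \<or> l = k" if "l < 3" for l using that ijk by auto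
  have "\<tau> i x \<in> classical_passages \<alpha> \<longleftrightarrow> x = \<xi> i j \<and> \<not> M i j \<or> x = \<xi> i k \<and> \<not> M i k" if x: "x \<in> {-1..1}" for x
  proof -
    have "(\<exists>l<3. l \<noteq> i \<and> f l x = f i x) \<longleftrightarrow> f i x = f j x \<or> f i x = f k x" using set ijk by metis
    also have "\<dots> \<longleftrightarrow> x = \<xi> i j \<or> x = \<xi> i k" using cross x ijk by auto
    finally show ?thesis
      unfolding passage_on_graph_iff[OF ijk(1) x] using marked[of i j] marked[of i k] order[OF ijk] ijk by auto
  qed
  then show ?thesis
    using gauss_word_strand[OF ijk(1), of "\<xi> i j" "\<xi> i k" "M i j" "M i k"] \<xi>[of i j] \<xi>[of i k] order[OF ijk] ijk by auto
qed

lemma unmarked_passages: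
  assumes ij: "i < 3" "j < 3" "hi i < lo j"
  shows "unmarked (M i j) (gauss_passage \<alpha> (\<tau> i (\<xi> i j))) = unmarked (M i j) (Over (point i j) ((rising i = rising j) = (j < i)))"
    and "unmarked (M j i) (gauss_passage \<alpha> (\<tau> j (\<xi> j i))) = unmarked (M i j) (Under (point i j) ((rising i = rising j) = (j < i)))"
proof -
  have ne: "i \<noteq> j" using ij \<tau>_image(2)[OF ij(1)] by auto
  show "unmarked (M i j) (gauss_passage \<alpha> (\<tau> i (\<xi> i j))) = unmarked (M i j) (Over (point i j) ((rising i = rising j) = (j < i)))"
    "unmarked (M j i) (gauss_passage \<alpha> (\<tau> j (\<xi> j i))) = unmarked (M i j) (Under (point i j) ((rising i = rising j) = (j < i)))"
    using gauss_passages_at_crossing[OF ij, of "\<xi> i j"] \<xi>[OF ij(1,2) ne] f_\<xi>[OF ij(1,2) ne] marked[OF ij(1,2) ne] positive_iff[OF ij(1,2) ne]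
    by (auto simp: unmarked_def point_def sym[of j i])
qed

text \<open>The indices are sorted by time: \<open>a\<close> passes over twice, \<open>b\<close>
  under \<open>a\<close> and over \<open>c\<close>, and \<open>c\<close> under twice. This is the
  pattern of \<open>fold_step_reidemeister3_marked\<close>.\<close>

lemma gauss_words:
  assumes abc: "a < 3" "b < 3" "c < 3" and less: "hi a < lo b" "hi b < lo c"
  shows "gauss_word \<alpha> {lo a..hi a} = directed (rising a = ((b < c) = \<sigma>))
      (unmarked (M a b) (Over (point a b) ((rising a = rising b) = (b < a))) @ unmarked (M a c) (Over (point a c) ((rising a = rising c) = (c < a))))"
    and "gauss_word \<alpha> {lo b..hi b} = directed (rising b = ((a < c) = \<sigma>))
      (unmarked (M a b) (Under (point a b) ((rising a = rising b) = (b < a))) @ unmarked (M b c) (Over (point b c) ((rising b = rising c) = (c < b))))"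
    and "gauss_word \<alpha> {lo c..hi c} = directed (rising c = ((a < b) = \<sigma>))
      (unmarked (M a c) (Under (point a c) ((rising a = rising c) = (c < a))) @ unmarked (M b c) (Under (point b c) ((rising b = rising c) = (c < b))))"
proof -
  have ac: "hi a < lo c" using less \<tau>_image(2)[OF abc(2)] by simp
  then have d: "distinct [a, b, c]" "distinct [b, a, c]" "distinct [c, a, b]"
    using less \<tau>_image(2)[OF abc(1)] \<tau>_image(2)[OF abc(2)] by auto
  note u = unmarked_passages[OF abc(1,2) less(1)] unmarked_passages[OF abc(2,3) less(2)] unmarked_passages[OF abc(1,3) ac]
  show "gauss_word \<alpha> {lo a..hi a} = directed (rising a = ((b < c) = \<sigma>))
      (unmarked (M a b) (Over (point a b) ((rising a = rising b) = (b < a))) @ unmarked (M a c) (Over (point a c) ((rising a = rising c) = (c < a))))"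
    using word_on_strand[OF abc d(1)] by (simp only: u)
  show "gauss_word \<alpha> {lo b..hi b} = directed (rising b = ((a < c) = \<sigma>))
      (unmarked (M a b) (Under (point a b) ((rising a = rising b) = (b < a))) @ unmarked (M b c) (Over (point b c) ((rising b = rising c) = (c < b))))"
    using word_on_strand[OF abc(2,1,3) d(2)] by (simp only: u)
  show "gauss_word \<alpha> {lo c..hi c} = directed (rising c = ((a < b) = \<sigma>))
      (unmarked (M a c) (Under (point a c) ((rising a = rising c) = (c < a))) @ unmarked (M b c) (Under (point b c) ((rising b = rising c) = (c < b))))"
    using word_on_strand[OF abc(3,1,2) d(3)] by (simp only: u)
qed

end

text \<open>For distinct \<open>i, j < 3\<close> the pair \<open>{i, j}\<close> is determined by \<open>i + j\<close>.\<close>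

definition pair_case :: "'z \<Rightarrow> 'z \<Rightarrow> 'z \<Rightarrow> nat \<Rightarrow> nat \<Rightarrow> 'z" where
  "pair_case x y z i j = (if i + j = 1 then x else if i + j = 2 then y else z)"

lemma less_3_iff: "i < 3 \<longleftrightarrow> i = 0 \<or> i = 1 \<or> i = (2 :: nat)"
  by auto

lemma label_endo_reidemeister3:
  assumes \<alpha>: "\<alpha> \<in> open_strings" and \<beta>: "\<beta> \<in> open_strings" and "reidemeister3 \<alpha> \<beta>"
  shows "label_endo (end_label \<alpha>) = label_endo (end_label \<beta>)"
proof -
  obtain \<psi> f g p q r p' q' r' A B C where
    t: "tangle_replacement \<psi> 3 \<alpha> (\<lambda>i. graph_strand (f i)) \<beta> (\<lambda>i. graph_strand (g i))"
    and f: "f 0 (-1) < f 1 (-1)" "f 1 (-1) < f 2 (-1)"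
    and pqr: "-1 < p" "p < q" "q < r" "r < 1"
    and f_cross: "\<forall>x\<in>{-1..1}. (f 0 x = f 1 x \<longleftrightarrow> x = p) \<and> (f 0 x = f 2 x \<longleftrightarrow> x = q) \<and> (f 1 x = f 2 x \<longleftrightarrow> x = r)"
    and pqr': "-1 < r'" "r' < q'" "q' < p'" "p' < 1"
    and g_cross: "\<forall>x\<in>{-1..1}. (g 0 x = g 1 x \<longleftrightarrow> x = p') \<and> (g 0 x = g 2 x \<longleftrightarrow> x = q') \<and> (g 1 x = g 2 x \<longleftrightarrow> x = r')"
    and marks_f: "\<psi> (p, f 0 p) \<in> snd \<alpha> \<longleftrightarrow> A" "\<psi> (q, f 0 q) \<in> snd \<alpha> \<longleftrightarrow> B" "\<psi> (r, f 1 r) \<in> snd \<alpha> \<longleftrightarrow> C"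
    and marks_g: "\<psi> (p', g 0 p') \<in> snd \<beta> \<longleftrightarrow> A" "\<psi> (q', g 0 q') \<in> snd \<beta> \<longleftrightarrow> B" "\<psi> (r', g 1 r') \<in> snd \<beta> \<longleftrightarrow> C"
    and ABC: "(\<not> A \<and> \<not> B \<and> \<not> C) \<or> (A \<and> B) \<or> (A \<and> C) \<or> (B \<and> C)"
    using assms(3) unfolding reidemeister3_def by blast
  obtain \<tau> where "tangle \<alpha> \<beta> 3 \<tau> \<psi> (\<lambda>i. graph_strand (f i)) (\<lambda>i. graph_strand (g i))"
    using tangle_replacement_tangle[OF \<alpha> \<beta> t] .
  then interpret tangle \<alpha> \<beta> 3 \<tau> \<psi> "\<lambda>i. graph_strand (f i)" "\<lambda>i. graph_strand (g i)" .
  interpret GA: graph_strands \<alpha> 3 \<tau> \<psi> f by unfold_locales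
  interpret GB: graph_strands \<beta> 3 \<tau> \<psi> g by unfold_locales
  have fe: "f 1 p = f 0 p" "f 2 q = f 0 q" "f 2 r = f 1 r" using f_cross pqr by auto
  have ge: "g 1 p' = g 0 p'" "g 2 q' = g 0 q'" "g 2 r' = g 1 r'" using g_cross pqr' by auto
  have g: "g 0 (-1) < g 1 (-1)" "g 1 (-1) < g 2 (-1)"
    using f agree_boundary[of 0] agree_boundary[of 1] agree_boundary[of 2] by (auto simp: graph_strand_def)
  interpret SA: three_strands \<alpha> \<tau> \<psi> f "pair_case p q r" "pair_case A B C" True
  proof
    fix i j k :: nat and x :: real
    show "pair_case p q r i j = pair_case p q r j i" "pair_case A B C i j = pair_case A B C j i"
      by (simp_all add: pair_case_def add.commute)
    show "i < j \<Longrightarrow> j < 3 \<Longrightarrow> f i (-1) < f j (-1)" using f by (auto simp: less_3_iff less_2_cases_iff)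
    assume ij: "i < 3" "j < 3"
    show "k < 3 \<Longrightarrow> distinct [i, j, k] \<Longrightarrow> pair_case p q r i j \<noteq> pair_case p q r i k \<and>
        (pair_case p q r i j < pair_case p q r i k \<longleftrightarrow> (j < k) = True)"
      using pqr ij by (auto simp: less_3_iff pair_case_def)
    assume "i \<noteq> j"
    show "-1 < pair_case p q r i j \<and> pair_case p q r i j < 1"
      using pqr by (auto simp: pair_case_def)
    show "\<psi> (pair_case p q r i j, f i (pair_case p q r i j)) \<in> snd \<alpha> \<longleftrightarrow> pair_case A B C i j"
      using ij \<open>i \<noteq> j\<close> marks_f fe by (auto simp: less_3_iff pair_case_def)
    assume "x \<in> {-1..1}"
    then have "f 0 x = f 1 x \<longleftrightarrow> x = p" "f 1 x = f 0 x \<longleftrightarrow> x = p"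
      "f 0 x = f 2 x \<longleftrightarrow> x = q" "f 2 x = f 0 x \<longleftrightarrow> x = q"
      "f 1 x = f 2 x \<longleftrightarrow> x = r" "f 2 x = f 1 x \<longleftrightarrow> x = r" using f_cross by metis+
    then show "f i x = f j x \<longleftrightarrow> x = pair_case p q r i j"
      using ij \<open>i \<noteq> j\<close> unfolding less_3_iff by (elim disjE) (simp_all add: pair_case_def del: One_nat_def)
  qed
  interpret SB: three_strands \<beta> \<tau> \<psi> g "pair_case p' q' r'" "pair_case A B C" False
  proof
    fix i j k :: nat and x :: real
    show "pair_case p' q' r' i j = pair_case p' q' r' j i" "pair_case A B C i j = pair_case A B C j i"
      by (simp_all add: pair_case_def add.commute)
    show "i < j \<Longrightarrow> j < 3 \<Longrightarrow> g i (-1) < g j (-1)" using g by (auto simp: less_3_iff less_2_cases_iff)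
    assume ij: "i < 3" "j < 3"
    show "k < 3 \<Longrightarrow> distinct [i, j, k] \<Longrightarrow> pair_case p' q' r' i j \<noteq> pair_case p' q' r' i k \<and>
        (pair_case p' q' r' i j < pair_case p' q' r' i k \<longleftrightarrow> (j < k) = False)"
      using pqr' ij by (auto simp: less_3_iff pair_case_def)
    assume "i \<noteq> j"
    show "-1 < pair_case p' q' r' i j \<and> pair_case p' q' r' i j < 1"
      using pqr' by (auto simp: pair_case_def)
    show "\<psi> (pair_case p' q' r' i j, g i (pair_case p' q' r' i j)) \<in> snd \<beta> \<longleftrightarrow> pair_case A B C i j"
      using ij \<open>i \<noteq> j\<close> marks_g ge by (auto simp: less_3_iff pair_case_def)
    assume "x \<in> {-1..1}"
    then have "g 0 x = g 1 x \<longleftrightarrow> x = p'" "g 1 x = g 0 x \<longleftrightarrow> x = p'"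
      "g 0 x = g 2 x \<longleftrightarrow> x = q'" "g 2 x = g 0 x \<longleftrightarrow> x = q'"
      "g 1 x = g 2 x \<longleftrightarrow> x = r'" "g 2 x = g 1 x \<longleftrightarrow> x = r'" using g_cross by metis+
    then show "g i x = g j x \<longleftrightarrow> x = pair_case p' q' r' i j"
      using ij \<open>i \<noteq> j\<close> unfolding less_3_iff by (elim disjE) (simp_all add: pair_case_def del: One_nat_def)
  qed
  obtain a b c where abc: "a < 3" "b < 3" "c < 3" and less: "A.hi a < A.lo b" "A.hi b < A.lo c"
    using A.hi_less_lo[of 0 1] A.hi_less_lo[of 0 2] A.hi_less_lo[of 1 2]
      that[of 0 1 2] that[of 0 2 1] that[of 1 0 2] that[of 1 2 0] that[of 2 0 1] that[of 2 1 0] by auto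
  note lohi = A.\<tau>_image(2)[OF abc(1)] A.\<tau>_image(2)[OF abc(2)] A.\<tau>_image(2)[OF abc(3)]
  have ne: "a \<noteq> b" "a \<noteq> c" "b \<noteq> c" using less lohi by auto
  have word: "gauss_word \<kappa> UNIV = gauss_word \<kappa> {..<A.lo a} @ gauss_word \<kappa> {A.lo a..A.hi a} @ gauss_word \<kappa> {A.hi a<..<A.lo b} @
      gauss_word \<kappa> {A.lo b..A.hi b} @ gauss_word \<kappa> {A.hi b<..<A.lo c} @ gauss_word \<kappa> {A.lo c..A.hi c} @ gauss_word \<kappa> {A.hi c<..}"
    if "open_string \<kappa>" for \<kappa>
    using open_string.gauss_word_split_UNIV[OF that lohi(1)] open_string.gauss_word_split_above[OF that less(1) lohi(2)]
      open_string.gauss_word_split_above[OF that less(2) lohi(3)] by simp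
  have disjoint: "{..<A.lo a} \<inter> {A.lo i..A.hi i} = {}" "{A.hi a<..<A.lo b} \<inter> {A.lo i..A.hi i} = {}" 
    "{A.hi b<..<A.lo c} \<inter> {A.lo i..A.hi i} = {}" "{A.hi c<..} \<inter> {A.lo i..A.hi i} = {}" if "i < 3" for i
  proof -
    have "i = a \<or> i = b \<or> i = c" using that abc ne by auto
    then show "{..<A.lo a} \<inter> {A.lo i..A.hi i} = {}" "{A.hi a<..<A.lo b} \<inter> {A.lo i..A.hi i} = {}" 
      "{A.hi b<..<A.lo c} \<inter> {A.lo i..A.hi i} = {}" "{A.hi c<..} \<inter> {A.lo i..A.hi i} = {}" using less lohi by auto
  qed
  have outside: "gauss_word \<beta> {..<A.lo a} = gauss_word \<alpha> {..<A.lo a}" "crossing ` set (gauss_word \<alpha> {..<A.lo a}) \<subseteq> - \<psi> ` square"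
    "gauss_word \<beta> {A.hi a<..<A.lo b} = gauss_word \<alpha> {A.hi a<..<A.lo b}" "crossing ` set (gauss_word \<alpha> {A.hi a<..<A.lo b}) \<subseteq> - \<psi> ` square"
    "gauss_word \<beta> {A.hi b<..<A.lo c} = gauss_word \<alpha> {A.hi b<..<A.lo c}" "crossing ` set (gauss_word \<alpha> {A.hi b<..<A.lo c}) \<subseteq> - \<psi> ` square"
    "gauss_word \<beta> {A.hi c<..} = gauss_word \<alpha> {A.hi c<..}" "crossing ` set (gauss_word \<alpha> {A.hi c<..}) \<subseteq> - \<psi> ` square"
    by (rule gauss_word_outside, erule disjoint)+
  let ?N = "- \<psi> ` square"
  have ptA: "SA.point a b \<notin> ?N" "SA.point a c \<notin> ?N" "SA.point b c \<notin> ?N" "distinct [SA.point a b, SA.point a c, SA.point b c]"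
    using SA.point_in_disc abc ne SA.distinct_points[OF abc] by simp_all
  have ptB: "SB.point a b \<notin> ?N" "SB.point a c \<notin> ?N" "SB.point b c \<notin> ?N" "distinct [SB.point a b, SB.point a c, SB.point b c]"
    using SB.point_in_disc abc ne SB.distinct_points[OF abc] by simp_all
  have "state_eq ?N
    (fold step (gauss_word \<alpha> {A.lo a..A.hi a} @ gauss_word \<alpha> {A.hi a<..<A.lo b} @ gauss_word \<alpha> {A.lo b..A.hi b} @
       gauss_word \<alpha> {A.hi b<..<A.lo c} @ gauss_word \<alpha> {A.lo c..A.hi c}) s)
    (fold step (gauss_word \<beta> {A.lo a..A.hi a} @ gauss_word \<alpha> {A.hi a<..<A.lo b} @ gauss_word \<beta> {A.lo b..A.hi b} @
       gauss_word \<alpha> {A.hi b<..<A.lo c} @ gauss_word \<beta> {A.lo c..A.hi c}) s)" for s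
  proof -
    \<comment> \<open>As parities: the directions occurring twice cancel, and what remains is that
      of two distinct indices exactly one is smaller.\<close>
    have e: "((A.rising a = A.rising c) = (c < a)) = (((A.rising a = A.rising b) = (b < a)) = ((A.rising b = (a < c)) = (A.rising c = (a < b))))"
      "((A.rising b = A.rising c) = (c < b)) = (((A.rising a = A.rising b) = (b < a)) = ((A.rising a = (b < c)) = (A.rising c = (a < b))))"
      using ne by (auto simp: not_less le_less)
    have m: "(\<not> pair_case A B C a b \<and> \<not> pair_case A B C a c \<and> \<not> pair_case A B C b c) \<or>
      (pair_case A B C a b \<and> pair_case A B C a c) \<or> (pair_case A B C a b \<and> pair_case A B C b c) \<or> (pair_case A B C a c \<and> pair_case A B C b c)"
      using abc ne ABC by (auto simp: less_3_iff pair_case_def)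
    \<comment> \<open>Replacing \<open>\<sigma>\<close> by its negation negates all three order
      bits, as the algebraic lemma expects for the other side of the move.\<close>
    have bool: "(x = (y = False)) = (\<not> (x = y))" "(x = (y = True)) = (x = y)" for x y :: bool by auto
    show ?thesis
      unfolding SA.gauss_words[OF abc less] SB.gauss_words[OF abc less] bool
      by (rule fold_step_reidemeister3_marked[OF ptA ptB outside(4) outside(6) state_eq_refl e m])
  qed
  from fold_step_state_eq[OF this outside(8)]
  have "state_eq ?N (fold step (gauss_word \<alpha> UNIV) initial_state) (fold step (gauss_word \<beta> UNIV) initial_state)"
    unfolding word[OF A.open_string_axioms] word[OF B.open_string_axioms] outside by simp
  then show ?thesis by (rule label_endo_end_label_eqI)
qed

lemma Phi_elementary_move:
  assumes "elementary_move \<alpha> \<beta>"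
  shows "Phi \<alpha> = Phi \<beta>"
proof -
  have \<alpha>\<beta>: "\<alpha> \<in> open_strings" "\<beta> \<in> open_strings" using assms unfolding elementary_move_def by blast+
  then interpret A: open_string \<alpha> + B: open_string \<beta> by unfold_locales
  show ?thesis
    unfolding A.Phi_eq B.Phi_eq
    using assms label_endo_reidemeister1[OF \<alpha>\<beta>] label_endo_reidemeister2[OF \<alpha>\<beta>] label_endo_reidemeister3[OF \<alpha>\<beta>]
      end_label_planar_isotopy[OF A.open_string_axioms B.open_string_axioms]
    unfolding elementary_move_def by metis
qed

lemma Phi_string_equiv:
  assumes "(\<alpha>, \<beta>) \<in> string_equiv"
  shows "Phi \<alpha> = Phi \<beta>"
proof -
  have "equivclp elementary_move \<alpha> \<beta>" using assms by (simp add: string_equiv_def)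
  then show ?thesis by (induction rule: equivclp_induct) (auto dest: Phi_elementary_move)
qed

section \<open>Concatenation\<close>

text \<open>\<kappa> is a translate of \<alpha> on the open set \<open>U\<close>, which gives the
  velocities too. \<open>S\<close> may also contain the seam of a concatenation, a time which by
  \<open>double_\<kappa>\<close> is no double point.\<close>

lemma gauss_word_translate:
  assumes \<alpha>: "open_string \<alpha>" and \<kappa>: "open_string \<kappa>" and U: "open U" "U \<subseteq> S"
    and translate: "\<And>t. t + a \<in> U \<Longrightarrow> fst \<kappa> (t + a) = fst \<alpha> t + (a, 0)"
    and double_\<alpha>: "\<And>s t. s \<noteq> t \<Longrightarrow> fst \<alpha> s = fst \<alpha> t \<Longrightarrow> t + a \<in> U"
    and double_\<kappa>: "\<And>s t. s \<noteq> t \<Longrightarrow> fst \<kappa> s = fst \<kappa> t \<Longrightarrow> t \<in> S \<Longrightarrow> s \<in> U \<and> t \<in> U"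
    and marks: "\<And>t. t + a \<in> U \<Longrightarrow> fst \<kappa> (t + a) \<in> snd \<kappa> \<longleftrightarrow> fst \<alpha> t \<in> snd \<alpha>"
  shows "gauss_word \<kappa> S = map (map_passage (\<lambda>p. p + (a, 0))) (gauss_word \<alpha> UNIV)"
proof (rule gauss_word_transport[OF \<alpha> \<kappa>, of "\<lambda>t. t + a"])
  interpret \<alpha>: open_string \<alpha> by fact
  interpret \<kappa>: open_string \<kappa> by fact
  have translate': "fst \<kappa> x = fst \<alpha> (x - a) + (a, 0)" if "x \<in> U" for x
    using translate[of "x - a"] that by simp
  show "strict_mono (\<lambda>t. t + a)" by (simp add: strict_mono_def)
  show transport: "(s + a, t + a) \<in> classical_crossings \<kappa> \<and> fst \<kappa> (t + a) = fst \<alpha> t + (a, 0) \<and>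
      positive_crossing \<kappa> (s + a, t + a) = positive_crossing \<alpha> (s, t)"
    if "(s, t) \<in> classical_crossings \<alpha>" for s t
  proof -
    have st: "s < t" "fst \<alpha> s = fst \<alpha> t" "fst \<alpha> s \<notin> snd \<alpha>" using that by (auto simp: classical_crossings_def)
    have "s + a \<in> U" "t + a \<in> U" using double_\<alpha>[of t s] double_\<alpha>[of s t] st by auto
    moreover have "velocity (fst \<kappa>) (r + a) = velocity (fst \<alpha>) r" if "r + a \<in> U" for r
    proof -
      have "((\<lambda>x. fst \<kappa> (x + a)) has_vector_derivative velocity (fst \<kappa>) (r + a)) (at r)"
        using vector_diff_chain_at[of "\<lambda>x. x + a" 1 r "fst \<kappa>" "velocity (fst \<kappa>) (r + a)"] \<kappa>.has_velocity
        by (simp add: comp_def has_vector_derivative_add_const)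
      then have "((\<lambda>x. fst \<alpha> x + (a, 0)) has_vector_derivative velocity (fst \<kappa>) (r + a)) (at r)"
      proof (rule has_vector_derivative_transform_within_open)
        show "open ((\<lambda>x. x - a) ` U)" using U(1) by (simp add: open_translation_subtract)
        show "r \<in> (\<lambda>x. x - a) ` U" using that by (auto simp: image_iff intro!: bexI[of _ "r + a"])
      qed (auto simp: translate')
      then have "(fst \<alpha> has_vector_derivative velocity (fst \<kappa>) (r + a)) (at r)"
        by (simp add: has_vector_derivative_add_const)
      then show ?thesis using \<alpha>.has_velocity vector_derivative_unique_at by blast
    qed
    ultimately show ?thesis
      using st translate marks by (simp add: classical_crossings_def positive_crossing_def)
  qed
  show "classical_passages \<kappa> \<inter> S = (\<lambda>t. t + a) ` (classical_passages \<alpha> \<inter> UNIV)"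
  proof (intro equalityI subsetI)
    fix t assume t: "t \<in> classical_passages \<kappa> \<inter> S"
    then obtain s where s: "s \<noteq> t" "fst \<kappa> s = fst \<kappa> t" "fst \<kappa> t \<notin> snd \<kappa>"
      using \<kappa>.double_point_iff by (auto simp: classical_passages_def)
    then have "s \<in> U" "t \<in> U" using double_\<kappa> t by auto
    then have "fst \<alpha> (s - a) = fst \<alpha> (t - a)" "fst \<alpha> (t - a) \<notin> snd \<alpha>"
      using translate[of "s - a"] translate[of "t - a"] marks[of "t - a"] s by auto
    then have "t - a \<in> classical_passages \<alpha>"
      using \<alpha>.double_point_iff[of "t - a"] s(1) by (auto simp: classical_passages_def intro!: exI[of _ "s - a"])
    then show "t \<in> (\<lambda>t. t + a) ` (classical_passages \<alpha> \<inter> UNIV)" by (auto intro!: image_eqI[of _ _ "t - a"])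
  next
    fix r assume "r \<in> (\<lambda>t. t + a) ` (classical_passages \<alpha> \<inter> UNIV)"
    then obtain t where t: "t \<in> classical_passages \<alpha>" "r = t + a" by auto
    then obtain s where "s \<noteq> t" "fst \<alpha> s = fst \<alpha> t" using \<alpha>.double_point_iff by (auto simp: classical_passages_def)
    then have "r \<in> S" using double_\<alpha> U(2) t(2) by auto
    moreover have "r \<in> classical_passages \<kappa>" using t(1)
    proof (cases rule: \<alpha>.passage_cases)
      case (1 s)
      then show ?thesis using transport[OF 1] \<kappa>.crossing_passages(2) t(2) by blast
    next
      case (2 s)
      then show ?thesis using transport[OF 2] \<kappa>.crossing_passages(1) t(2) by blast
    qed
    ultimately show "r \<in> classical_passages \<kappa> \<inter> S" by blast
  qed
qed

text \<open>As the names are disjoint, the second word never reads a record made by the first one.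
  It therefore acts as if started from the label \<open>?L\<close> with empty records.\<close>

lemma fold_step_append_rename:
  assumes "inj h" "inj k" and disjoint: "crossing ` set (map (map_passage h) ps) \<inter> crossing ` set (map (map_passage k) qs) = {}"
  shows "abs_fg (fst (fold step (map (map_passage h) ps @ map (map_passage k) qs) initial_state) n) =
    abs_fg (subst (fst (fold step ps initial_state)) (fst (fold step qs initial_state) n))"
proof -
  let ?P = "map (map_passage h) ps" and ?Q = "map (map_passage k) qs"
  let ?L = "fst (fold step ps initial_state)"
  have "fst (fold step ?P initial_state) = ?L"
    using fold_step_rename[OF \<open>inj h\<close>, of ps "\<lambda>n. [(n, True)]" "\<lambda>c n. []"]
    by (simp add: initial_state_def comp_def)
  then obtain st where st: "fold step ?P initial_state = (?L, st)" by (metis prod.collapse)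
  have "st c = (\<lambda>n. [])" if "c \<in> crossing ` set ?Q" for c
    using snd_fold_step_other[of c ?P initial_state] that disjoint st by (auto simp: initial_state_def)
  then have "state_eq (crossing ` set ?Q) (?L, st) (?L, \<lambda>c n. [])"
    unfolding state_eq_def by (metis fst_conv snd_conv)
  then have "state_eq (crossing ` set ?Q) (fold step ?Q (?L, st)) (fold step ?Q (?L, \<lambda>c n. []))"
    by (rule fold_step_state_eq) simp
  then have "abs_fg (fst (fold step (?P @ ?Q) initial_state) n) = abs_fg (fst (fold step ?Q (?L, \<lambda>c n. [])) n)"
    unfolding state_eq_def fold_append comp_def st by blast
  also have "fst (fold step ?Q (?L, \<lambda>c n. [])) = fst (fold step qs (?L, \<lambda>c n. []))"
    using fold_step_rename[OF \<open>inj k\<close>] by (simp add: comp_def)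
  \<comment> \<open>This start is the initial state with \<open>?L\<close> substituted for the
    generators, so by naturality the substitution can be postponed to the end.\<close>
  also have "(?L, \<lambda>c n. []) = subst_state ?L initial_state" by (simp add: subst_state_def initial_state_def)
  finally show ?thesis unfolding fold_step_subst_state by (simp add: subst_state_def case_prod_unfold)
qed

locale concatenation = A: open_string \<alpha> + B: open_string \<beta> for \<alpha> \<beta> +
  fixes R S :: real
  assumes fits: "fits_strip R \<alpha>" "fits_strip S \<beta>"
begin

abbreviation "\<kappa> \<equiv> concatenate R S \<alpha> \<beta>"

lemma RS: "R > 0" "S > 0"
  using fits by (simp_all add: fits_strip_def)

lemma standard: "\<bar>x\<bar> \<ge> R \<Longrightarrow> fst \<alpha> x = (x, 0)" "\<bar>x\<bar> \<ge> S \<Longrightarrow> fst \<beta> x = (x, 0)"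
  and strip: "\<bar>x\<bar> < R \<Longrightarrow> \<bar>fst (fst \<alpha> x)\<bar> < R" "\<bar>x\<bar> < S \<Longrightarrow> \<bar>fst (fst \<beta> x)\<bar> < S"
  using fits unfolding fits_strip_def by (smt (verit))+

lemma \<kappa>_left: "t \<le> 0 \<Longrightarrow> fst \<kappa> t = fst \<alpha> (t + R) - (R, 0)"
  and \<kappa>_right: "t > 0 \<Longrightarrow> fst \<kappa> t = fst \<beta> (t - S) + (S, 0)"
  by (simp_all add: concatenate_def)

text \<open>At times outside the strip the string is at \<open>(x, 0)\<close>, injectively, and it
  returns there at no time inside the strip, whose points have smaller abscissas in absolute
  value.\<close>

lemma double_in_strip:
  "s \<noteq> t \<Longrightarrow> fst \<alpha> s = fst \<alpha> t \<Longrightarrow> \<bar>t\<bar> < R"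
  "s \<noteq> t \<Longrightarrow> fst \<beta> s = fst \<beta> t \<Longrightarrow> \<bar>t\<bar> < S"
proof -
  show "\<bar>t\<bar> < R" if "s \<noteq> t" "fst \<alpha> s = fst \<alpha> t" for s t
  proof (rule ccontr)
    assume "\<not> \<bar>t\<bar> < R"
    then show False using that standard(1)[of t] standard(1)[of s] strip(1)[of s] by (cases "\<bar>s\<bar> < R") auto
  qed
  show "\<bar>t\<bar> < S" if "s \<noteq> t" "fst \<beta> s = fst \<beta> t" for s t
  proof (rule ccontr)
    assume "\<not> \<bar>t\<bar> < S"
    then show False using that standard(2)[of t] standard(2)[of s] strip(2)[of s] by (cases "\<bar>s\<bar> < S") auto
  qed
qed

lemma double_point_in_strip:
  "p \<in> double_points (fst \<alpha>) \<Longrightarrow> \<bar>fst p\<bar> < R" "p \<in> double_points (fst \<beta>) \<Longrightarrow> \<bar>fst p\<bar> < S"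
proof -
  show "\<bar>fst p\<bar> < R" if p: "p \<in> double_points (fst \<alpha>)" for p
  proof -
    obtain s t where "s \<noteq> t" "fst \<alpha> s = p" "fst \<alpha> t = p" using p by (auto simp: double_points_def)
    then show ?thesis using strip(1)[of t] double_in_strip(1)[of s t] by auto
  qed
  show "\<bar>fst p\<bar> < S" if p: "p \<in> double_points (fst \<beta>)" for p
  proof -
    obtain s t where "s \<noteq> t" "fst \<beta> s = p" "fst \<beta> t = p" using p by (auto simp: double_points_def)
    then show ?thesis using strip(2)[of t] double_in_strip(2)[of s t] by auto
  qed
qed

text \<open>This keeps the two factors apart: coinciding points of \<kappa> come from the same
  factor, and the factors share no name of a crossing.\<close>

lemma fst_\<kappa>_pos: "0 < fst (fst \<kappa> t) \<longleftrightarrow> 0 < t"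
proof (cases "t \<le> 0")
  case True
  have "fst (fst \<alpha> (t + R)) \<le> R"
    using standard(1)[of "t + R"] strip(1)[of "t + R"] True by (cases "\<bar>t + R\<bar> < R") auto
  then show ?thesis using True by (simp add: \<kappa>_left)
next
  case False
  have "fst (fst \<beta> (t - S)) > - S"
    using standard(2)[of "t - S"] strip(2)[of "t - S"] False by (cases "\<bar>t - S\<bar> < S") auto
  then show ?thesis using False by (simp add: \<kappa>_right)
qed

lemma coincidence:
  assumes "s \<noteq> t" "fst \<kappa> s = fst \<kappa> t"
  shows "s < 0 \<and> t < 0 \<and> fst \<alpha> (s + R) = fst \<alpha> (t + R) \<or> 0 < s \<and> 0 < t \<and> fst \<beta> (s - S) = fst \<beta> (t - S)"
proof (cases "0 < t")
  case True
  then have "0 < s" using fst_\<kappa>_pos[of s] fst_\<kappa>_pos[of t] assms(2) by simp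
  then show ?thesis using True assms(2) by (simp add: \<kappa>_right)
next
  case False
  then have "s \<le> 0" "t \<le> 0" using fst_\<kappa>_pos[of s] fst_\<kappa>_pos[of t] assms(2) by simp_all
  then have eq: "fst \<alpha> (s + R) = fst \<alpha> (t + R)" using assms(2) by (simp add: \<kappa>_left)
  \<comment> \<open>Time 0 is excluded: it corresponds to the parameter \<open>R\<close> of
    \<alpha>, which lies outside the strip and hence is no double point.\<close>
  then have "s < 0" "t < 0"
    using double_in_strip(1)[of "s + R" "t + R"] double_in_strip(1)[of "t + R" "s + R"] assms(1) by auto
  then show ?thesis using eq by blast
qed

lemma snd_\<kappa>: "snd \<kappa> = (\<lambda>p. p - (R, 0)) ` snd \<alpha> \<union> (\<lambda>p. p + (S, 0)) ` snd \<beta>"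
  by (simp add: concatenate_def)

lemma snd_double: "snd \<alpha> \<subseteq> double_points (fst \<alpha>)" "snd \<beta> \<subseteq> double_points (fst \<beta>)"
  using A.\<alpha> B.\<alpha> by (auto simp: open_strings_def)

lemma mark_left: "t < 0 \<Longrightarrow> fst \<kappa> t \<in> snd \<kappa> \<longleftrightarrow> fst \<alpha> (t + R) \<in> snd \<alpha>"
proof -
  assume t: "t < 0"
  have "fst \<kappa> t \<notin> (\<lambda>p. p + (S, 0)) ` snd \<beta>"
  proof
    assume "fst \<kappa> t \<in> (\<lambda>p. p + (S, 0)) ` snd \<beta>"
    then obtain p where "p \<in> snd \<beta>" "fst \<kappa> t = p + (S, 0)" by blast
    then have "0 < fst (fst \<kappa> t)" using double_point_in_strip(2)[of p] snd_double(2) by auto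
    then show False using fst_\<kappa>_pos t by simp
  qed
  moreover have "fst \<kappa> t \<in> (\<lambda>p. p - (R, 0)) ` snd \<alpha> \<longleftrightarrow> fst \<alpha> (t + R) \<in> snd \<alpha>"
    using t inj_image_mem_iff[of "\<lambda>p. p - (R, 0)" "fst \<alpha> (t + R)" "snd \<alpha>"] by (simp add: \<kappa>_left inj_def)
  ultimately show ?thesis unfolding snd_\<kappa> by blast
qed

lemma mark_right: "0 < t \<Longrightarrow> fst \<kappa> t \<in> snd \<kappa> \<longleftrightarrow> fst \<beta> (t - S) \<in> snd \<beta>"
proof -
  assume t: "0 < t"
  have "fst \<kappa> t \<notin> (\<lambda>p. p - (R, 0)) ` snd \<alpha>"
  proof
    assume "fst \<kappa> t \<in> (\<lambda>p. p - (R, 0)) ` snd \<alpha>"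
    then obtain p where "p \<in> snd \<alpha>" "fst \<kappa> t = p - (R, 0)" by blast
    then have "fst (fst \<kappa> t) < 0" using double_point_in_strip(1)[of p] snd_double(1) by auto
    then show False using fst_\<kappa>_pos[of t] t by simp
  qed
  moreover have "fst \<kappa> t \<in> (\<lambda>p. p + (S, 0)) ` snd \<beta> \<longleftrightarrow> fst \<beta> (t - S) \<in> snd \<beta>"
    using t inj_image_mem_iff[of "\<lambda>p. p + (S, 0)" "fst \<beta> (t - S)" "snd \<beta>"] by (simp add: \<kappa>_right inj_def)
  ultimately show ?thesis unfolding snd_\<kappa> by blast
qed

lemma Phi_concatenate:
  assumes "\<kappa> \<in> open_strings"
  shows "Phi \<kappa> = mult (End_monoid free_group_F) (Phi \<alpha>) (Phi \<beta>)"
proof -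
  interpret K: open_string \<kappa> by unfold_locales fact
  have left: "gauss_word \<kappa> {..0} = map (map_passage (\<lambda>p. p + (- R, 0))) (gauss_word \<alpha> UNIV)"
  proof (rule gauss_word_translate[OF A.open_string_axioms K.open_string_axioms, of "{..<0}"])
    show "t + - R \<in> {..<0} \<Longrightarrow> fst \<kappa> (t + - R) = fst \<alpha> t + (- R, 0)" for t
      using \<kappa>_left[of "t + - R"] by (simp add: prod_eq_iff)
    show "s \<noteq> t \<Longrightarrow> fst \<alpha> s = fst \<alpha> t \<Longrightarrow> t + - R \<in> {..<0}" for s t
      using double_in_strip(1)[of s t] by auto
    show "s \<noteq> t \<Longrightarrow> fst \<kappa> s = fst \<kappa> t \<Longrightarrow> t \<in> {..0} \<Longrightarrow> s \<in> {..<0} \<and> t \<in> {..<0}" for s t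
      using coincidence[of s t] by auto
    show "t + - R \<in> {..<0} \<Longrightarrow> fst \<kappa> (t + - R) \<in> snd \<kappa> \<longleftrightarrow> fst \<alpha> t \<in> snd \<alpha>" for t
      using mark_left[of "t + - R"] by simp
  qed auto
  have right: "gauss_word \<kappa> {0<..} = map (map_passage (\<lambda>p. p + (S, 0))) (gauss_word \<beta> UNIV)"
  proof (rule gauss_word_translate[OF B.open_string_axioms K.open_string_axioms, of "{0<..}"])
    show "t + S \<in> {0<..} \<Longrightarrow> fst \<kappa> (t + S) = fst \<beta> t + (S, 0)" for t
      using \<kappa>_right[of "t + S"] by simp
    show "s \<noteq> t \<Longrightarrow> fst \<beta> s = fst \<beta> t \<Longrightarrow> t + S \<in> {0<..}" for s t
      using double_in_strip(2)[of s t] by auto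
    show "s \<noteq> t \<Longrightarrow> fst \<kappa> s = fst \<kappa> t \<Longrightarrow> t \<in> {0<..} \<Longrightarrow> s \<in> {0<..} \<and> t \<in> {0<..}" for s t
      using coincidence[of s t] by auto
    show "t + S \<in> {0<..} \<Longrightarrow> fst \<kappa> (t + S) \<in> snd \<kappa> \<longleftrightarrow> fst \<beta> t \<in> snd \<beta>" for t
      using mark_right[of "t + S"] by simp
  qed auto
  have "gauss_word \<kappa> ({..0} \<union> {0<..}) = gauss_word \<kappa> {..0} @ gauss_word \<kappa> {0<..}"
    by (rule K.gauss_word_Un) auto
  moreover have "{..0} \<union> {0<..} = (UNIV :: real set)" by auto
  ultimately have word: "gauss_word \<kappa> UNIV = gauss_word \<kappa> {..0} @ gauss_word \<kappa> {0<..}" by simp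
  have "crossing (gauss_passage \<kappa> t) = fst \<kappa> t" for t by (simp add: gauss_passage_def Let_def)
  then have names: "crossing ` set (gauss_word \<kappa> T) = fst \<kappa> ` (classical_passages \<kappa> \<inter> T)" for T
    by (simp add: gauss_word_def image_image K.finite_passages)
  have "fst \<kappa> ` (classical_passages \<kappa> \<inter> {..0}) \<inter> fst \<kappa> ` (classical_passages \<kappa> \<inter> {0<..}) = {}"
    using fst_\<kappa>_pos by (smt (verit) IntD2 atMost_iff disjoint_iff greaterThan_iff imageE)
  then have "crossing ` set (gauss_word \<kappa> {..0}) \<inter> crossing ` set (gauss_word \<kappa> {0<..}) = {}"
    by (simp only: names)
  then have "abs_fg (end_label \<kappa> n) = abs_fg (subst (end_label \<alpha>) (end_label \<beta> n))" for n
    unfolding end_label_def word left right by (intro fold_step_append_rename) (auto simp: inj_def)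
  then show ?thesis
    unfolding K.Phi_eq A.Phi_eq B.Phi_eq label_endo_comp by (rule label_endo_cong)
qed

text \<open>The margin of width 1 makes both strings standard near the seam, so \<kappa> is the
  horizontal line at times between -1 and 1 and the velocities fit together continuously at
  0.\<close>

lemma concatenate_in_open_strings:
  assumes wide: "\<And>x. \<bar>x\<bar> \<ge> R - 1 \<Longrightarrow> fst \<alpha> x = (x, 0)" "\<And>x. \<bar>x\<bar> \<ge> S - 1 \<Longrightarrow> fst \<beta> x = (x, 0)"
    and "R \<ge> 1" "S \<ge> 1"
  shows "\<kappa> \<in> open_strings"
proof -
  define V where "V t = (if t \<le> 0 then velocity (fst \<alpha>) (t + R) else velocity (fst \<beta>) (t - S))" for t
  have std: "((\<lambda>x. (x, 0)) has_vector_derivative (1, 0)) (at t)" for t :: real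
    by (intro has_vector_derivative_Pair has_vector_derivative_id has_vector_derivative_const)
  have ends: "velocity (fst \<alpha>) R = (1, 0)" "velocity (fst \<beta>) (- S) = (1, 0)"
  proof -
    have "(fst \<alpha> has_vector_derivative (1, 0)) (at R)"
      by (rule has_vector_derivative_transform_within_open[OF std, of "{R - 1<..}"]) (use wide(1) assms(3) in auto)
    then show "velocity (fst \<alpha>) R = (1, 0)" using A.has_velocity vector_derivative_unique_at by blast
    have "(fst \<beta> has_vector_derivative (1, 0)) (at (- S))"
      by (rule has_vector_derivative_transform_within_open[OF std, of "{..<- S + 1}"]) (use wide(2) assms(4) in auto)
    then show "velocity (fst \<beta>) (- S) = (1, 0)" using B.has_velocity vector_derivative_unique_at by blast
  qed
  have V: "(fst \<kappa> has_vector_derivative V t) (at t)" for t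
  proof (cases t "0 :: real" rule: linorder_cases)
    case less
    have "((\<lambda>x. fst \<alpha> (x + R)) has_vector_derivative V t) (at t)"
      using vector_diff_chain_at[of "\<lambda>x. x + R" 1 t "fst \<alpha>" "velocity (fst \<alpha>) (t + R)"] A.has_velocity less
      by (simp add: comp_def has_vector_derivative_add_const V_def)
    then have "((\<lambda>x. fst \<alpha> (x + R) - (R, 0)) has_vector_derivative V t) (at t)"
      by (simp add: has_vector_derivative_diff_const)
    then show ?thesis
      by (rule has_vector_derivative_transform_within_open[where S = "{..<0}"]) (use less in \<open>auto simp: \<kappa>_left\<close>)
  next
    case equal
    then have "V t = (1, 0)" using ends by (simp add: V_def)
    moreover have "(x, 0) = fst \<kappa> x" if "x \<in> {-1<..<1}" for x
      using that wide(1)[of "x + R"] wide(2)[of "x - S"] assms(3,4) by (cases "x \<le> 0") (auto simp: \<kappa>_left \<kappa>_right)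
    ultimately show ?thesis
      using has_vector_derivative_transform_within_open[OF std[of t], of "{-1<..<1}" "fst \<kappa>"] equal by auto
  next
    case greater
    have "((\<lambda>x. fst \<beta> (x - S)) has_vector_derivative V t) (at t)"
      using vector_diff_chain_at[of "\<lambda>x. x - S" 1 t "fst \<beta>" "velocity (fst \<beta>) (t - S)"] B.has_velocity greater
      by (simp add: comp_def has_vector_derivative_diff_const V_def)
    then have "((\<lambda>x. fst \<beta> (x - S) + (S, 0)) has_vector_derivative V t) (at t)"
      by (simp add: has_vector_derivative_add_const)
    then show ?thesis
      by (rule has_vector_derivative_transform_within_open[where S = "{0<..}"]) (use greater in \<open>auto simp: \<kappa>_right\<close>)
  qed
  have vel: "velocity (fst \<kappa>) t = V t" for t
    unfolding velocity_def using V by (rule vector_derivative_at)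
  have cont: "continuous_on UNIV (velocity (fst \<alpha>))" "continuous_on UNIV (velocity (fst \<beta>))"
    using A.generic B.generic unfolding generic_immersion_def C1_differentiable_on_eq velocity_def by auto
  have "continuous_on UNIV V"
    unfolding V_def
    by (intro continuous_on_cases_le[where h = "\<lambda>t. t"] continuous_on_compose2[OF cont(1)] continuous_on_compose2[OF cont(2)] continuous_intros)
      (auto simp: ends)
  then have "fst \<kappa> C1_differentiable_on UNIV" unfolding C1_differentiable_on_def using V by blast
  moreover have "velocity (fst \<kappa>) t \<noteq> 0" for t
    using A.generic B.generic by (simp add: vel V_def generic_immersion_def)
  moreover have double: "double_points (fst \<kappa>) = (\<lambda>p. p - (R, 0)) ` double_points (fst \<alpha>) \<union> (\<lambda>p. p + (S, 0)) ` double_points (fst \<beta>)"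
  proof (intro equalityI subsetI)
    fix p assume "p \<in> double_points (fst \<kappa>)"
    then obtain s t where st: "s \<noteq> t" "fst \<kappa> s = p" "fst \<kappa> t = p" by (auto simp: double_points_def)
    then consider "s < 0" "t < 0" "fst \<alpha> (s + R) = fst \<alpha> (t + R)" | "0 < s" "0 < t" "fst \<beta> (s - S) = fst \<beta> (t - S)"
      using coincidence[of s t] by auto
    then show "p \<in> (\<lambda>p. p - (R, 0)) ` double_points (fst \<alpha>) \<union> (\<lambda>p. p + (S, 0)) ` double_points (fst \<beta>)"
    proof cases
      case 1
      then have "fst \<alpha> (t + R) \<in> double_points (fst \<alpha>)"
        unfolding A.double_point_iff using st(1) by (intro exI[of _ "s + R"]) simp
      then show ?thesis using 1 st(3) \<kappa>_left[of t] by auto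
    next
      case 2
      then have "fst \<beta> (t - S) \<in> double_points (fst \<beta>)"
        unfolding B.double_point_iff using st(1) by (intro exI[of _ "s - S"]) simp
      then show ?thesis using 2 st(3) \<kappa>_right[of t] by auto
    qed
  next
    fix p assume "p \<in> (\<lambda>p. p - (R, 0)) ` double_points (fst \<alpha>) \<union> (\<lambda>p. p + (S, 0)) ` double_points (fst \<beta>)"
    then consider q where "q \<in> double_points (fst \<alpha>)" "p = q - (R, 0)" | q where "q \<in> double_points (fst \<beta>)" "p = q + (S, 0)"
      by blast
    then show "p \<in> double_points (fst \<kappa>)"
    proof cases
      case 1
      then obtain s t where st: "s \<noteq> t" "fst \<alpha> s = q" "fst \<alpha> t = q" by (auto simp: double_points_def)
      then have "s - R \<le> 0" "t - R \<le> 0" using double_in_strip(1)[of s t] double_in_strip(1)[of t s] by auto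
      then have "s - R \<noteq> t - R \<and> fst \<kappa> (s - R) = p \<and> fst \<kappa> (t - R) = p" using st 1 by (simp add: \<kappa>_left)
      then show ?thesis unfolding double_points_def by blast
    next
      case 2
      then obtain s t where st: "s \<noteq> t" "fst \<beta> s = q" "fst \<beta> t = q" by (auto simp: double_points_def)
      then have "0 < s + S" "0 < t + S" using double_in_strip(2)[of s t] double_in_strip(2)[of t s] by auto
      then have "s + S \<noteq> t + S \<and> fst \<kappa> (s + S) = p \<and> fst \<kappa> (t + S) = p" using st 2 by (simp add: \<kappa>_right)
      then show ?thesis unfolding double_points_def by blast
    qed
  qed
  moreover from double have "finite (double_points (fst \<kappa>))"
    using A.generic B.generic by (simp add: generic_immersion_def)
  moreover have "det2 (velocity (fst \<kappa>) s) (velocity (fst \<kappa>) t) \<noteq> 0" if "s \<noteq> t" "fst \<kappa> s = fst \<kappa> t" for s t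
    using coincidence[OF that] A.transversal[of "s + R" "t + R"] B.transversal[of "s - S" "t - S"] that(1)
    by (auto simp: vel V_def)
  moreover have "s = t \<or> t = u \<or> s = u" if "fst \<kappa> s = fst \<kappa> t" "fst \<kappa> t = fst \<kappa> u" for s t u
  proof (rule ccontr)
    assume "\<not> ?thesis"
    then show False
      using coincidence[of s t] coincidence[of t u] A.no_triple[of "s + R" "t + R" "u + R"] B.no_triple[of "s - S" "t - S" "u - S"] that
      by auto
  qed
  ultimately have "generic_immersion (fst \<kappa>)" unfolding generic_immersion_def by blast
  moreover have "fst \<kappa> x = (x, 0)" if "\<bar>x\<bar> \<ge> 2 * R + 2 * S" for x
    using that standard(1)[of "x + R"] standard(2)[of "x - S"] RS by (cases "x \<le> 0") (auto simp: \<kappa>_left \<kappa>_right)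
  moreover have "snd \<kappa> \<subseteq> double_points (fst \<kappa>)"
    unfolding snd_\<kappa> double using snd_double by (intro Un_mono image_mono)
  ultimately have "(fst \<kappa>, snd \<kappa>) \<in> open_strings" unfolding open_strings_def by blast
  then show ?thesis by simp
qed

end

lemma (in open_string) wide_strip:
  obtains R where "fits_strip R \<alpha>" "R \<ge> 1" "\<And>x. \<bar>x\<bar> \<ge> R - 1 \<Longrightarrow> fst \<alpha> x = (x, 0)"
proof -
  obtain K where "\<forall>x. \<bar>x\<bar> \<ge> K \<longrightarrow> fst \<alpha> x = (x, 0)" using \<alpha> by (auto simp: open_strings_def)
  then have K: "\<bar>x\<bar> \<ge> K \<Longrightarrow> fst \<alpha> x = (x, 0)" for x by blast
  have "continuous_on {-K..K} (fst \<alpha>)"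
    using has_velocity has_vector_derivative_continuous by (meson continuous_at_imp_continuous_on)
  then have "bounded (fst \<alpha> ` {-K..K})" by (intro compact_imp_bounded compact_continuous_image) auto
  then obtain M where "\<forall>x\<in>{-K..K}. norm (fst \<alpha> x) \<le> M" by (auto simp: bounded_iff)
  then have M: "x \<in> {-K..K} \<Longrightarrow> norm (fst \<alpha> x) \<le> M" for x by blast
  \<comment> \<open>\<open>R\<close> exceeds \<open>K\<close> by 1 to leave the margin, exceeds the
    bound \<open>M\<close> for the compact middle part to contain it in the strip, and is at least
    1.\<close>
  define R where "R = max (max K M) 0 + 1"
  have R: "R \<ge> 1" "R \<ge> K + 1" "R \<ge> M + 1" by (auto simp: R_def)
  have "\<bar>fst (fst \<alpha> x)\<bar> < R" if "\<bar>x\<bar> < R" for x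
  proof (cases "\<bar>x\<bar> \<ge> K")
    case True
    then show ?thesis using K that by simp
  next
    case False
    then have "norm (fst \<alpha> x) \<le> M" by (intro M) auto
    moreover have "\<bar>fst (fst \<alpha> x)\<bar> \<le> norm (fst \<alpha> x)" using norm_fst_le[of "fst (fst \<alpha> x)" "snd (fst \<alpha> x)"] by simp
    ultimately show ?thesis using R by linarith
  qed
  then have "fits_strip R \<alpha>" using K R by (auto simp: fits_strip_def)
  then show ?thesis using that[of R] K R by auto
qed

theorem theorem2p1:
  shows "(\<forall>\<alpha>\<in>open_strings. \<exists>!\<phi>. is_Phi \<alpha> \<phi>) \<and>
    (\<forall>\<alpha> \<beta>. (\<alpha>, \<beta>) \<in> string_equiv \<longrightarrow> Phi \<alpha> = Phi \<beta>) \<and>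
    Phi_class \<in> hom string_semigroup (End_monoid free_group_F)"
proof (intro conjI ballI allI impI)
  fix \<alpha> assume "\<alpha> \<in> open_strings"
  then interpret open_string \<alpha> by unfold_locales
  show "\<exists>!\<phi>. is_Phi \<alpha> \<phi>" using is_Phi_label_endo is_Phi_unique by blast
next
  fix \<alpha> \<beta> assume "(\<alpha>, \<beta>) \<in> string_equiv"
  then show "Phi \<alpha> = Phi \<beta>" by (rule Phi_string_equiv)
next
  have refl: "(\<alpha>, \<alpha>) \<in> string_equiv" if "\<alpha> \<in> open_strings" for \<alpha>
    using that by (simp add: string_equiv_def)
  have Phi_class: "Phi_class (string_equiv `` {\<alpha>}) = Phi \<alpha>" if "\<alpha> \<in> open_strings" for \<alpha>
  proof -
    have "Phi \<gamma> = Phi \<alpha>" if "(\<alpha>, \<gamma>) \<in> string_equiv" for \<gamma> using Phi_string_equiv[OF that] by simp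
    then have "Phi ` (string_equiv `` {\<alpha>}) = {Phi \<alpha>}" using refl[OF that] by blast
    then show ?thesis by (simp add: Phi_class_def)
  qed
  show "Phi_class \<in> hom string_semigroup (End_monoid free_group_F)"
  proof (rule homI)
    fix A assume "A \<in> carrier string_semigroup"
    then obtain \<alpha> where \<alpha>: "\<alpha> \<in> open_strings" "A = string_equiv `` {\<alpha>}"
      by (auto simp: string_semigroup_def elim: quotientE)
    then interpret A: open_string \<alpha> by unfold_locales
    show "Phi_class A \<in> carrier (End_monoid free_group_F)"
      unfolding \<alpha>(2) Phi_class[OF \<alpha>(1)] A.Phi_eq by (rule label_endo_in_carrier)
  next
    fix A B assume "A \<in> carrier string_semigroup" "B \<in> carrier string_semigroup"
    then obtain \<alpha> \<beta> where \<alpha>: "\<alpha> \<in> open_strings" "A = string_equiv `` {\<alpha>}" and \<beta>: "\<beta> \<in> open_strings" "B = string_equiv `` {\<beta>}"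
      by (auto simp: string_semigroup_def elim!: quotientE)
    let ?C = "A \<otimes>\<^bsub>string_semigroup\<^esub> B" and ?\<phi> = "Phi \<alpha> \<otimes>\<^bsub>End_monoid free_group_F\<^esub> Phi \<beta>"
    have C: "?C = {\<gamma>. \<exists>\<alpha>\<in>A. \<exists>\<beta>\<in>B. \<exists>R S. fits_strip R \<alpha> \<and> fits_strip S \<beta> \<and> (concatenate R S \<alpha> \<beta>, \<gamma>) \<in> string_equiv}"
      by (simp add: string_semigroup_def)
    \<comment> \<open>Independence of the representatives and of the widths \<open>R\<close>,
      \<open>S\<close>: any admissible concatenation in the two classes has the same value.\<close>
    have "Phi \<gamma> = ?\<phi>" if "\<gamma> \<in> ?C" for \<gamma>
    proof -
      obtain \<alpha>' \<beta>' R S where *: "(\<alpha>, \<alpha>') \<in> string_equiv" "(\<beta>, \<beta>') \<in> string_equiv" "fits_strip R \<alpha>'" "fits_strip S \<beta>'"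
        and \<gamma>: "(concatenate R S \<alpha>' \<beta>', \<gamma>) \<in> string_equiv"
        using \<open>\<gamma> \<in> ?C\<close> unfolding C unfolding \<alpha>(2) \<beta>(2) by blast
      have "\<alpha>' \<in> open_strings" "\<beta>' \<in> open_strings" using * by (auto simp: string_equiv_def)
      then interpret concatenation \<alpha>' \<beta>' R S using * by unfold_locales
      have "concatenate R S \<alpha>' \<beta>' \<in> open_strings" using \<gamma> by (auto simp: string_equiv_def)
      then show ?thesis
        using Phi_concatenate Phi_string_equiv[OF *(1)] Phi_string_equiv[OF *(2)] Phi_string_equiv[OF \<gamma>] by simp
    qed
    \<comment> \<open>\<open>Phi_class\<close> is defined by \<open>the_elem\<close>, so the product
      class must be inhabited; strips with a margin provide a concatenation that is again an open
      string.\<close>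
    moreover obtain \<gamma> where "\<gamma> \<in> ?C"
    proof -
      interpret A: open_string \<alpha> by unfold_locales (rule \<alpha>(1))
      interpret B: open_string \<beta> by unfold_locales (rule \<beta>(1))
      obtain R where R: "fits_strip R \<alpha>" "R \<ge> 1" "\<And>x. \<bar>x\<bar> \<ge> R - 1 \<Longrightarrow> fst \<alpha> x = (x, 0)" by (rule A.wide_strip) blast
      obtain S where S: "fits_strip S \<beta>" "S \<ge> 1" "\<And>x. \<bar>x\<bar> \<ge> S - 1 \<Longrightarrow> fst \<beta> x = (x, 0)" by (rule B.wide_strip) blast
      interpret concatenation \<alpha> \<beta> R S using R(1) S(1) by unfold_locales
      have "concatenate R S \<alpha> \<beta> \<in> open_strings" using concatenate_in_open_strings R S by blast
      then have "concatenate R S \<alpha> \<beta> \<in> ?C"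
        unfolding C unfolding \<alpha>(2) \<beta>(2) using refl \<alpha>(1) \<beta>(1) R(1) S(1) by blast
      then show ?thesis by (rule that)
    qed
    ultimately have "Phi ` ?C = {?\<phi>}"
      by (intro equalityI subsetI) (metis imageE singletonI, metis imageI singletonD)
    then have "Phi_class ?C = ?\<phi>" unfolding Phi_class_def[of ?C] by simp
    then show "Phi_class ?C = Phi_class A \<otimes>\<^bsub>End_monoid free_group_F\<^esub> Phi_class B"
      unfolding \<alpha>(2) \<beta>(2) Phi_class[OF \<alpha>(1)] Phi_class[OF \<beta>(1)] .
  qed
qed

end
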